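(* Let $u(t)$, $t\ge 0$, be the maximum expected length of an increasing sequence that can be selected by an online policy, within time horizon $t$, from the atoms of a unit rate planar Poisson point process $\Pi$ on $[0,\infty)\times[0,1]$. Then $$u(t)=\sqrt{2t}-\frac{1}{12}\log t+O(1)\qquad\text{as } t\to\infty .$$
   Context: Let $\Pi$ be a unit rate planar Poisson point process in $[0,\infty)\times[0,1]$. An atom $(s,x)$ of $\Pi$ is interpreted as an item of value $x$ observed at time $s$. A sequence of atoms $(s_1,x_1),\dots,(s_k,x_k)$ is increasing if $s_1<\cdots<s_k$ and $x_1<\cdots<x_k$. The information available at time $s$ is the configuration of $\Pi$ restricted to $[0,s]\times[0,1]$. An online policy with horizon $t$ is an increasing sequence of stopping times adapted to the natural filtration of the process $(\Pi_{|[0,s]\times[0,1]},\ s\ge 0)$, taking values in the set of arrival times of atoms in $[0,t]$ (or $\infty$ if no further selection is made), such that the atoms selected at these times form an increasing sequence. $u(t)$ is the maximum, over all such policies, of the expected number of selected atoms. It is known that $u$ is differentiable, increasing and concave on $[0,\infty)$ and is the unique solution of the dynamic programming equation $$u'(t)=\int_0^1\big(u(t(1-x))+1-u(t)\big)^+\,\mathrm{d}x,\quad t\ge0,\qquad u(0)=0,$$ where $y^+=\max(y,0)$. *)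

theory Defs
  imports "HOL-Probability.Probability" "HOL-Library.Landau_Symbols"
begin

text \<open>A point configuration is a subset of the strip \<open>[0,\<infinity>) \<times> [0,1]\<close>; the first coordinate of
  an atom is its arrival time, the second one its value.\<close>

definition strip :: "(real \<times> real) set" where
  "strip = {0..} \<times> {0..1}"

abbreviation num_atoms :: "('a \<Rightarrow> (real \<times> real) set) \<Rightarrow> (real \<times> real) set \<Rightarrow> 'a \<Rightarrow> nat" where
  "num_atoms X B \<omega> \<equiv> card (X \<omega> \<inter> B)"

text \<open>The Poisson law is written out because the library's \<open>poisson_pmf\<close> is only specified for a
  strictly positive rate, while \<open>B\<close> may be a Lebesgue null set here.\<close>

locale unit_poisson_process = prob_space M for M :: "'a measure" +
  fixes X :: "'a \<Rightarrow> (real \<times> real) set"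
  assumes atoms_in_strip: "\<And>\<omega>. \<omega> \<in> space M \<Longrightarrow> X \<omega> \<subseteq> strip"
    and locally_finite: "\<And>\<omega> B. \<omega> \<in> space M \<Longrightarrow> bounded B \<Longrightarrow> finite (X \<omega> \<inter> B)"
    and num_atoms_measurable:
      "\<And>B. B \<in> sets borel \<Longrightarrow> bounded B \<Longrightarrow> num_atoms X B \<in> M \<rightarrow>\<^sub>M count_space UNIV"
    and num_atoms_poisson:
      "\<And>B k. B \<in> sets borel \<Longrightarrow> bounded B \<Longrightarrow> B \<subseteq> strip \<Longrightarrow>
        prob {\<omega> \<in> space M. num_atoms X B \<omega> = k} =
          measure lborel B ^ k / fact k * exp (- measure lborel B)"
    and num_atoms_indep:
      "\<And>(I :: nat set) B. finite I \<Longrightarrow> disjoint_family_on B I \<Longrightarrow>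
        (\<And>i. i \<in> I \<Longrightarrow> B i \<in> sets borel \<and> bounded (B i) \<and> B i \<subseteq> strip) \<Longrightarrow>
        indep_vars (\<lambda>_. count_space UNIV) (\<lambda>i. num_atoms X (B i)) I"

text \<open>Time is indexed by \<open>ennreal\<close>, so that stopping times may take the value \<open>\<infinity>\<close>.\<close>

definition natural_filtration ::
    "'a measure \<Rightarrow> ('a \<Rightarrow> (real \<times> real) set) \<Rightarrow> ennreal \<Rightarrow> 'a measure" where
  "natural_filtration M X s = sigma (space M)
     {{\<omega> \<in> space M. num_atoms X B \<omega> = k} | B k.
        B \<in> sets borel \<and> bounded B \<and> B \<subseteq> {p \<in> strip. ennreal (fst p) \<le> s}}"

definition increasing_atoms :: "(real \<times> real) set \<Rightarrow> bool" where
  "increasing_atoms S \<longleftrightarrow>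
     (\<forall>p\<in>S. \<forall>q\<in>S. p \<noteq> q \<longrightarrow>
        (fst p < fst q \<and> snd p < snd q) \<or> (fst q < fst p \<and> snd q < snd p))"

definition selected_atoms ::
    "('a \<Rightarrow> (real \<times> real) set) \<Rightarrow> (nat \<Rightarrow> 'a \<Rightarrow> ennreal) \<Rightarrow> 'a \<Rightarrow> (real \<times> real) set" where
  "selected_atoms X \<tau> \<omega> = {p \<in> X \<omega>. \<exists>i. \<tau> i \<omega> = ennreal (fst p)}"

text \<open>The time \<open>\<tau> i\<close> is that of the \<open>i\<close>-th selection, with \<open>\<tau> i = \<infinity>\<close> if there are at most \<open>i\<close>
  selections. The sequence increases strictly as long as it is finite.
  Almost surely no two atoms arrive simultaneously, so \<open>\<tau> i\<close> determines the selected atom.\<close>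

definition online_policy ::
    "'a measure \<Rightarrow> ('a \<Rightarrow> (real \<times> real) set) \<Rightarrow> real \<Rightarrow> (nat \<Rightarrow> 'a \<Rightarrow> ennreal) \<Rightarrow> bool" where
  "online_policy M X t \<tau> \<longleftrightarrow>
     (\<forall>i. stopping_time (natural_filtration M X) (\<tau> i)) \<and>
     (AE \<omega> in M.
        (\<forall>i. \<tau> i \<omega> < \<tau> (Suc i) \<omega> \<or> \<tau> (Suc i) \<omega> = \<infinity>) \<and>
        (\<forall>i. \<tau> i \<omega> = \<infinity> \<or> (\<exists>p\<in>X \<omega>. fst p \<le> t \<and> \<tau> i \<omega> = ennreal (fst p))) \<and>
        increasing_atoms (selected_atoms X \<tau> \<omega>))"

definition expected_length :: "'a measure \<Rightarrow> (nat \<Rightarrow> 'a \<Rightarrow> ennreal) \<Rightarrow> ennreal" where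
  "expected_length M \<tau> = (\<integral>\<^sup>+ \<omega>. (\<Sum>i. indicator {\<omega>. \<tau> i \<omega> < \<infinity>} \<omega>) \<partial>M)"

definition online_value :: "'a measure \<Rightarrow> ('a \<Rightarrow> (real \<times> real) set) \<Rightarrow> real \<Rightarrow> real" where
  "online_value M X t = enn2real (SUP \<tau> \<in> {\<tau>. online_policy M X t \<tau>}. expected_length M \<tau>)"

end

theory Submission
  imports Defs "HOL-Real_Asymp.Real_Asymp"
begin

text \<open>
  If \<open>y\<close> is the last selected value at time \<open>s\<close>, the remaining problem is a copy of the original one
  with horizon \<open>z = (t - s) (1 - y)\<close>. Hence, for a function \<open>g\<close> with
  \<open>g'(z) \<ge> \<integral>\<^sub>0\<^sup>1 (1 + g (z (1 - x)) - g z)\<^sup>+ dx\<close>, the number of selections so far plus \<open>g z\<close> is a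
  supermartingale under every policy, and \<open>g t - g 0\<close> bounds the value from above. Dually, if
  \<open>h'(z) \<le> \<integral>\<^sub>0\<^bsup>\<phi> z\<^esup> (1 + h (z (1 - x)) - h z) dx\<close>, then the policy that accepts an atom iff the relative
  increase of the value is at most \<open>\<phi> z\<close> achieves at least \<open>h t - h 0\<close>. Both claims follow by
  telescoping along a path and the compensator formula for predictable integrands, so neither
  the dynamic programming equation nor an optimal policy is needed.

  The function \<open>G t = \<surd>(2 (t + 1)) - ln (t + 1) / 12\<close> satisfies both inequalities up to an error of order
  \<open>t\<^bsup>-3/2\<^esup>\<close>, with acceptance width close to \<open>\<surd>(2/t)\<close>. The error is absorbed by adding or subtracting
  an increasing bounded function with derivative of that order.
\<close>

subsection \<open>Approximate solutions of the dynamic programming equation\<close>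

text \<open>The constant 1/12 comes from matching coefficients. For a trial solution
  \<open>sqrt (2 * z) + b * ln z\<close> put \<open>w = sqrt (2 * z)\<close>. Up to smaller terms
  the integrand is 1 - (w/2 + b) x - (w/8) x^2, its zero lies near 2/w, and its integral up to there
  is 1/w - (1/3 + 2 b)/w^2 + O(w^-3). The derivative of the trial solution is 1/w + 2 b/w^2, so
  equality forces b = -1/12. The next order, w^-3, is integrable in z at infinity, which is why it
  costs only O(1). The shift to \<open>t + 1\<close> keeps the logarithm and the derivatives finite
  at 0; this matters because the remaining area along every path reaches 0 at the horizon.

  The probabilistic part works in [0, infinity], where subtraction is delicate. Each pathwise
  estimate is therefore a two-sided sum, with the gains collected at atoms on one side and the
  corresponding area integral on the other. The two have equal expectations and are cancelled only
  after the area has been shown to have finite expectation.\<close>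

definition approx_value :: "real \<Rightarrow> real" where
  "approx_value t = sqrt (2 * (t + 1)) - 1 / 12 * ln (t + 1)"

definition approx_value_deriv :: "real \<Rightarrow> real" where
  "approx_value_deriv t = 1 / sqrt (2 * (t + 1)) - 1 / (12 * (t + 1))"

text \<open>The exponent 3/2 in its derivative exceeds 1, so the function is bounded. It is
  normalised to vanish at 0, and its supremum is \<open>2 * C\<close>.\<close>

definition correction :: "real \<Rightarrow> real \<Rightarrow> real" where
  "correction C t = 2 * C * (1 - 1 / sqrt (t + 1))"

definition correction_deriv :: "real \<Rightarrow> real \<Rightarrow> real" where
  "correction_deriv C t = C / sqrt (t + 1) ^ 3"

lemma approx_value_has_derivative:
  assumes "t \<ge> 0"
  shows "(approx_value has_real_derivative approx_value_deriv t) (at t)"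
proof -
  have "((\<lambda>t. sqrt (2 * (t + 1))) has_real_derivative 1 / sqrt (2 * (t + 1))) (at t)"
    using assms by (auto intro!: derivative_eq_intros simp: field_simps)
  moreover have "((\<lambda>t. ln (t + 1)) has_real_derivative 1 / (t + 1)) (at t)"
    using assms by (auto intro!: derivative_eq_intros)
  ultimately have "((\<lambda>t. sqrt (2 * (t + 1)) - 1 / 12 * ln (t + 1)) has_real_derivative
      1 / sqrt (2 * (t + 1)) - 1 / 12 * (1 / (t + 1))) (at t)"
    by (intro DERIV_diff DERIV_cmult)
  then show ?thesis
    unfolding approx_value_def[abs_def] approx_value_deriv_def by simp
qed

lemma correction_has_derivative:
  assumes "t \<ge> 0"
  shows "(correction C has_real_derivative correction_deriv C t) (at t)"
proof -
  have "sqrt (t + 1) > 0"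
    using assms by simp
  then show ?thesis
    using assms unfolding correction_def[abs_def] correction_deriv_def
    by (auto intro!: derivative_eq_intros simp: field_simps power3_eq_cube)
qed

lemma correction_mono:
  assumes "0 \<le> s" "s \<le> t" "0 \<le> C"
  shows "correction C s \<le> correction C t"
  using assms unfolding correction_def
  by (intro mult_left_mono) (auto intro!: divide_left_mono)

lemma correction_bounds:
  assumes "0 \<le> t" "0 \<le> C"
  shows "0 \<le> correction C t" "correction C t \<le> 2 * C"
proof -
  show "0 \<le> correction C t"
    using assms unfolding correction_def by (auto simp: divide_simps)
  show "correction C t \<le> 2 * C"
    using assms unfolding correction_def by (simp add: mult_left_le)
qed

lemma approx_value_deriv_bounds:
  assumes "0 \<le> t"
  shows "0 \<le> approx_value_deriv t" "approx_value_deriv t \<le> 1"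
proof -
  \<comment> \<open>In this variable the derivative is a rational function; all later expansions are
    in powers of 1/w.\<close>
  define w where "w = sqrt (2 * (t + 1))"
  have w: "w \<ge> 1"
    using assms by (simp add: w_def)
  have "w\<^sup>2 = 2 * (t + 1)"
    using assms by (simp add: w_def)
  then have eq: "approx_value_deriv t = 1 / w - 1 / (6 * w\<^sup>2)"
    by (simp add: approx_value_deriv_def w_def)
  have "w \<le> 6 * w\<^sup>2"
    using w by (simp add: power2_eq_square)
  then show "0 \<le> approx_value_deriv t"
    unfolding eq using w by (auto intro!: divide_left_mono)
  have "1 / w \<le> 1" "0 \<le> 1 / (6 * w\<^sup>2)"
    using w by auto
  then show "approx_value_deriv t \<le> 1"
    unfolding eq by linarith
qed

lemma approx_value_mono:
  assumes "0 \<le> s" "s \<le> t"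
  shows "approx_value s \<le> approx_value t"
proof (rule DERIV_nonneg_imp_nondecreasing[OF assms(2)])
  fix x assume "s \<le> x" "x \<le> t"
  then show "\<exists>y. (approx_value has_real_derivative y) (at x) \<and> 0 \<le> y"
    using assms approx_value_has_derivative[of x] approx_value_deriv_bounds(1)[of x] by auto
qed

text \<open>The integrand is integrated up to its zero, where \<open>s\<^sup>3\<close> with \<open>s = a x\<close> is replaced by its tangent at \<open>1\<close>.\<close>
lemma nn_integral_quadratic_le:
  fixes a k :: real
  assumes a: "a > 0" and k: "k \<ge> 0"
  shows "(\<integral>\<^sup>+x\<in>{0..}. ennreal (1 - a * x - k * (a * x)\<^sup>2) \<partial>lborel)
           \<le> ennreal ((1 / 2 - k / 3 + k\<^sup>2 / 2) / a)"
proof -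
  let ?p = "\<lambda>x::real. 1 - a * x - k * (a * x)\<^sup>2"
  let ?P = "\<lambda>x::real. ((a * x) - (a * x)\<^sup>2 / 2 - k * (a * x) ^ 3 / 3) / a"
  \<comment> \<open>At \<open>1 / a\<close> the quadratic equals \<open>- k \<le> 0\<close>, so its
    zero lies between 0 and \<open>1 / a\<close>.\<close>
  have "\<exists>x\<ge>0. x \<le> 1 / a \<and> ?p x = 0"
    using a k by (intro IVT2') (auto intro!: continuous_intros)
  then obtain r where r: "r \<ge> 0" "?p r = 0"
    by auto
  have anti: "?p y \<le> ?p x" if "0 \<le> x" "x \<le> y" for x y
    using that a k by (intro diff_mono mult_left_mono power_mono) auto
  have "(\<integral>\<^sup>+x\<in>{0..}. ennreal (?p x) \<partial>lborel) = (\<integral>\<^sup>+x. ennreal (?p x) * indicator {0..r} x \<partial>lborel)"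
  proof (intro nn_integral_cong)
    fix x :: real
    show "ennreal (?p x) * indicator {0..} x = ennreal (?p x) * indicator {0..r} x"
    proof (cases "r < x")
      case True
      then have "ennreal (?p x) = 0"
        using anti[of r x] r by (intro ennreal_neg) auto
      then show ?thesis
        by simp
    qed (auto simp: indicator_def)
  qed
  also have "\<dots> = ennreal (?P r - ?P 0)"
  proof (rule nn_integral_FTC_Icc[where F = ?P])
    show "?p \<in> borel_measurable borel"
      by measurable
    show "(?P has_real_derivative ?p x) (at x)" for x
      using a by (auto intro!: derivative_eq_intros simp: power2_eq_square power3_eq_cube field_simps)
    show "0 \<le> ?p x" if "x \<in> {0..r}" for x
      using anti[of x r] that r by simp
  qed (use r in auto)
  also have "\<dots> \<le> ennreal ((1 / 2 - k / 3 + k\<^sup>2 / 2) / a)"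
  proof (rule ennreal_leI)
    define s where "s = a * r"
    have s: "s \<ge> 0"
      using a r by (auto simp: s_def)
    have "s ^ 3 - 3 * s + 2 = (s - 1)\<^sup>2 * (s + 2)"
      by (simp add: power2_eq_square power3_eq_cube algebra_simps)
    then have "s ^ 3 \<ge> 3 * s - 2"
      using s by (smt (verit) mult_nonneg_nonneg zero_le_power2)
    then have "k * s ^ 3 \<ge> k * (3 * s - 2)"
      using k by (intro mult_left_mono)
    then have "s - s\<^sup>2 / 2 - k * s ^ 3 / 3 \<le> s - s\<^sup>2 / 2 - k * (3 * s - 2) / 3"
      by linarith
    \<comment> \<open>Completing the square removes the root: whatever \<open>s\<close> is, the
      value is at most that at \<open>s = 1 - k\<close>.\<close>
    also have "\<dots> = (1 - k)\<^sup>2 / 2 + 2 * k / 3 - (s - (1 - k))\<^sup>2 / 2"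
      by (simp add: power2_eq_square field_simps)
    also have "\<dots> \<le> (1 - k)\<^sup>2 / 2 + 2 * k / 3"
      by simp
    also have "\<dots> = 1 / 2 - k / 3 + k\<^sup>2 / 2"
      by (simp add: power2_eq_square field_simps)
    finally show "?P r - ?P 0 \<le> (1 / 2 - k / 3 + k\<^sup>2 / 2) / a"
      unfolding s_def[symmetric] using a by (simp add: divide_right_mono)
  qed
  finally show ?thesis .
qed

section \<open>Elementary bounds for the square root and the logarithm\<close>

lemma sqrt_one_minus_le:
  fixes y :: real
  assumes "0 \<le> y" "y \<le> 1"
  shows "sqrt (1 - y) \<le> 1 - y / 2 - y\<^sup>2 / 8"
proof (rule real_le_lsqrt)
  have "y\<^sup>2 \<le> 1"
    using assms by (simp add: power_le_one)
  then show "0 \<le> 1 - y / 2 - y\<^sup>2 / 8"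
    using assms by simp
  have "(1 - y / 2 - y\<^sup>2 / 8)\<^sup>2 = 1 - y + y ^ 3 / 8 + y ^ 4 / 64"
    by (simp add: power2_eq_square power3_eq_cube eval_nat_numeral field_simps)
  then show "1 - y \<le> (1 - y / 2 - y\<^sup>2 / 8)\<^sup>2"
    using assms by simp
qed

text \<open>The cubic coefficient 1/8 is twice the Taylor coefficient 1/16. The slack makes the
  square fall below \<open>1 - y\<close> on the whole interval up to 1/2.\<close>

lemma sqrt_one_minus_ge:
  fixes y :: real
  assumes "0 \<le> y" "y \<le> 1 / 2"
  shows "1 - y / 2 - y\<^sup>2 / 8 - y ^ 3 / 8 \<le> sqrt (1 - y)"
proof (rule real_le_rsqrt)
  have "(1 - y / 2 - y\<^sup>2 / 8 - y ^ 3 / 8)\<^sup>2 = 1 - y - y ^ 3 / 8 * (1 - 9/8 * y - y\<^sup>2 / 4 - y ^ 3 / 8)"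
    by (simp add: power2_eq_square power3_eq_cube eval_nat_numeral field_simps)
  moreover have "y\<^sup>2 \<le> (1/2)\<^sup>2" "y ^ 3 \<le> (1/2) ^ 3"
    using assms by (auto intro!: power_mono)
  then have "1 - 9/8 * y - y\<^sup>2 / 4 - y ^ 3 / 8 \<ge> 0"
    using assms by (simp add: power2_eq_square power3_eq_cube)
  then have "y ^ 3 / 8 * (1 - 9/8 * y - y\<^sup>2 / 4 - y ^ 3 / 8) \<ge> 0"
    using assms by (intro mult_nonneg_nonneg) auto
  ultimately show "(1 - y / 2 - y\<^sup>2 / 8 - y ^ 3 / 8)\<^sup>2 \<le> 1 - y"
    by linarith
qed

lemma minus_ln_one_minus_le:
  fixes y :: real
  assumes "0 \<le> y" "y \<le> 1 / 2"
  shows "- ln (1 - y) \<le> y + 2 * y\<^sup>2"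
  using ln_one_minus_pos_lower_bound[OF assms] by linarith

text \<open>The shift by 1 is compatible with scaling:
  \<open>z * (1 - x) + 1 = (z + 1) * (1 - y)\<close>, so the root factors and the logarithm splits
  exactly. The difference then depends on \<open>z\<close> only through \<open>w\<close> and
  \<open>y\<close>.\<close>

lemma approx_value_diff:
  assumes "z \<ge> 0" "0 \<le> x" "x \<le> 1"
  defines "w \<equiv> sqrt (2 * (z + 1))" and "y \<equiv> x * (z / (z + 1))"
  shows "1 + approx_value (z * (1 - x)) - approx_value z =
           1 - w * (1 - sqrt (1 - y)) - 1 / 12 * ln (1 - y)"
proof -
  have eq: "z * (1 - x) + 1 = (z + 1) * (1 - y)"
    using assms by (simp add: y_def field_simps)
  have "z * (1 - x) \<ge> 0"
    using assms by simp
  then have pos: "(z + 1) * (1 - y) > 0"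
    using eq by linarith
  then have y: "1 - y > 0"
    using assms(1) by (simp add: zero_less_mult_iff)
  have e1: "sqrt (2 * ((z + 1) * (1 - y))) = w * sqrt (1 - y)"
    unfolding w_def real_sqrt_mult[symmetric] by (simp add: mult_ac)
  have e2: "ln ((z + 1) * (1 - y)) = ln (z + 1) + ln (1 - y)"
    using assms(1) y by (simp add: ln_mult)
  show ?thesis
    unfolding approx_value_def eq w_def[symmetric] e1 e2 by (simp add: algebra_simps)
qed

text \<open>For large \<open>w\<close> the integrand is dominated by a quadratic where
  \<open>y \<le> 1 / 2\<close> and is nonpositive elsewhere, which reduces the claim to
  \<open>nn_integral_quadratic_le\<close>. For small \<open>w\<close> the integral is at most 1, and
  a large \<open>C\<close> suffices.\<close>

lemma approx_value_supersolution:
  obtains C where "C \<ge> 0" "\<And>z. z \<ge> 0 \<Longrightarrow>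
    (\<integral>\<^sup>+x\<in>{0..1}. ennreal (1 + approx_value (z * (1 - x)) - approx_value z) \<partial>lborel)
      \<le> ennreal (approx_value_deriv z + correction_deriv C z)"
proof -
  \<comment> \<open>The factor \<open>1 - 2 / w\<^sup>2\<close> is \<open>z / (z + 1)\<close>, so
    \<open>a w * x = (w / 2 - 1 / 12) * y\<close>, and \<open>k w\<close> is the quadratic
    coefficient in this variable. The 1/6 is the term \<open>2 * y\<^sup>2\<close> of the logarithm
    bound divided by 12.\<close>
  define a where "a = (\<lambda>w::real. (w / 2 - 1 / 12) * (1 - 2 / w\<^sup>2))"
  define k where "k = (\<lambda>w::real. (w / 8 - 1 / 6) / (w / 2 - 1 / 12) / (w / 2 - 1 / 12))"
  define B where "B = (\<lambda>w. (1 / 2 - k w / 3 + (k w)\<^sup>2 / 2) / a w)"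
  \<comment> \<open>Agreement in both the 1/w and the 1/w^2 term is what singles out the constant
    1/12.\<close>
  have "(\<lambda>w. B w - (1 / w - 1 / (6 * w\<^sup>2))) \<in> O[at_top](\<lambda>w. 1 / w ^ 3)"
    unfolding B_def a_def k_def by real_asymp
  then obtain c where c: "eventually (\<lambda>w. norm (B w - (1 / w - 1 / (6 * w\<^sup>2))) \<le> c * norm (1 / w ^ 3)) at_top"
    by (elim landau_o.bigE)
  \<comment> \<open>For \<open>y > 1 / 2\<close> the square root loses a fixed multiple of
    \<open>w\<close>, while the logarithm gains at most
    \<open>ln (z + 1) = ln (w\<^sup>2 / 2)\<close> over 12.\<close>
  moreover have "eventually (\<lambda>w::real. 1 - w * (1 - sqrt (1 / 2)) + 1 / 12 * ln (w\<^sup>2 / 2) \<le> 0) at_top"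
    by real_asymp
  moreover have "eventually (\<lambda>w::real. w \<ge> 2) at_top"
    by (rule eventually_ge_at_top)
  ultimately have "eventually (\<lambda>w. B w \<le> 1 / w - 1 / (6 * w\<^sup>2) + c / w ^ 3 \<and>
      1 - w * (1 - sqrt (1 / 2)) + 1 / 12 * ln (w\<^sup>2 / 2) \<le> 0 \<and> w \<ge> 2) at_top"
    by eventually_elim auto
  then obtain w0 where w0: "\<And>w. w \<ge> w0 \<Longrightarrow> B w \<le> 1 / w - 1 / (6 * w\<^sup>2) + c / w ^ 3"
      "\<And>w. w \<ge> w0 \<Longrightarrow> 1 - w * (1 - sqrt (1 / 2)) + 1 / 12 * ln (w\<^sup>2 / 2) \<le> 0"
      "\<And>w. w \<ge> w0 \<Longrightarrow> w \<ge> 2"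
    unfolding eventually_at_top_linorder by blast
  \<comment> \<open>The cube makes \<open>correction_deriv C z \<ge> 1\<close> when
    \<open>w < w0\<close>; the other summand absorbs the remainder \<open>c / w ^ 3\<close> when
    \<open>w \<ge> w0\<close>.\<close>
  define C where "C = \<bar>w0\<bar> ^ 3 + \<bar>c\<bar>"
  have "(\<integral>\<^sup>+x\<in>{0..1}. ennreal (1 + approx_value (z * (1 - x)) - approx_value z) \<partial>lborel)
      \<le> ennreal (approx_value_deriv z + correction_deriv C z)" if z: "z \<ge> 0" for z
  proof -
    define w where "w = sqrt (2 * (z + 1))"
    define v where "v = sqrt (z + 1)"
    have v: "v \<ge> 1" and wv: "w = sqrt 2 * v"
      using z by (simp add: v_def) (simp only: w_def v_def real_sqrt_mult)
    have "sqrt 2 \<ge> 1"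
      by simp
    then have vw: "v \<le> w"
      unfolding wv using v by (simp add: mult_le_cancel_right1)
    have w2: "w\<^sup>2 = 2 * (z + 1)" and w_pos: "w > 0"
      using z by (auto simp: w_def)
    show ?thesis
    proof (cases "w \<ge> w0")
      case False
      have "(\<integral>\<^sup>+x\<in>{0..1}. ennreal (1 + approx_value (z * (1 - x)) - approx_value z) \<partial>lborel) \<le>
          (\<integral>\<^sup>+x. indicator {0..1::real} x \<partial>lborel)"
      proof (intro nn_integral_mono)
        fix x :: real
        have "approx_value (z * (1 - x)) \<le> approx_value z" if "x \<in> {0..1}"
          using that z by (intro approx_value_mono) (auto simp: mult_left_le)
        then show "ennreal (1 + approx_value (z * (1 - x)) - approx_value z) * indicator {0..1} x
            \<le> indicator {0..1} x"
          by (auto simp: indicator_def)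
      qed
      also have "\<dots> = ennreal 1"
        by simp
      also have "\<dots> \<le> ennreal (approx_value_deriv z + correction_deriv C z)"
      proof (rule ennreal_leI)
        have "v \<le> \<bar>w0\<bar>"
          using False vw by linarith
        then have "v ^ 3 \<le> \<bar>w0\<bar> ^ 3"
          using v by (intro power_mono) auto
        also have "\<dots> \<le> C"
          by (simp add: C_def)
        finally have "1 \<le> correction_deriv C z"
          unfolding correction_deriv_def v_def[symmetric] using v by (simp add: le_divide_eq)
        then show "1 \<le> approx_value_deriv z + correction_deriv C z"
          using approx_value_deriv_bounds[OF z] by linarith
      qed
      finally show ?thesis .
    next
      case True
      have w: "w \<ge> 2"
        using w0(3) True by simp
      have \<rho>: "z / (z + 1) = 1 - 2 / w\<^sup>2"
        using z by (simp add: w2 field_simps)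
      have "w\<^sup>2 \<ge> 2\<^sup>2"
        using w by (intro power_mono) auto
      then have \<rho>_pos: "1 - 2 / w\<^sup>2 > 0" "1 - 2 / w\<^sup>2 \<le> 1"
        using w by (auto simp: field_simps)
      have a: "a w > 0" and k: "k w \<ge> 0"
        using w \<rho>_pos by (auto simp: a_def k_def)
      have "(\<integral>\<^sup>+x\<in>{0..1}. ennreal (1 + approx_value (z * (1 - x)) - approx_value z) \<partial>lborel) \<le>
          (\<integral>\<^sup>+x\<in>{0..}. ennreal (1 - a w * x - k w * (a w * x)\<^sup>2) \<partial>lborel)"
      proof (intro nn_integral_mono)
        fix x :: real
        have "ennreal (1 + approx_value (z * (1 - x)) - approx_value z) \<le> ennreal (1 - a w * x - k w * (a w * x)\<^sup>2)"
          if x: "x \<in> {0..1}"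
        proof -
          define y where "y = x * (z / (z + 1))"
          have y0: "y \<ge> 0"
            using x z by (simp add: y_def)
          have y1: "y \<le> z / (z + 1)"
            using x z mult_left_le_one_le[of "z / (z + 1)" x] by (auto simp: y_def)
          have F: "1 + approx_value (z * (1 - x)) - approx_value z =
              1 - w * (1 - sqrt (1 - y)) - 1 / 12 * ln (1 - y)"
            unfolding w_def y_def using x z by (intro approx_value_diff) auto
          show ?thesis
          proof (cases "y \<le> 1 / 2")
            case True
            have "w * sqrt (1 - y) \<le> w * (1 - y / 2 - y\<^sup>2 / 8)"
              using y0 True w_pos by (intro mult_left_mono sqrt_one_minus_le) auto
            then have "1 - w * (1 - sqrt (1 - y)) - 1 / 12 * ln (1 - y)
                \<le> 1 - w * (y / 2 + y\<^sup>2 / 8) + 1 / 12 * (y + 2 * y\<^sup>2)"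
              using minus_ln_one_minus_le[OF y0 True] by (simp add: algebra_simps)
            also have "\<dots> = 1 - (w / 2 - 1 / 12) * y - (w / 8 - 1 / 6) * y\<^sup>2"
              by (simp add: algebra_simps)
            also have "\<dots> = 1 - a w * x - k w * (a w * x)\<^sup>2"
            proof -
              have "a w * x = (w / 2 - 1 / 12) * y"
                by (simp add: a_def y_def \<rho> mult_ac)
              moreover have "w / 2 - 1 / 12 \<noteq> 0"
                using w by simp
              then have "k w * ((w / 2 - 1 / 12) * (w / 2 - 1 / 12)) = w / 8 - 1 / 6"
                unfolding k_def by (simp only: divide_divide_eq_left nonzero_eq_divide_eq[symmetric] mult_eq_0_iff simp_thms not_False_eq_True)
              then have "k w * ((w / 2 - 1 / 12) * (w / 2 - 1 / 12)) * (y * y) = (w / 8 - 1 / 6) * (y * y)"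
                by (rule arg_cong)
              then have "k w * ((w / 2 - 1 / 12) * y)\<^sup>2 = (w / 8 - 1 / 6) * y\<^sup>2"
                by (simp only: power2_eq_square mult_ac)
              ultimately show ?thesis
                by simp
            qed
            finally show ?thesis
              unfolding F by (rule ennreal_leI)
          next
            case False
            have "1 / (z + 1) = 1 - z / (z + 1)"
              using z by (simp add: field_simps)
            then have le: "1 / (z + 1) \<le> 1 - y"
              using y1 by linarith
            have "1 / (z + 1) > 0"
              using z by simp
            then have "ln (1 / (z + 1)) \<le> ln (1 - y)"
              using le by (intro ln_mono) auto
            then have "- ln (1 - y) \<le> ln (w\<^sup>2 / 2)"
            proof -
              have "w\<^sup>2 / 2 = z + 1"
                by (simp add: w2)
              then show ?thesis
                using \<open>ln (1 / (z + 1)) \<le> ln (1 - y)\<close> z by (simp only:) (simp add: ln_div)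
            qed
            moreover have "w * sqrt (1 - y) \<le> w * sqrt (1 / 2)"
              using False w_pos by (intro mult_left_mono) (auto simp del: real_sqrt_divide)
            ultimately have "1 - w * (1 - sqrt (1 - y)) - 1 / 12 * ln (1 - y) \<le> 0"
              using w0(2)[OF \<open>w \<ge> w0\<close>] by (simp add: right_diff_distrib)
            then show ?thesis
              unfolding F by (simp add: ennreal_neg)
          qed
        qed
        then show "ennreal (1 + approx_value (z * (1 - x)) - approx_value z) * indicator {0..1} x
            \<le> ennreal (1 - a w * x - k w * (a w * x)\<^sup>2) * indicator {0..} x"
          by (auto simp: indicator_def)
      qed
      also have "\<dots> \<le> ennreal (B w)"
        unfolding B_def by (rule nn_integral_quadratic_le[OF a k])
      also have "\<dots> \<le> ennreal (approx_value_deriv z + correction_deriv C z)"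
      proof (rule ennreal_leI)
        have "0 \<le> \<bar>w0\<bar> ^ 3"
          by simp
        then have "c / w ^ 3 \<le> C / w ^ 3"
          using w_pos unfolding C_def by (intro divide_right_mono) (linarith, simp)
        also have "\<dots> \<le> C / v ^ 3"
          using v vw unfolding C_def by (intro divide_left_mono power_mono) auto
        finally have "c / w ^ 3 \<le> correction_deriv C z"
          by (simp add: correction_deriv_def v_def)
        moreover have "approx_value_deriv z = 1 / w - 1 / (6 * w\<^sup>2)"
          unfolding approx_value_deriv_def w2 by (simp add: w_def)
        ultimately show "B w \<le> approx_value_deriv z + correction_deriv C z"
          using w0(1)[OF True] by linarith
      qed
      finally show ?thesis .
    qed
  qed
  moreover have "C \<ge> 0"
    by (simp add: C_def)
  ultimately show ?thesis
    by (rule that[rotated])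
qed

text \<open>The integrand vanishes near 2/w - 2/(3 w^2). The simpler value 2/(w + 1) lies below this
  root for large \<open>w\<close>, so the integrand is still nonnegative there, and missing the root
  by O(w^-2) costs only O(w^-3) in the integral. Below \<open>t0\<close> the sign is not controlled
  and nothing is accepted.\<close>

definition acceptance_width :: "real \<Rightarrow> real \<Rightarrow> real" where
  "acceptance_width t0 z = (if z < t0 then 0 else 2 / (sqrt (2 * (z + 1)) + 1))"

lemma acceptance_width_measurable [measurable]:
  "acceptance_width t0 \<in> borel_measurable borel"
  unfolding acceptance_width_def[abs_def] by measurable

lemma acceptance_width_le_1:
  assumes "z \<ge> 0"
  shows "acceptance_width t0 z \<le> 1"
proof -
  have "sqrt (2 * (z + 1)) \<ge> 1"
    using assms by simp
  then show ?thesis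
    by (auto simp: acceptance_width_def simp del: distrib_left_numeral real_sqrt_ge_1_iff)
qed

text \<open>A polynomial minorant \<open>L\<close> of the integrand is decreasing, so its sign need
  only be checked at the end of the window, and its primitive \<open>P\<close> there has the
  expansion of \<open>approx_value_deriv\<close> up to O(w^-3). Below \<open>t0\<close> the
  correction makes the left-hand side nonpositive.\<close>

lemma approx_value_subsolution:
  obtains C t0 where "C \<ge> 0"
    "\<And>z x. z \<ge> 0 \<Longrightarrow> x \<in> {0<..acceptance_width t0 z} \<Longrightarrow>
      0 \<le> 1 + approx_value (z * (1 - x)) - approx_value z"
    "\<And>z. z \<ge> 0 \<Longrightarrow> ennreal (approx_value_deriv z - correction_deriv C z) \<le>
      (\<integral>\<^sup>+x\<in>{0<..acceptance_width t0 z}.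
        ennreal (1 + approx_value (z * (1 - x)) - approx_value z) \<partial>lborel)"
proof -
  define \<theta> where "\<theta> = (\<lambda>w::real. 2 / (w + 1))"
  \<comment> \<open>The cubic lower bound for the root is combined with
    \<open>- ln (1 - y) \<ge> y\<close>.\<close>
  define L where "L = (\<lambda>w y::real. 1 - (w / 2 - 1 / 12) * y - w / 8 * y\<^sup>2 - w / 8 * y ^ 3)"
  define P where "P = (\<lambda>w y::real. y - (w / 2 - 1 / 12) * y\<^sup>2 / 2 - w / 24 * y ^ 3 - w / 32 * y ^ 4)"
  have "(\<lambda>w. P w (\<theta> w) - (1 / w - 1 / (6 * w\<^sup>2))) \<in> O[at_top](\<lambda>w. 1 / w ^ 3)"
    unfolding P_def \<theta>_def by real_asymp
  then obtain c where c: "eventually (\<lambda>w. norm (P w (\<theta> w) - (1 / w - 1 / (6 * w\<^sup>2))) \<le> c * norm (1 / w ^ 3)) at_top"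
    by (elim landau_o.bigE)
  moreover have "eventually (\<lambda>w. L w (\<theta> w) \<ge> 0) at_top"
    unfolding L_def \<theta>_def by real_asymp
  moreover have "eventually (\<lambda>w::real. w \<ge> 3) at_top"
    by (rule eventually_ge_at_top)
  ultimately have "eventually (\<lambda>w. 1 / w - 1 / (6 * w\<^sup>2) - c / w ^ 3 \<le> P w (\<theta> w) \<and> L w (\<theta> w) \<ge> 0 \<and> w \<ge> 3) at_top"
  proof eventually_elim
    case (elim w)
    then have "norm (1 / w ^ 3) = 1 / w ^ 3"
      by simp
    with elim show ?case
      unfolding real_norm_def by (simp add: abs_le_iff)
  qed
  then obtain w0 where w0: "\<And>w. w \<ge> w0 \<Longrightarrow> 1 / w - 1 / (6 * w\<^sup>2) - c / w ^ 3 \<le> P w (\<theta> w)"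
      "\<And>w. w \<ge> w0 \<Longrightarrow> L w (\<theta> w) \<ge> 0" "\<And>w. w \<ge> w0 \<Longrightarrow> w \<ge> 3"
    unfolding eventually_at_top_linorder by blast
  have w0_3: "w0 \<ge> 3"
    using w0(3)[of w0] by simp
  define C where "C = w0 ^ 3 + \<bar>c\<bar>"
  have lower: "L w x \<le> 1 + approx_value (z * (1 - x)) - approx_value z" "0 \<le> L w x"
    if z: "z \<ge> 0" and w: "w = sqrt (2 * (z + 1))" "w \<ge> w0" and x: "x \<in> {0..\<theta> w}" for z w x
  proof -
    have w3: "w \<ge> 3"
      using w w0 by simp
    have "\<theta> w \<le> 1 / 2"
      using w3 by (simp add: \<theta>_def field_simps)
    then have x2: "0 \<le> x" "x \<le> 1 / 2"
      using x by auto
    have L_anti: "L w b \<le> L w a" if "0 \<le> a" "a \<le> b" for a b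
      using that w3 unfolding L_def by (intro diff_mono mult_left_mono power_mono) auto
    show "0 \<le> L w x"
      using L_anti[of x "\<theta> w"] w0(2)[OF w(2)] x by simp
    define y where "y = x * (z / (z + 1))"
    have y: "0 \<le> y" "y \<le> x"
      using x2 z mult_left_le[of "z / (z + 1)" x] by (auto simp: y_def)
    \<comment> \<open>Since \<open>L\<close> decreases, replacing \<open>y\<close> by the larger
      \<open>x\<close> errs in the favourable direction and removes the factor
      \<open>z / (z + 1)\<close>.\<close>
    have "L w x \<le> L w y"
      using y by (intro L_anti)
    also have "\<dots> \<le> 1 - w * (1 - sqrt (1 - y)) - 1 / 12 * ln (1 - y)"
    proof -
      have "w * (1 - y / 2 - y\<^sup>2 / 8 - y ^ 3 / 8) \<le> w * sqrt (1 - y)"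
        using y x2 w3 by (intro mult_left_mono sqrt_one_minus_ge) auto
      moreover have "ln (1 - y) \<le> - y"
        using y x2 ln_le_minus_one[of "1 - y"] by simp
      ultimately show ?thesis
        by (simp add: L_def algebra_simps)
    qed
    also have "\<dots> = 1 + approx_value (z * (1 - x)) - approx_value z"
      unfolding w y_def using x2 z by (intro approx_value_diff[symmetric]) auto
    finally show "L w x \<le> 1 + approx_value (z * (1 - x)) - approx_value z" .
  qed
  \<comment> \<open>This is the condition \<open>w0 \<le> w\<close> solved for
    \<open>z\<close>.\<close>
  define t0 where "t0 = w0\<^sup>2 / 2 - 1"
  have large: "w0 \<le> sqrt (2 * (z + 1)) \<longleftrightarrow> t0 \<le> z" if "z \<ge> 0" for z
  proof -
    have "w0 \<le> sqrt (2 * (z + 1)) \<longleftrightarrow> w0\<^sup>2 \<le> 2 * (z + 1)"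
      using w0_3 by (metis abs_of_nonneg order.trans real_sqrt_abs real_sqrt_le_iff zero_le_numeral)
    then show ?thesis
      by (simp add: t0_def field_simps)
  qed
  show ?thesis
  proof (rule that)
    show "C \<ge> 0"
      using w0_3 by (simp add: C_def)
  next
    fix z x :: real
    assume z: "z \<ge> 0" and x: "x \<in> {0<..acceptance_width t0 z}"
    then have "t0 \<le> z"
      by (auto simp: acceptance_width_def split: if_splits)
    then show "0 \<le> 1 + approx_value (z * (1 - x)) - approx_value z"
      using lower[OF z refl, of x] large[OF z] x by (auto simp: acceptance_width_def \<theta>_def)
  next
    fix z :: real
    assume z: "z \<ge> 0"
    define w where "w = sqrt (2 * (z + 1))"
    define v where "v = sqrt (z + 1)"
    have v: "v \<ge> 1" and wv: "w = sqrt 2 * v"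
      using z by (simp add: v_def) (simp only: w_def v_def real_sqrt_mult)
    have "sqrt 2 \<ge> 1"
      by simp
    then have vw: "v \<le> w"
      unfolding wv using v by (simp add: mult_le_cancel_right1)
    have w2: "w\<^sup>2 = 2 * (z + 1)" and w_pos: "w > 0"
      using z by (auto simp: w_def)
    show "ennreal (approx_value_deriv z - correction_deriv C z) \<le>
      (\<integral>\<^sup>+x\<in>{0<..acceptance_width t0 z}.
        ennreal (1 + approx_value (z * (1 - x)) - approx_value z) \<partial>lborel)"
    proof (cases "t0 \<le> z")
      case False
      then have "v \<le> w0"
        using large[OF z] vw by (simp add: w_def)
      then have "v ^ 3 \<le> w0 ^ 3"
        using v by (intro power_mono) auto
      then have "1 \<le> correction_deriv C z"
        unfolding correction_deriv_def v_def[symmetric] C_def using v by (simp add: le_divide_eq)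
      then have "approx_value_deriv z - correction_deriv C z \<le> 0"
        using approx_value_deriv_bounds[OF z] by linarith
      then show ?thesis
        by (simp add: ennreal_neg)
    next
      case True
      then have w: "w \<ge> w0"
        using large[OF z] by (simp add: w_def)
      have \<theta>: "\<theta> w \<ge> 0" "acceptance_width t0 z = \<theta> w"
        using w_pos True by (auto simp: \<theta>_def acceptance_width_def w_def)
      have "ennreal (approx_value_deriv z - correction_deriv C z) \<le> ennreal (P w (\<theta> w) - P w 0)"
      proof (rule ennreal_leI)
        have "0 \<le> w0 ^ 3"
          using w0_3 by simp
        then have "c / w ^ 3 \<le> C / w ^ 3"
          using w_pos unfolding C_def by (intro divide_right_mono) (linarith, simp)
        also have "\<dots> \<le> C / v ^ 3"
          using v vw w0_3 unfolding C_def by (intro divide_left_mono power_mono) auto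
        finally have "c / w ^ 3 \<le> correction_deriv C z"
          by (simp add: correction_deriv_def v_def)
        moreover have "approx_value_deriv z = 1 / w - 1 / (6 * w\<^sup>2)"
          unfolding approx_value_deriv_def w2 by (simp add: w_def)
        moreover have "P w 0 = 0"
          by (simp add: P_def)
        ultimately show "approx_value_deriv z - correction_deriv C z \<le> P w (\<theta> w) - P w 0"
          using w0(1)[OF w] by linarith
      qed
      also have "\<dots> = (\<integral>\<^sup>+x. ennreal (L w x) * indicator {0..\<theta> w} x \<partial>lborel)"
      proof (rule nn_integral_FTC_Icc[where F = "P w", symmetric])
        show "L w \<in> borel_measurable borel"
          unfolding L_def by measurable
        show "(P w has_real_derivative L w x) (at x)" for x
          unfolding P_def L_def
          by (auto intro!: derivative_eq_intros simp: power2_eq_square power3_eq_cube)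
        show "0 \<le> L w x" if "x \<in> {0..\<theta> w}" for x
          using lower(2)[OF z w_def w] that by simp
      qed (use \<theta> in auto)
      also have "\<dots> \<le> (\<integral>\<^sup>+x\<in>{0<..acceptance_width t0 z}.
        ennreal (1 + approx_value (z * (1 - x)) - approx_value z) \<partial>lborel)"
      proof (rule nn_integral_mono_AE, rule AE_mp[OF AE_lborel_singleton[of 0]], rule AE_I2, rule impI)
        fix x :: real
        assume "x \<noteq> 0"
        then show "ennreal (L w x) * indicator {0..\<theta> w} x
            \<le> ennreal (1 + approx_value (z * (1 - x)) - approx_value z) * indicator {0<..acceptance_width t0 z} x"
          using lower(1)[OF z w_def w, of x] unfolding \<theta>(2)
          by (auto simp: indicator_def intro!: ennreal_leI)
      qed
      finally show ?thesis .
    qed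
  qed
qed

subsection \<open>The compensator of the Poisson process\<close>

text \<open>Leaving out time 0 and value 0 discards almost surely no atom. The left-open time
  interval fits the predictable rectangles, and every value exceeds the initial record 0.\<close>

definition strip_until :: "real \<Rightarrow> (real \<times> real) set" where
  "strip_until t = {0<..t} \<times> {0<..1}"

lemma strip_until_borel [measurable]: "strip_until t \<in> sets borel"
  unfolding strip_until_def by (intro borel_Times) auto

lemma strip_until_subset: "strip_until t \<subseteq> {p \<in> strip. ennreal (fst p) \<le> ennreal t}"
  by (auto simp: strip_until_def strip_def ennreal_leI)

lemma bounded_strip_until: "bounded (strip_until t)"
  unfolding strip_until_def by (intro bounded_Times) (auto intro: bounded_subset[OF bounded_closed_interval])

lemma poisson_mean_sums:
  fixes l :: real
  shows "(\<lambda>k. real k * (l ^ k / fact k * exp (- l))) sums l"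
proof -
  have "(\<lambda>k. l ^ k /\<^sub>R fact k) sums exp l"
    by (rule exp_converges)
  then have "(\<lambda>k. l * exp (- l) * (l ^ k /\<^sub>R fact k)) sums (l * exp (- l) * exp l)"
    by (rule sums_mult)
  moreover have "l * exp (- l) * exp l = l"
    by (simp add: exp_minus)
  moreover have "l * exp (- l) * (l ^ k /\<^sub>R fact k) = real (Suc k) * (l ^ Suc k / fact (Suc k) * exp (- l))" for k
  proof -
    have "real (Suc k) * (l ^ Suc k / fact (Suc k)) = l * (l ^ k / fact k)"
      unfolding fact_Suc power_Suc of_nat_mult by (simp del: of_nat_Suc)
    then show ?thesis
      by (simp add: scaleR_conv_of_real divide_inverse mult_ac)
  qed
  ultimately have "(\<lambda>k. real (Suc k) * (l ^ Suc k / fact (Suc k) * exp (- l))) sums l"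
    by simp
  then show ?thesis
    by (subst (asm) sums_Suc_iff) simp
qed

section \<open>Natural filtration and independence of past and future\<close>

context unit_poisson_process
begin

lemma space_natural_filtration [simp]: "space (natural_filtration M X s) = space M"
  unfolding natural_filtration_def by (rule space_measure_of) auto

lemma sets_natural_filtration:
  "sets (natural_filtration M X s) = sigma_sets (space M)
     {{\<omega> \<in> space M. num_atoms X B \<omega> = k} | B k.
        B \<in> sets borel \<and> bounded B \<and> B \<subseteq> {p \<in> strip. ennreal (fst p) \<le> s}}"
  unfolding natural_filtration_def by (rule sets_measure_of) auto

lemma sets_natural_filtration_mono:
  "r \<le> s \<Longrightarrow> sets (natural_filtration M X r) \<subseteq> sets (natural_filtration M X s)"
  unfolding sets_natural_filtration by (intro sigma_sets_mono') (blast intro: order.trans)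

lemma sets_natural_filtration_subset: "sets (natural_filtration M X s) \<subseteq> sets M"
  unfolding sets_natural_filtration
proof (rule sets.sigma_sets_subset, safe)
  fix B :: "(real \<times> real) set" and k
  assume "B \<in> sets borel" "bounded B"
  from num_atoms_measurable[OF this] show "{\<omega> \<in> space M. num_atoms X B \<omega> = k} \<in> sets M"
    by measurable
qed

lemma num_atoms_adapted:
  assumes "B \<in> sets borel" "bounded B" "B \<subseteq> {p \<in> strip. ennreal (fst p) \<le> s}"
  shows "num_atoms X B \<in> natural_filtration M X s \<rightarrow>\<^sub>M count_space UNIV"
proof (subst measurable_count_space_eq2_countable, intro conjI ballI)
  fix k
  have "{\<omega> \<in> space M. num_atoms X B \<omega> = k} \<in> sets (natural_filtration M X s)"
    unfolding sets_natural_filtration using assms by (intro sigma_sets.Basic) blast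
  also have "{\<omega> \<in> space M. num_atoms X B \<omega> = k} = num_atoms X B -` {k} \<inter> space (natural_filtration M X s)"
    by auto
  finally show "num_atoms X B -` {k} \<inter> space (natural_filtration M X s) \<in> sets (natural_filtration M X s)" .
qed auto

lemma prob_num_atoms_indep:
  assumes \<B>: "finite \<B>" "\<And>B. B \<in> \<B> \<Longrightarrow> B \<in> sets borel \<and> bounded B \<and> B \<subseteq> strip"
    and C: "C \<in> sets borel" "bounded C" "C \<subseteq> strip" "\<And>B. B \<in> \<B> \<Longrightarrow> B \<inter> C = {}"
  shows "prob ({\<omega> \<in> space M. \<forall>B\<in>\<B>. num_atoms X B \<omega> \<in> K B} \<inter> {\<omega> \<in> space M. num_atoms X C \<omega> \<in> L}) =
           prob {\<omega> \<in> space M. \<forall>B\<in>\<B>. num_atoms X B \<omega> \<in> K B} * prob {\<omega> \<in> space M. num_atoms X C \<omega> \<in> L}"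
proof -
  \<comment> \<open>Independence is only assumed for disjoint sets, so pass to the atoms of the algebra generated by \<open>\<B>\<close>.\<close>
  define n where "n = card (Pow \<B>)"
  obtain e where e: "bij_betw e {..<n} (Pow \<B>)"
    using ex_bij_betw_nat_finite[of "Pow \<B>"] \<B>(1) by (auto simp: n_def atLeast0LessThan)
  define cell where "cell = (\<lambda>\<S>. {p \<in> \<Union>\<B>. \<forall>B\<in>\<B>. p \<in> B \<longleftrightarrow> B \<in> \<S>})"
  \<comment> \<open>Index \<open>n\<close> is reserved for \<open>C\<close>, so that the blocks
    \<open>{..<n}\<close> and \<open>{n}\<close> of one independent family represent past and
    future.\<close>
  define Q where "Q = (\<lambda>i. if i < n then cell (e i) else C)"
  have cell_borel: "cell \<S> \<in> sets borel" for \<S>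
  proof -
    have "cell \<S> = {p \<in> space borel. (\<exists>B\<in>\<B>. p \<in> B) \<and> (\<forall>B\<in>\<B>. p \<in> B \<longleftrightarrow> B \<in> \<S>)}"
      by (auto simp: cell_def)
    also have "\<dots> \<in> sets borel"
    proof (intro sets.sets_Collect_conj sets.sets_Collect_finite_Ex sets.sets_Collect_finite_All \<B>(1))
      fix B assume "B \<in> \<B>"
      then have "B \<in> sets borel"
        using \<B>(2) by blast
      moreover have "{p \<in> space borel. p \<in> B} = B" "{p \<in> space borel. p \<in> B \<longleftrightarrow> B \<in> \<S>} = (if B \<in> \<S> then B else - B)"
        by auto
      ultimately show "{p \<in> space borel. p \<in> B} \<in> sets borel" "{p \<in> space borel. p \<in> B \<longleftrightarrow> B \<in> \<S>} \<in> sets borel"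
        by (simp_all only: borel_comp split: if_split) simp_all
    qed
    finally show ?thesis .
  qed
  have cell_bounded: "bounded (cell \<S>)" for \<S>
    by (rule bounded_subset[of "\<Union>\<B>"]) (use \<B> in \<open>auto simp: cell_def intro!: bounded_Union\<close>)
  have cell_strip: "cell \<S> \<subseteq> strip" for \<S>
    using \<B> by (auto simp: cell_def)
  have Q: "Q i \<in> sets borel \<and> bounded (Q i) \<and> Q i \<subseteq> strip" for i
    using C cell_borel cell_bounded cell_strip by (simp add: Q_def)
  have e_subset: "e i \<subseteq> \<B>" if "i < n" for i
    using e that by (auto simp: bij_betw_def)
  have cell_disjoint: "cell \<S> \<inter> cell \<T> = {}" if "\<S> \<subseteq> \<B>" "\<T> \<subseteq> \<B>" "\<S> \<noteq> \<T>" for \<S> \<T>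
    using that by (auto simp: cell_def)
  have disj: "disjoint_family_on Q {..n}"
    unfolding disjoint_family_on_def
  proof (intro ballI impI)
    fix i j assume ij: "i \<in> {..n}" "j \<in> {..n}" "i \<noteq> j"
    have cell_C: "cell \<S> \<inter> C = {}" for \<S>
      using C(4) by (auto simp: cell_def)
    have "e i \<noteq> e j" if "i < n" "j < n"
      using e ij that by (auto simp: bij_betw_def inj_on_def)
    then show "Q i \<inter> Q j = {}"
      using ij cell_C cell_disjoint[of "e i" "e j"] e_subset by (auto simp: Q_def Int_commute)
  qed
  let ?N = "\<lambda>i \<omega>. num_atoms X (Q i) \<omega>"
  have "indep_vars (\<lambda>_. count_space UNIV) ?N {..n}"
    by (rule num_atoms_indep) (use disj Q in auto)
  then have ind: "indep_var (PiM {..<n} (\<lambda>_. count_space UNIV)) (\<lambda>\<omega>. restrict (\<lambda>i. ?N i \<omega>) {..<n})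
      (PiM {n} (\<lambda>_. count_space UNIV)) (\<lambda>\<omega>. restrict (\<lambda>i. ?N i \<omega>) {n})"
    by (rule indep_var_restrict) auto
  define E where "E = {f \<in> space (PiM {..<n} (\<lambda>_. count_space UNIV :: nat measure)).
    \<forall>B\<in>\<B>. (\<Sum>i\<in>{i\<in>{..<n}. B \<in> e i}. f i) \<in> K B}"
  define G where "G = {f \<in> space (PiM {n} (\<lambda>_. count_space UNIV :: nat measure)). f n \<in> L}"
  have E: "E \<in> sets (PiM {..<n} (\<lambda>_. count_space UNIV))"
    unfolding E_def using \<B>(1) by measurable
  have G: "G \<in> sets (PiM {n} (\<lambda>_. count_space UNIV))"
    unfolding G_def by measurable
  \<comment> \<open>\<open>B\<close> is the disjoint union of the cells whose membership pattern
    contains it. Events about overlapping regions thereby become events about the vector of cell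
    counts.\<close>
  have num_B: "num_atoms X B \<omega> = (\<Sum>i\<in>{i\<in>{..<n}. B \<in> e i}. ?N i \<omega>)" if \<omega>: "\<omega> \<in> space M" and B: "B \<in> \<B>" for \<omega> B
  proof -
    have "X \<omega> \<inter> B = (\<Union>i\<in>{i\<in>{..<n}. B \<in> e i}. X \<omega> \<inter> Q i)"
    proof (intro equalityI subsetI)
      fix p assume p: "p \<in> X \<omega> \<inter> B"
      have "{B \<in> \<B>. p \<in> B} \<in> Pow \<B>"
        by auto
      then obtain i where i: "i < n" "e i = {B \<in> \<B>. p \<in> B}"
        using e unfolding bij_betw_def by (metis (no_types, lifting) imageE lessThan_iff)
      then show "p \<in> (\<Union>i\<in>{i\<in>{..<n}. B \<in> e i}. X \<omega> \<inter> Q i)"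
        using p B by (auto simp: Q_def cell_def intro!: exI[of _ i])
    next
      fix p assume "p \<in> (\<Union>i\<in>{i\<in>{..<n}. B \<in> e i}. X \<omega> \<inter> Q i)"
      then show "p \<in> X \<omega> \<inter> B"
        using B by (auto simp: Q_def cell_def)
    qed
    then have "num_atoms X B \<omega> = card (\<Union>i\<in>{i\<in>{..<n}. B \<in> e i}. X \<omega> \<inter> Q i)"
      by simp
    also have "\<dots> = (\<Sum>i\<in>{i\<in>{..<n}. B \<in> e i}. ?N i \<omega>)"
    proof (rule card_UN_disjoint)
      show "\<forall>i\<in>{i \<in> {..<n}. B \<in> e i}. finite (X \<omega> \<inter> Q i)"
        using locally_finite[OF \<omega>] Q by blast
      show "\<forall>i\<in>{i \<in> {..<n}. B \<in> e i}. \<forall>j\<in>{i \<in> {..<n}. B \<in> e i}. i \<noteq> j \<longrightarrow> X \<omega> \<inter> Q i \<inter> (X \<omega> \<inter> Q j) = {}"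
      proof (intro ballI impI)
        fix i j assume "i \<in> {i \<in> {..<n}. B \<in> e i}" "j \<in> {i \<in> {..<n}. B \<in> e i}" "i \<noteq> j"
        then have "Q i \<inter> Q j = {}"
          by (intro disjoint_family_onD[OF disj]) auto
        then show "X \<omega> \<inter> Q i \<inter> (X \<omega> \<inter> Q j) = {}"
          by blast
      qed
    qed simp
    finally show ?thesis .
  qed
  have "(\<lambda>\<omega>. restrict (\<lambda>i. ?N i \<omega>) {..<n}) -` E \<inter> space M = {\<omega> \<in> space M. \<forall>B\<in>\<B>. num_atoms X B \<omega> \<in> K B}"
    by (auto simp: E_def space_PiM num_B)
  moreover have "(\<lambda>\<omega>. restrict (\<lambda>i. ?N i \<omega>) {n}) -` G \<inter> space M = {\<omega> \<in> space M. num_atoms X C \<omega> \<in> L}"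
    by (auto simp: G_def space_PiM Q_def)
  moreover have "(\<lambda>\<omega>. (restrict (\<lambda>i. ?N i \<omega>) {..<n}, restrict (\<lambda>i. ?N i \<omega>) {n})) -` (E \<times> G) \<inter> space M =
      ((\<lambda>\<omega>. restrict (\<lambda>i. ?N i \<omega>) {..<n}) -` E \<inter> space M) \<inter> ((\<lambda>\<omega>. restrict (\<lambda>i. ?N i \<omega>) {n}) -` G \<inter> space M)"
    by auto
  ultimately show ?thesis
    using indep_varD[OF ind E G] by simp
qed

text \<open>A pi-system argument: finite intersections of generators of the past and events about
  the single count on \<open>C\<close> are independent and closed under intersection, so
  independence passes to the generated sigma-algebras.\<close>

lemma past_future_indep:
  assumes a: "0 \<le> a" and A: "A \<in> sets (natural_filtration M X (ennreal a))"
    and C: "C \<in> sets borel" "bounded C" "C \<subseteq> strip" "C \<subseteq> {p. a < fst p}"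
  shows "prob (A \<inter> {\<omega> \<in> space M. num_atoms X C \<omega> = k}) = prob A * prob {\<omega> \<in> space M. num_atoms X C \<omega> = k}"
proof -
  define gen where "gen = {B \<in> sets borel. bounded B \<and> B \<subseteq> {p \<in> strip. ennreal (fst p) \<le> ennreal a}}"
  define \<G> where "\<G> = {{\<omega> \<in> space M. \<forall>x\<in>J. num_atoms X (fst x) \<omega> = snd x} | J. finite J \<and> fst ` J \<subseteq> gen}"
  define \<H> where "\<H> = {{\<omega> \<in> space M. num_atoms X C \<omega> \<in> L} | L. True}"
  have gen: "B \<in> sets borel \<and> bounded B \<and> B \<subseteq> strip" "B \<inter> C = {}" if "B \<in> gen" for B
  proof -
    show "B \<in> sets borel \<and> bounded B \<and> B \<subseteq> strip"
      using that by (auto simp: gen_def)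
    have "fst p \<le> a" if "p \<in> B" for p
      using that \<open>B \<in> gen\<close> a by (auto simp: gen_def)
    then show "B \<inter> C = {}"
      using C(4) by force
  qed
  have events: "\<G> \<subseteq> events" "\<H> \<subseteq> events"
  proof -
    show "\<G> \<subseteq> events"
    proof
      fix E assume "E \<in> \<G>"
      then obtain J where J: "finite J" "fst ` J \<subseteq> gen"
          "E = {\<omega> \<in> space M. \<forall>x\<in>J. num_atoms X (fst x) \<omega> = snd x}"
        unfolding \<G>_def by blast
      have "{\<omega> \<in> space M. num_atoms X (fst x) \<omega> = snd x} \<in> sets M" if "x \<in> J" for x
      proof -
        have [measurable]: "num_atoms X (fst x) \<in> M \<rightarrow>\<^sub>M count_space UNIV"
          using gen(1)[of "fst x"] J(2) that by (intro num_atoms_measurable) auto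
        show ?thesis
          by measurable
      qed
      then show "E \<in> events"
        unfolding J(3) using J(1) by (intro sets.sets_Collect_finite_All) auto
    qed
    show "\<H> \<subseteq> events"
      using num_atoms_measurable[OF C(1,2)] unfolding \<H>_def by (auto intro: measurable_sets_Collect)
  qed
  have "indep_set \<G> \<H>"
  proof (rule indep_setI[OF events])
    fix E H assume "E \<in> \<G>" "H \<in> \<H>"
    then obtain J L where J: "finite J" "fst ` J \<subseteq> gen"
        "E = {\<omega> \<in> space M. \<forall>x\<in>J. num_atoms X (fst x) \<omega> = snd x}" and
        H: "H = {\<omega> \<in> space M. num_atoms X C \<omega> \<in> L}"
      unfolding \<G>_def \<H>_def by blast
    \<comment> \<open>A region may occur in \<open>J\<close> with several prescribed counts. The
      admissible set for \<open>B\<close> collects all of them, and is empty when they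
      conflict.\<close>
    have "E = {\<omega> \<in> space M. \<forall>B\<in>fst ` J. num_atoms X B \<omega> \<in> {k. \<forall>x\<in>J. fst x = B \<longrightarrow> k = snd x}}"
      unfolding J(3) by auto
    then show "prob (E \<inter> H) = prob E * prob H"
      unfolding H
    proof (simp only:, intro prob_num_atoms_indep)
      fix B assume "B \<in> fst ` J"
      then have "B \<in> gen"
        using J(2) by blast
      then show "B \<in> sets borel \<and> bounded B \<and> B \<subseteq> strip" "B \<inter> C = {}"
        using gen by blast+
    qed (use J C in auto)
  qed
  moreover have "Int_stable \<G>"
  proof (rule Int_stableI)
    fix E E' assume "E \<in> \<G>" "E' \<in> \<G>"
    then obtain J J' where J: "finite J" "fst ` J \<subseteq> gen"
        "E = {\<omega> \<in> space M. \<forall>x\<in>J. num_atoms X (fst x) \<omega> = snd x}"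
      and J': "finite J'" "fst ` J' \<subseteq> gen"
        "E' = {\<omega> \<in> space M. \<forall>x\<in>J'. num_atoms X (fst x) \<omega> = snd x}"
      unfolding \<G>_def by blast
    have "E \<inter> E' = {\<omega> \<in> space M. \<forall>x\<in>J \<union> J'. num_atoms X (fst x) \<omega> = snd x}"
      unfolding J(3) J'(3) by auto
    then show "E \<inter> E' \<in> \<G>"
      unfolding \<G>_def using J J' by (intro CollectI exI[of _ "J \<union> J'"]) auto
  qed
  moreover have "Int_stable \<H>"
  proof (rule Int_stableI)
    fix H H' assume "H \<in> \<H>" "H' \<in> \<H>"
    then obtain L L' where "H = {\<omega> \<in> space M. num_atoms X C \<omega> \<in> L}" "H' = {\<omega> \<in> space M. num_atoms X C \<omega> \<in> L'}"
      unfolding \<H>_def by blast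
    then show "H \<inter> H' \<in> \<H>"
      unfolding \<H>_def by (intro CollectI exI[of _ "L \<inter> L'"]) auto
  qed
  ultimately have ind: "indep_set (sigma_sets (space M) \<G>) (sigma_sets (space M) \<H>)"
    by (rule indep_set_sigma_sets)
  have "A \<in> sigma_sets (space M) \<G>"
  proof -
    have "sets (natural_filtration M X (ennreal a)) \<subseteq> sigma_sets (space M) \<G>"
      unfolding sets_natural_filtration
    proof (rule sigma_sets_mono', safe)
      fix B :: "(real \<times> real) set" and k
      assume "B \<in> sets borel" "bounded B" "B \<subseteq> {p \<in> strip. ennreal (fst p) \<le> ennreal a}"
      then show "{\<omega> \<in> space M. num_atoms X B \<omega> = k} \<in> \<G>"
        unfolding \<G>_def gen_def by (intro CollectI exI[of _ "{(B, k)}"]) auto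
    qed
    then show ?thesis
      using A by auto
  qed
  moreover have "{\<omega> \<in> space M. num_atoms X C \<omega> = k} \<in> sigma_sets (space M) \<H>"
    unfolding \<H>_def by (intro sigma_sets.Basic CollectI exI[of _ "{k}"]) auto
  ultimately show ?thesis
    by (rule indep_setD[OF ind])
qed

text \<open>Splitting by the value of the count, independence factors out the probability of
  \<open>A\<close>, and the Poisson mean is the area of \<open>C\<close>. This is the compensator
  formula for one rectangle.\<close>

lemma expected_num_atoms:
  assumes a: "0 \<le> a" and A: "A \<in> sets (natural_filtration M X (ennreal a))"
    and C: "C \<in> sets borel" "bounded C" "C \<subseteq> strip" "C \<subseteq> {p. a < fst p}"
  shows "(\<integral>\<^sup>+\<omega>. indicator A \<omega> * of_nat (num_atoms X C \<omega>) \<partial>M) = emeasure M A * emeasure lborel C"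
proof -
  define l where "l = measure lborel C"
  let ?E = "\<lambda>k. {\<omega> \<in> space M. num_atoms X C \<omega> = k}"
  have [measurable]: "A \<in> sets M" "num_atoms X C \<in> M \<rightarrow>\<^sub>M count_space UNIV"
    using A sets_natural_filtration_subset num_atoms_measurable C by auto
  have "(\<integral>\<^sup>+\<omega>. indicator A \<omega> * of_nat (num_atoms X C \<omega>) \<partial>M) =
      (\<integral>\<^sup>+\<omega>. (\<Sum>k. of_nat k * indicator (A \<inter> ?E k) \<omega>) \<partial>M)"
  proof (rule nn_integral_cong)
    fix \<omega> assume \<omega>: "\<omega> \<in> space M"
    have "(\<Sum>k. of_nat k * indicator (A \<inter> ?E k) \<omega> :: ennreal) =
        (\<Sum>k\<in>{num_atoms X C \<omega>}. of_nat k * indicator (A \<inter> ?E k) \<omega>)"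
      by (rule suminf_finite) (auto simp: indicator_def)
    then show "indicator A \<omega> * of_nat (num_atoms X C \<omega>) = (\<Sum>k. of_nat k * indicator (A \<inter> ?E k) \<omega> :: ennreal)"
      using \<omega> by (auto simp: indicator_def)
  qed
  also have "\<dots> = (\<Sum>k. of_nat k * emeasure M (A \<inter> ?E k))"
    by (subst nn_integral_suminf) (auto simp: nn_integral_cmult)
  also have "\<dots> = (\<Sum>k. emeasure M A * ennreal (real k * (l ^ k / fact k * exp (- l))))"
  proof (rule suminf_cong)
    fix k
    have "emeasure M (A \<inter> ?E k) = ennreal (prob A * (l ^ k / fact k * exp (- l)))"
      using past_future_indep[OF a A C, of k] num_atoms_poisson[OF C(1-3), of k]
      by (simp add: emeasure_eq_measure l_def)
    moreover have "0 \<le> l"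
      by (simp add: l_def)
    ultimately show "of_nat k * emeasure M (A \<inter> ?E k) = emeasure M A * ennreal (real k * (l ^ k / fact k * exp (- l)))"
      by (simp add: emeasure_eq_measure ennreal_of_nat_eq_real_of_nat ennreal_mult' mult_ac flip: ennreal_mult'')
  qed
  also have "\<dots> = emeasure M A * (\<Sum>k. ennreal (real k * (l ^ k / fact k * exp (- l))))"
    by (rule ennreal_suminf_cmult)
  also have "(\<Sum>k. ennreal (real k * (l ^ k / fact k * exp (- l)))) = ennreal l"
    by (rule suminf_ennreal_eq[OF _ poisson_mean_sums]) (simp add: l_def)
  also have "ennreal l = emeasure lborel C"
    using emeasure_bounded_finite[OF C(2)] by (simp add: l_def emeasure_eq_ennreal_measure)
  finally show ?thesis .
qed

section \<open>Measurability of sums over atoms\<close>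

lemma nn_integral_atoms_rectangle:
  assumes "\<omega> \<in> space M"
  shows "(\<integral>\<^sup>+p. indicator (A \<times> B) (\<omega>, p) \<partial>count_space (X \<omega> \<inter> strip_until r)) =
    indicator A \<omega> * of_nat (num_atoms X (B \<inter> strip_until r) \<omega>)"
proof -
  have fin: "finite (X \<omega> \<inter> strip_until r)"
    using assms bounded_strip_until by (intro locally_finite) auto
  have "(\<integral>\<^sup>+p. indicator (A \<times> B) (\<omega>, p) \<partial>count_space (X \<omega> \<inter> strip_until r)) =
      indicator A \<omega> * (\<Sum>p\<in>X \<omega> \<inter> strip_until r. if p \<in> B then 1 else 0)"
    unfolding nn_integral_count_space_finite[OF fin] sum_distrib_left
    by (intro sum.cong) (auto simp: indicator_def)
  also have "(\<Sum>p\<in>X \<omega> \<inter> strip_until r. if p \<in> B then 1 else 0 :: ennreal) = of_nat (card (X \<omega> \<inter> strip_until r \<inter> B))"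
    using fin by (simp add: sum.inter_restrict[symmetric])
  also have "X \<omega> \<inter> strip_until r \<inter> B = X \<omega> \<inter> (B \<inter> strip_until r)"
    by auto
  finally show ?thesis .
qed

text \<open>The sigma-algebra \<open>N\<close> is left open because the result is used twice: with
  \<open>M\<close> to take expectations, and with the filtration at time \<open>r\<close> to see
  that selections are adapted.\<close>

lemma nn_integral_atoms_measurable:
  assumes space_N: "space N = space M"
    and count: "\<And>B. B \<in> sets borel \<Longrightarrow> B \<subseteq> strip_until r \<Longrightarrow> num_atoms X B \<in> N \<rightarrow>\<^sub>M count_space UNIV"
    and K: "K \<in> borel_measurable (N \<Otimes>\<^sub>M borel)"
  shows "(\<lambda>\<omega>. \<integral>\<^sup>+p. K (\<omega>, p) \<partial>count_space (X \<omega> \<inter> strip_until r)) \<in> borel_measurable N"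
  using K
proof (induction rule: borel_measurable_induct)
  case (cong f g)
  have "(\<integral>\<^sup>+p. f (\<omega>, p) \<partial>count_space (X \<omega> \<inter> strip_until r)) = (\<integral>\<^sup>+p. g (\<omega>, p) \<partial>count_space (X \<omega> \<inter> strip_until r))"
    if "\<omega> \<in> space N" for \<omega>
    using that cong(3) by (intro nn_integral_cong) (auto simp: space_pair_measure)
  then show ?case
    using cong(4) by (subst measurable_cong) auto
next
  case (set C)
  let ?G = "{A \<times> B | A B. A \<in> sets N \<and> B \<in> sets (borel :: (real \<times> real) measure)}"
  have "Int_stable ?G"
    by (rule Int_stable_pair_measure_generator)
  moreover have "?G \<subseteq> Pow (space N \<times> UNIV)"
    using sets.sets_into_space by fastforce
  moreover have "C \<in> sigma_sets (space N \<times> UNIV) ?G"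
    using set by (simp add: sets_pair_measure)
  ultimately show ?case
  proof (induction rule: sigma_sets_induct_disjoint)
    case (basic C)
    then obtain A B where AB [measurable]: "A \<in> sets N" "B \<in> sets borel" and C: "C = A \<times> B"
      by auto
    have [measurable]: "num_atoms X (B \<inter> strip_until r) \<in> N \<rightarrow>\<^sub>M count_space UNIV"
      by (rule count) auto
    have "(\<integral>\<^sup>+p. indicator C (\<omega>, p) \<partial>count_space (X \<omega> \<inter> strip_until r)) =
        indicator A \<omega> * of_nat (num_atoms X (B \<inter> strip_until r) \<omega>)" if "\<omega> \<in> space N" for \<omega>
      using that space_N unfolding C by (intro nn_integral_atoms_rectangle) simp
    then show ?case
      by (subst measurable_cong) auto
  next
    case empty
    then show ?case
      by simp
  next
    case (compl C)
    have [measurable]: "num_atoms X (strip_until r) \<in> N \<rightarrow>\<^sub>M count_space UNIV"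
      by (rule count) auto
    have "(\<integral>\<^sup>+p. indicator (space N \<times> UNIV - C) (\<omega>, p) \<partial>count_space (X \<omega> \<inter> strip_until r)) =
        of_nat (num_atoms X (strip_until r) \<omega>) - (\<integral>\<^sup>+p. indicator C (\<omega>, p) \<partial>count_space (X \<omega> \<inter> strip_until r))"
      if \<omega>: "\<omega> \<in> space N" for \<omega>
    proof -
      have fin: "finite (X \<omega> \<inter> strip_until r)"
        using that space_N bounded_strip_until by (intro locally_finite) auto
      have sum_eq: "of_nat (num_atoms X (strip_until r) \<omega>) =
          (\<Sum>p\<in>X \<omega> \<inter> strip_until r. indicator (space N \<times> UNIV - C) (\<omega>, p) :: ennreal) +
          (\<Sum>p\<in>X \<omega> \<inter> strip_until r. indicator C (\<omega>, p))"
      proof -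
        have "(of_nat (num_atoms X (strip_until r) \<omega>) :: ennreal) = (\<Sum>p\<in>X \<omega> \<inter> strip_until r. 1)"
          by simp
        also have "\<dots> = (\<Sum>p\<in>X \<omega> \<inter> strip_until r. indicator (space N \<times> UNIV - C) (\<omega>, p) + indicator C (\<omega>, p))"
          using \<omega> by (intro sum.cong) (auto simp: indicator_def)
        finally show ?thesis
          by (simp only: sum.distrib)
      qed
      \<comment> \<open>Only finitely many atoms contribute, so the complement may be handled by
        subtraction.\<close>
      have "(\<Sum>p\<in>X \<omega> \<inter> strip_until r. indicator C (\<omega>, p) :: ennreal) \<noteq> top"
        using fin by (auto simp: indicator_def)
      then show ?thesis
        unfolding nn_integral_count_space_finite[OF fin] sum_eq by (rule ennreal_add_diff_cancel_right[symmetric])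
    qed
    moreover have "(\<lambda>\<omega>. of_nat (num_atoms X (strip_until r) \<omega>) -
        (\<integral>\<^sup>+p. indicator C (\<omega>, p) \<partial>count_space (X \<omega> \<inter> strip_until r))) \<in> borel_measurable N"
      using compl(2) by measurable
    ultimately show ?case
      by (subst measurable_cong) auto
  next
    case (union C)
    have "(\<integral>\<^sup>+p. indicator (\<Union>i. C i) (\<omega>, p) \<partial>count_space (X \<omega> \<inter> strip_until r)) =
        (\<Sum>i. \<integral>\<^sup>+p. indicator (C i) (\<omega>, p) \<partial>count_space (X \<omega> \<inter> strip_until r))" for \<omega>
      unfolding suminf_indicator[OF union(1), symmetric] by (rule nn_integral_suminf) simp
    then show ?case
      using union(3) by simp
  qed
next
  case (mult u c)
  then show ?case
    by (simp add: nn_integral_cmult)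
next
  case (add u v)
  then show ?case
    by (simp add: nn_integral_add)
next
  case (seq U)
  have "(\<integral>\<^sup>+p. (SUP i. U i) (\<omega>, p) \<partial>count_space (X \<omega> \<inter> strip_until r)) =
      (SUP i. \<integral>\<^sup>+p. U i (\<omega>, p) \<partial>count_space (X \<omega> \<inter> strip_until r))" for \<omega>
    unfolding SUP_apply using \<open>incseq U\<close>
    by (intro nn_integral_monotone_convergence_SUP) (auto simp: incseq_def le_fun_def)
  then show ?case
    using seq.IH by (simp only:) (intro borel_measurable_SUP; simp)
qed

text \<open>Generators of the predictable sigma-algebra with the atom's value as a mark:
  \<open>A\<close> is decided at time \<open>a\<close>, and the rectangle starts strictly after
  \<open>a\<close>. For negative \<open>a\<close>, \<open>ennreal a\<close> is 0 and
  \<open>A\<close> belongs to the filtration at time 0.\<close>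

definition predictable_rectangles :: "('a \<times> real \<times> real) set set" where
  "predictable_rectangles = {A \<times> ({a<..b} \<times> B) | A a b B.
     A \<in> sets (natural_filtration M X (ennreal a)) \<and> B \<in> sets borel}"

definition predictable :: "('a \<times> real \<times> real) measure" where
  "predictable = sigma (space M \<times> UNIV) predictable_rectangles"

lemma predictable_rectangles_subset: "predictable_rectangles \<subseteq> Pow (space M \<times> UNIV)"
  unfolding predictable_rectangles_def
  using sets.sets_into_space[of _ "natural_filtration M X _"] by fastforce

lemma space_predictable [simp]: "space predictable = space M \<times> UNIV"
  unfolding predictable_def by (rule space_measure_of) (rule predictable_rectangles_subset)

lemma sets_predictable: "sets predictable = sigma_sets (space M \<times> UNIV) predictable_rectangles"
  unfolding predictable_def by (rule sets_measure_of) (rule predictable_rectangles_subset)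

lemma rectangle_predictable:
  assumes "A \<in> sets (natural_filtration M X (ennreal a))" "B \<in> sets borel"
  shows "A \<times> ({a<..b} \<times> B) \<in> sets predictable"
  unfolding sets_predictable predictable_rectangles_def using assms by (intro sigma_sets.Basic) blast

text \<open>The intersection starts at the later of the two left endpoints, where both events are
  already known.\<close>

lemma Int_stable_predictable_rectangles: "Int_stable predictable_rectangles"
proof (rule Int_stableI)
  fix C D assume "C \<in> predictable_rectangles" "D \<in> predictable_rectangles"
  then obtain A a b B A' a' b' B' where
    C: "C = A \<times> ({a<..b} \<times> B)" "A \<in> sets (natural_filtration M X (ennreal a))" "B \<in> sets borel" and
    D: "D = A' \<times> ({a'<..b'} \<times> B')" "A' \<in> sets (natural_filtration M X (ennreal a'))" "B' \<in> sets borel"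
    unfolding predictable_rectangles_def by blast
  have "A \<in> sets (natural_filtration M X (ennreal (max a a')))" "A' \<in> sets (natural_filtration M X (ennreal (max a a')))"
    using C D sets_natural_filtration_mono[OF ennreal_leI[of a "max a a'"]]
      sets_natural_filtration_mono[OF ennreal_leI[of a' "max a a'"]] by auto
  then have "A \<inter> A' \<in> sets (natural_filtration M X (ennreal (max a a')))" "B \<inter> B' \<in> sets borel"
    using C D by auto
  moreover have "C \<inter> D = (A \<inter> A') \<times> ({max a a'<..min b b'} \<times> (B \<inter> B'))"
    unfolding C D by auto
  ultimately show "C \<inter> D \<in> predictable_rectangles"
    unfolding predictable_rectangles_def by blast
qed

text \<open>For each rational \<open>q\<close> the set is \<open>A q\<close> times everything after
  \<open>q\<close>, an increasing union of rectangles of length \<open>n\<close>. Restricting to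
  rational times keeps the outer union countable.\<close>

lemma past_predictable:
  assumes "\<And>q. A q \<in> sets (natural_filtration M X (ennreal (of_rat q)))"
  shows "{x \<in> space predictable. \<exists>q. of_rat q < fst (snd x) \<and> fst x \<in> A q} \<in> sets predictable"
proof -
  have "(\<Union>q. \<Union>n::nat. A q \<times> ({of_rat q<..of_rat q + real n} \<times> UNIV)) \<in> sets predictable"
    using assms by (intro sets.countable_UN image_subsetI rectangle_predictable) auto
  also have "(\<Union>q. \<Union>n::nat. A q \<times> ({of_rat q<..of_rat q + real n} \<times> UNIV)) =
      {x \<in> space predictable. \<exists>q. of_rat q < fst (snd x) \<and> fst x \<in> A q}"
  proof (intro equalityI subsetI)
    fix x assume "x \<in> {x \<in> space predictable. \<exists>q. of_rat q < fst (snd x) \<and> fst x \<in> A q}"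
    then obtain q where q: "of_rat q < fst (snd x)" "fst x \<in> A q"
      by auto
    obtain n :: nat where "fst (snd x) - of_rat q \<le> real n"
      using real_arch_simple by blast
    then show "x \<in> (\<Union>q. \<Union>n::nat. A q \<times> ({of_rat q<..of_rat q + real n} \<times> UNIV))"
      using q by (cases x) (auto intro!: exI[of _ q] exI[of _ n])
  qed (use sets.sets_into_space[OF assms] in auto)
  finally show ?thesis .
qed

lemma measurable_predictable_snd [measurable]: "snd \<in> predictable \<rightarrow>\<^sub>M borel"
proof -
  have "(\<lambda>x. fst (snd x)) \<in> borel_measurable predictable"
  proof (rule borel_measurableI_le)
    fix c :: real
    have "(\<Union>n::nat. space M \<times> ({c - real n<..c} \<times> UNIV)) \<in> sets predictable"
      using sets.top[of "natural_filtration M X _"] by (intro sets.countable_UN image_subsetI rectangle_predictable) auto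
    also have "(\<Union>n::nat. space M \<times> ({c - real n<..c} \<times> UNIV)) = {x \<in> space predictable. fst (snd x) \<le> c}"
    proof (intro equalityI subsetI)
      fix x assume x: "x \<in> {x \<in> space predictable. fst (snd x) \<le> c}"
      obtain n :: nat where "c - fst (snd x) < real n"
        using reals_Archimedean2 by blast
      then show "x \<in> (\<Union>n::nat. space M \<times> ({c - real n<..c} \<times> UNIV))"
        using x by (cases x) (auto intro!: exI[of _ n])
    qed auto
    finally show "{x \<in> space predictable. fst (snd x) \<le> c} \<in> sets predictable" .
  qed
  moreover have "(\<lambda>x. snd (snd x)) \<in> borel_measurable predictable"
  proof (rule measurableI)
    fix B :: "real set" assume B: "B \<in> sets borel"
    have "(\<Union>n::nat. space M \<times> ({- real n<..real n} \<times> B)) \<in> sets predictable"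
      using B sets.top[of "natural_filtration M X _"] by (intro sets.countable_UN image_subsetI rectangle_predictable) auto
    also have "(\<Union>n::nat. space M \<times> ({- real n<..real n} \<times> B)) = (\<lambda>x. snd (snd x)) -` B \<inter> space predictable"
    proof (intro equalityI subsetI)
      fix x assume x: "x \<in> (\<lambda>x. snd (snd x)) -` B \<inter> space predictable"
      obtain n :: nat where "\<bar>fst (snd x)\<bar> < real n"
        using reals_Archimedean2 by blast
      then show "x \<in> (\<Union>n::nat. space M \<times> ({- real n<..real n} \<times> B))"
        using x by (cases x) (auto intro!: exI[of _ n])
    qed auto
    finally show "(\<lambda>x. snd (snd x)) -` B \<inter> space predictable \<in> sets predictable" .
  qed auto
  ultimately have "(\<lambda>x. (fst (snd x), snd (snd x))) \<in> predictable \<rightarrow>\<^sub>M borel \<Otimes>\<^sub>M borel"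
    by (rule measurable_Pair)
  then show ?thesis
    by (simp add: borel_prod)
qed

text \<open>Predictable sets are progressively measurable: a rectangle starting at
  \<open>a < r\<close> has its event in the past of \<open>r\<close>, and any other one misses the
  strip up to \<open>r\<close>.\<close>

lemma predictable_section:
  assumes "C \<in> sets predictable"
  shows "C \<inter> (space M \<times> strip_until r) \<in> sets (natural_filtration M X (ennreal r) \<Otimes>\<^sub>M borel)"
  using assms unfolding sets_predictable
proof (induction rule: sigma_sets.induct)
  case (Basic C)
  then obtain A a b B where C: "C = A \<times> ({a<..b} \<times> B)" and A: "A \<in> sets (natural_filtration M X (ennreal a))" and B: "B \<in> sets borel"
    unfolding predictable_rectangles_def by blast
  show ?case
  proof (cases "a < r")
    case True
    then have "A \<in> sets (natural_filtration M X (ennreal r))"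
      using A sets_natural_filtration_mono[OF ennreal_leI[of a r]] by auto
    moreover have "({a<..b} \<times> B) \<inter> strip_until r \<in> sets borel"
      using B by (intro sets.Int borel_Times strip_until_borel) auto
    moreover have "C \<inter> (space M \<times> strip_until r) = A \<times> (({a<..b} \<times> B) \<inter> strip_until r)"
      using sets.sets_into_space[OF A] by (auto simp: C)
    ultimately show ?thesis
      by auto
  next
    case False
    then have "C \<inter> (space M \<times> strip_until r) = {}"
      by (auto simp: C strip_until_def)
    then show ?thesis
      by simp
  qed
next
  case Empty
  then show ?case
    by simp
next
  case (Compl C)
  have "space M \<times> strip_until r \<in> sets (natural_filtration M X (ennreal r) \<Otimes>\<^sub>M borel)"
    using sets.top[of "natural_filtration M X (ennreal r)"] by (intro pair_measureI) auto
  then have "space M \<times> strip_until r - C \<inter> (space M \<times> strip_until r) \<in> sets (natural_filtration M X (ennreal r) \<Otimes>\<^sub>M borel)"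
    using Compl by auto
  also have "space M \<times> strip_until r - C \<inter> (space M \<times> strip_until r) = (space M \<times> UNIV - C) \<inter> (space M \<times> strip_until r)"
    by auto
  finally show ?case .
next
  case (Union C)
  then have "(\<Union>i. C i \<inter> (space M \<times> strip_until r)) \<in> sets (natural_filtration M X (ennreal r) \<Otimes>\<^sub>M borel)"
    by (intro sets.countable_UN image_subsetI)
  also have "(\<Union>i. C i \<inter> (space M \<times> strip_until r)) = (\<Union>i. C i) \<inter> (space M \<times> strip_until r)"
    by auto
  finally show ?case .
qed

text \<open>The count is an indicator integrated against the atoms, so
  \<open>nn_integral_atoms_measurable\<close> applies with the filtration at \<open>r\<close> in the
  role of \<open>N\<close>.\<close>

lemma card_atoms_adapted:
  assumes "C \<in> sets (natural_filtration M X (ennreal r) \<Otimes>\<^sub>M borel)"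
  shows "(\<lambda>\<omega>. card {p \<in> X \<omega> \<inter> strip_until r. (\<omega>, p) \<in> C}) \<in> natural_filtration M X (ennreal r) \<rightarrow>\<^sub>M count_space UNIV"
proof (subst measurable_count_space_eq2_countable, intro conjI ballI)
  let ?F = "natural_filtration M X (ennreal r)"
  fix k
  let ?I = "\<lambda>\<omega>. \<integral>\<^sup>+p. indicator C (\<omega>, p) \<partial>count_space (X \<omega> \<inter> strip_until r)"
  have [measurable]: "?I \<in> borel_measurable ?F"
  proof (rule nn_integral_atoms_measurable)
    fix B assume B: "B \<in> sets borel" "B \<subseteq> strip_until r"
    show "num_atoms X B \<in> ?F \<rightarrow>\<^sub>M count_space UNIV"
      by (rule num_atoms_adapted[OF B(1) bounded_subset[OF bounded_strip_until B(2)] order.trans[OF B(2) strip_until_subset]])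
  qed (use assms in auto)
  have card_eq: "?I \<omega> = of_nat (card {p \<in> X \<omega> \<inter> strip_until r. (\<omega>, p) \<in> C})" if "\<omega> \<in> space M" for \<omega>
  proof -
    have fin: "finite (X \<omega> \<inter> strip_until r)"
      using that bounded_strip_until by (intro locally_finite) auto
    have "?I \<omega> = (\<Sum>p\<in>X \<omega> \<inter> strip_until r. if (\<omega>, p) \<in> C then 1 else 0)"
      unfolding nn_integral_count_space_finite[OF fin] by (intro sum.cong) (auto simp: indicator_def)
    also have "\<dots> = of_nat (card {p \<in> X \<omega> \<inter> strip_until r. (\<omega>, p) \<in> C})"
      using fin by (simp add: sum.inter_filter[symmetric])
    finally show ?thesis .
  qed
  have "{\<omega> \<in> space ?F. ?I \<omega> = of_nat k} \<in> sets ?F"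
    by measurable
  also have "{\<omega> \<in> space ?F. ?I \<omega> = of_nat k} = (\<lambda>\<omega>. card {p \<in> X \<omega> \<inter> strip_until r. (\<omega>, p) \<in> C}) -` {k} \<inter> space ?F"
    by (auto simp: card_eq)
  finally show "(\<lambda>\<omega>. card {p \<in> X \<omega> \<inter> strip_until r. (\<omega>, p) \<in> C}) -` {k} \<inter> space ?F \<in> sets ?F" .
qed auto

lemma card_predictable_atoms_adapted:
  assumes "C \<in> sets predictable"
  shows "(\<lambda>\<omega>. card {p \<in> X \<omega> \<inter> strip_until r. (\<omega>, p) \<in> C}) \<in> natural_filtration M X (ennreal r) \<rightarrow>\<^sub>M count_space UNIV"
proof -
  have "{p \<in> X \<omega> \<inter> strip_until r. (\<omega>, p) \<in> C \<inter> (space M \<times> strip_until r)} = {p \<in> X \<omega> \<inter> strip_until r. (\<omega>, p) \<in> C}"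
    if "\<omega> \<in> space (natural_filtration M X (ennreal r))" for \<omega>
    using that by auto
  then show ?thesis
    using card_atoms_adapted[OF predictable_section[OF assms], of r] by (subst measurable_cong) auto
qed

lemma exists_atom_adapted:
  assumes "C \<in> sets (natural_filtration M X (ennreal r) \<Otimes>\<^sub>M borel)"
  shows "{\<omega> \<in> space M. \<exists>p\<in>X \<omega> \<inter> strip_until r. (\<omega>, p) \<in> C} \<in> sets (natural_filtration M X (ennreal r))"
proof -
  note [measurable] = card_atoms_adapted[OF assms]
  have "{\<omega> \<in> space (natural_filtration M X (ennreal r)). card {p \<in> X \<omega> \<inter> strip_until r. (\<omega>, p) \<in> C} \<noteq> 0}
      \<in> sets (natural_filtration M X (ennreal r))"
    by measurable
  also have "{\<omega> \<in> space (natural_filtration M X (ennreal r)). card {p \<in> X \<omega> \<inter> strip_until r. (\<omega>, p) \<in> C} \<noteq> 0} =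
      {\<omega> \<in> space M. \<exists>p\<in>X \<omega> \<inter> strip_until r. (\<omega>, p) \<in> C}"
    using finite_subset[OF _ locally_finite[OF _ bounded_strip_until], of "{p \<in> X _ \<inter> strip_until r. (_, p) \<in> C}" _ r]
    by (auto simp: card_eq_0_iff)
  finally show ?thesis .
qed

lemma exists_predictable_atom_adapted:
  assumes "C \<in> sets predictable"
  shows "{\<omega> \<in> space M. \<exists>p\<in>X \<omega> \<inter> strip_until r. (\<omega>, p) \<in> C} \<in> sets (natural_filtration M X (ennreal r))"
proof -
  have "{\<omega> \<in> space M. \<exists>p\<in>X \<omega> \<inter> strip_until r. (\<omega>, p) \<in> C} =
      {\<omega> \<in> space M. \<exists>p\<in>X \<omega> \<inter> strip_until r. (\<omega>, p) \<in> C \<inter> (space M \<times> strip_until r)}"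
    by auto
  also have "\<dots> \<in> sets (natural_filtration M X (ennreal r))"
    by (rule exists_atom_adapted[OF predictable_section[OF assms]])
  finally show ?thesis .
qed

section \<open>From predictable integrands to the compensator formula\<close>

lemma predictable_imp_measurable:
  assumes "K \<in> predictable \<rightarrow>\<^sub>M N"
  shows "K \<in> M \<Otimes>\<^sub>M borel \<rightarrow>\<^sub>M N"
proof -
  have "(\<lambda>x. x) \<in> M \<Otimes>\<^sub>M borel \<rightarrow>\<^sub>M predictable"
    unfolding predictable_def
  proof (rule measurable_measure_of[OF predictable_rectangles_subset])
    fix C assume "C \<in> predictable_rectangles"
    then obtain A a b B where C: "C = A \<times> ({a<..b} \<times> B)" and A: "A \<in> sets (natural_filtration M X (ennreal a))" and B: "B \<in> sets borel"
      unfolding predictable_rectangles_def by blast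
    have "A \<times> ({a<..b} \<times> B) \<in> sets (M \<Otimes>\<^sub>M borel)"
      using A B sets_natural_filtration_subset by (intro pair_measureI borel_Times) auto
    moreover have "C \<subseteq> space (M \<Otimes>\<^sub>M borel)"
      using sets.sets_into_space[OF A] by (auto simp: C space_pair_measure)
    ultimately show "(\<lambda>x. x) -` C \<inter> space (M \<Otimes>\<^sub>M borel) \<in> sets (M \<Otimes>\<^sub>M borel)"
      by (simp add: C Int_absorb2)
  qed (auto simp: space_pair_measure)
  from measurable_compose[OF this assms] show ?thesis .
qed

lemma measurable_nn_integral_strip:
  assumes "K \<in> borel_measurable predictable"
  shows "(\<lambda>\<omega>. \<integral>\<^sup>+p\<in>strip_until t. K (\<omega>, p) \<partial>lborel) \<in> borel_measurable M"
proof -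
  have [measurable]: "K \<in> borel_measurable (M \<Otimes>\<^sub>M borel)"
    using assms by (rule predictable_imp_measurable)
  have "(\<lambda>x. K x * indicator (strip_until t) (snd x)) \<in> borel_measurable (M \<Otimes>\<^sub>M borel)"
    by measurable
  then have "(\<lambda>x. K x * indicator (strip_until t) (snd x)) \<in> borel_measurable (M \<Otimes>\<^sub>M lborel)"
    by (simp cong: measurable_cong_sets sets_pair_measure_cong)
  from lborel.borel_measurable_nn_integral_fst[OF this] show ?thesis
    by simp
qed

lemma measurable_nn_integral_atoms:
  assumes "K \<in> borel_measurable predictable"
  shows "(\<lambda>\<omega>. \<integral>\<^sup>+p. K (\<omega>, p) \<partial>count_space (X \<omega> \<inter> strip_until t)) \<in> borel_measurable M"
proof (rule nn_integral_atoms_measurable)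
  fix B assume "B \<in> sets borel" "B \<subseteq> strip_until t"
  then show "num_atoms X B \<in> M \<rightarrow>\<^sub>M count_space UNIV"
    using bounded_strip_until by (intro num_atoms_measurable) (auto intro: bounded_subset)
qed (use predictable_imp_measurable[OF assms] in auto)

lemma compensator_rectangle:
  assumes C: "C \<in> predictable_rectangles"
  shows "(\<integral>\<^sup>+\<omega>. \<integral>\<^sup>+p. indicator C (\<omega>, p) \<partial>count_space (X \<omega> \<inter> strip_until t) \<partial>M) =
         (\<integral>\<^sup>+\<omega>. (\<integral>\<^sup>+p\<in>strip_until t. indicator C (\<omega>, p) \<partial>lborel) \<partial>M)"
proof -
  obtain A a b B where C: "C = A \<times> ({a<..b} \<times> B)" and A: "A \<in> sets (natural_filtration M X (ennreal a))" and B: "B \<in> sets borel"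
    using C unfolding predictable_rectangles_def by blast
  define Q where "Q = {a<..b} \<times> B \<inter> strip_until t"
  have Q: "Q \<in> sets borel" "bounded Q" "Q \<subseteq> strip" "Q \<subseteq> {p. max 0 a < fst p}"
  proof -
    show "Q \<in> sets borel"
      unfolding Q_def using B by (intro sets.Int borel_Times strip_until_borel) auto
    show "bounded Q"
      by (rule bounded_subset[OF bounded_strip_until[of t]]) (auto simp: Q_def)
    show "Q \<subseteq> strip"
      using strip_until_subset[of t] by (auto simp: Q_def)
    show "Q \<subseteq> {p. max 0 a < fst p}"
      by (auto simp: Q_def strip_until_def)
  qed
  \<comment> \<open>A negative left endpoint may be raised to 0: \<open>ennreal\<close> does this to
    the filtration, and \<open>Q\<close> lies after time 0 anyway.\<close>
  have A': "A \<in> sets (natural_filtration M X (ennreal (max 0 a)))"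
    using A by simp
  have AM: "A \<in> sets M"
    using A sets_natural_filtration_subset by auto
  have "(\<integral>\<^sup>+\<omega>. \<integral>\<^sup>+p. indicator C (\<omega>, p) \<partial>count_space (X \<omega> \<inter> strip_until t) \<partial>M) =
      (\<integral>\<^sup>+\<omega>. indicator A \<omega> * of_nat (num_atoms X Q \<omega>) \<partial>M)"
  proof (rule nn_integral_cong)
    fix \<omega> assume "\<omega> \<in> space M"
    then show "(\<integral>\<^sup>+p. indicator C (\<omega>, p) \<partial>count_space (X \<omega> \<inter> strip_until t)) = indicator A \<omega> * of_nat (num_atoms X Q \<omega>)"
      unfolding C Q_def by (rule nn_integral_atoms_rectangle)
  qed
  also have "\<dots> = emeasure M A * emeasure lborel Q"
    by (rule expected_num_atoms[OF _ A' Q]) simp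
  also have "\<dots> = (\<integral>\<^sup>+\<omega>. indicator A \<omega> * emeasure lborel Q \<partial>M)"
    using AM by (simp add: nn_integral_multc)
  also have "\<dots> = (\<integral>\<^sup>+\<omega>. (\<integral>\<^sup>+p\<in>strip_until t. indicator C (\<omega>, p) \<partial>lborel) \<partial>M)"
  proof (rule nn_integral_cong)
    fix \<omega>
    have "(\<integral>\<^sup>+p\<in>strip_until t. indicator C (\<omega>, p) \<partial>lborel) = (\<integral>\<^sup>+p. indicator A \<omega> * indicator Q p \<partial>lborel)"
      by (intro nn_integral_cong) (auto simp: C Q_def indicator_def)
    also have "\<dots> = indicator A \<omega> * emeasure lborel Q"
      using Q(1) by (simp add: nn_integral_cmult)
    finally show "indicator A \<omega> * emeasure lborel Q = (\<integral>\<^sup>+p\<in>strip_until t. indicator C (\<omega>, p) \<partial>lborel)"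
      by simp
  qed
  finally show ?thesis .
qed

text \<open>Both sides are measures in the integrand that agree on the intersection-stable
  rectangles. A monotone class argument first reaches all predictable sets, then all nonnegative
  predictable functions.\<close>

theorem compensator_formula:
  assumes "K \<in> borel_measurable predictable"
  shows "(\<integral>\<^sup>+\<omega>. \<integral>\<^sup>+p. K (\<omega>, p) \<partial>count_space (X \<omega> \<inter> strip_until t) \<partial>M) =
         (\<integral>\<^sup>+\<omega>. (\<integral>\<^sup>+p\<in>strip_until t. K (\<omega>, p) \<partial>lborel) \<partial>M)"
  using assms
proof (induction rule: borel_measurable_induct)
  case (cong f g)
  have "(\<integral>\<^sup>+\<omega>. \<integral>\<^sup>+p. f (\<omega>, p) \<partial>count_space (X \<omega> \<inter> strip_until t) \<partial>M) =
      (\<integral>\<^sup>+\<omega>. \<integral>\<^sup>+p. g (\<omega>, p) \<partial>count_space (X \<omega> \<inter> strip_until t) \<partial>M)"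
    using cong(3) by (intro nn_integral_cong) auto
  moreover have "(\<integral>\<^sup>+\<omega>. (\<integral>\<^sup>+p\<in>strip_until t. f (\<omega>, p) \<partial>lborel) \<partial>M) = (\<integral>\<^sup>+\<omega>. (\<integral>\<^sup>+p\<in>strip_until t. g (\<omega>, p) \<partial>lborel) \<partial>M)"
    using cong(3) by (intro nn_integral_cong) auto
  ultimately show ?case
    using cong(4) by simp
next
  case (set C)
  from Int_stable_predictable_rectangles predictable_rectangles_subset set[unfolded sets_predictable]
  show ?case
  proof (induction rule: sigma_sets_induct_disjoint)
    case (basic C)
    then show ?case
      by (rule compensator_rectangle)
  next
    case empty
    then show ?case
      by simp
  next
    case (compl C)
    \<comment> \<open>The whole space is not a rectangle. \<open>?U\<close> is one, and it contains
      everything either side can see; its finite area then permits subtraction.\<close>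
    let ?U = "space M \<times> ({0<..t} \<times> UNIV)"
    let ?count = "\<lambda>C. \<integral>\<^sup>+\<omega>. \<integral>\<^sup>+p. indicator C (\<omega>, p) \<partial>count_space (X \<omega> \<inter> strip_until t) \<partial>M"
    let ?area = "\<lambda>C. \<integral>\<^sup>+\<omega>. (\<integral>\<^sup>+p\<in>strip_until t. indicator C (\<omega>, p) \<partial>lborel) \<partial>M"
    have C: "C \<in> sets predictable" "space M \<times> UNIV - C \<in> sets predictable"
      using compl(1) sigma_sets.Compl[OF compl(1)] by (simp_all add: sets_predictable)
    have meas: "(indicator C :: _ \<Rightarrow> ennreal) \<in> borel_measurable predictable"
        "(indicator (space M \<times> UNIV - C) :: _ \<Rightarrow> ennreal) \<in> borel_measurable predictable"
      using C by auto
    have "?count (space M \<times> UNIV - C) + ?count C = ?count ?U"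
      unfolding nn_integral_add[OF measurable_nn_integral_atoms[OF meas(2)] measurable_nn_integral_atoms[OF meas(1)], symmetric]
    proof (rule nn_integral_cong)
      fix \<omega> assume \<omega>: "\<omega> \<in> space M"
      show "(\<integral>\<^sup>+p. indicator (space M \<times> UNIV - C) (\<omega>, p) \<partial>count_space (X \<omega> \<inter> strip_until t)) +
          (\<integral>\<^sup>+p. indicator C (\<omega>, p) \<partial>count_space (X \<omega> \<inter> strip_until t)) =
          (\<integral>\<^sup>+p. indicator ?U (\<omega>, p) \<partial>count_space (X \<omega> \<inter> strip_until t))"
        using \<omega> by (subst nn_integral_add[symmetric]) (auto simp: indicator_def strip_until_def intro!: nn_integral_cong)
    qed
    moreover have "?area (space M \<times> UNIV - C) + ?area C = ?area ?U"
      unfolding nn_integral_add[OF measurable_nn_integral_strip[OF meas(2)] measurable_nn_integral_strip[OF meas(1)], symmetric]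
    proof (rule nn_integral_cong)
      fix \<omega> assume \<omega>: "\<omega> \<in> space M"
      have [measurable]: "(\<lambda>p. indicator (space M \<times> UNIV - C) (\<omega>, p) :: ennreal) \<in> borel_measurable borel"
        "(\<lambda>p. indicator C (\<omega>, p) :: ennreal) \<in> borel_measurable borel"
        using measurable_compose[OF measurable_Pair1'[OF \<omega>] predictable_imp_measurable[OF meas(1)]]
          measurable_compose[OF measurable_Pair1'[OF \<omega>] predictable_imp_measurable[OF meas(2)]] by simp_all
      show "(\<integral>\<^sup>+p\<in>strip_until t. indicator (space M \<times> UNIV - C) (\<omega>, p) \<partial>lborel) +
          (\<integral>\<^sup>+p\<in>strip_until t. indicator C (\<omega>, p) \<partial>lborel) =
          (\<integral>\<^sup>+p\<in>strip_until t. indicator ?U (\<omega>, p) \<partial>lborel)"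
      proof (subst nn_integral_add[symmetric])
        show "(\<integral>\<^sup>+p. indicator (space M \<times> UNIV - C) (\<omega>, p) * indicator (strip_until t) p +
            indicator C (\<omega>, p) * indicator (strip_until t) p \<partial>lborel) =
          (\<integral>\<^sup>+p\<in>strip_until t. indicator ?U (\<omega>, p) \<partial>lborel)"
          using \<omega> by (intro nn_integral_cong) (auto simp: indicator_def strip_until_def)
      qed measurable
    qed
    moreover have "?count ?U = ?area ?U"
    proof (rule compensator_rectangle)
      show "?U \<in> predictable_rectangles"
        unfolding predictable_rectangles_def using sets.top[of "natural_filtration M X (ennreal 0)"]
        by (intro CollectI exI[of _ "space M"] exI[of _ 0] exI[of _ t] exI[of _ UNIV] conjI) auto
    qed
    moreover have "?area C \<noteq> top"
    proof -
      have "?area C \<le> (\<integral>\<^sup>+\<omega>. emeasure lborel (strip_until t) \<partial>M)"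
      proof (rule nn_integral_mono)
        fix \<omega>
        have "(\<integral>\<^sup>+p\<in>strip_until t. indicator C (\<omega>, p) \<partial>lborel) \<le> (\<integral>\<^sup>+p. indicator (strip_until t) p \<partial>lborel)"
          by (intro nn_integral_mono) (auto simp: indicator_def)
        then show "(\<integral>\<^sup>+p\<in>strip_until t. indicator C (\<omega>, p) \<partial>lborel) \<le> emeasure lborel (strip_until t)"
          by simp
      qed
      also have "\<dots> = emeasure lborel (strip_until t)"
        by (simp add: emeasure_space_1)
      also have "\<dots> < \<infinity>"
        by (rule emeasure_bounded_finite[OF bounded_strip_until])
      finally show ?thesis
        by simp
    qed
    ultimately show ?case
      using compl(2) by (metis (no_types, lifting) ennreal_add_diff_cancel_right)
  next
    case (union C)
    have C: "(indicator (C i) :: _ \<Rightarrow> ennreal) \<in> borel_measurable predictable" for i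
      using union(2) by (auto simp: sets_predictable[symmetric])
    have "(\<integral>\<^sup>+\<omega>. \<integral>\<^sup>+p. indicator (\<Union>i. C i) (\<omega>, p) \<partial>count_space (X \<omega> \<inter> strip_until t) \<partial>M) =
        (\<Sum>i. \<integral>\<^sup>+\<omega>. \<integral>\<^sup>+p. indicator (C i) (\<omega>, p) \<partial>count_space (X \<omega> \<inter> strip_until t) \<partial>M)"
      unfolding nn_integral_suminf[OF measurable_nn_integral_atoms[OF C], symmetric]
      unfolding suminf_indicator[OF union(1), symmetric] by (intro nn_integral_cong nn_integral_suminf) simp
    moreover have "(\<integral>\<^sup>+\<omega>. (\<integral>\<^sup>+p\<in>strip_until t. indicator (\<Union>i. C i) (\<omega>, p) \<partial>lborel) \<partial>M) =
        (\<Sum>i. \<integral>\<^sup>+\<omega>. (\<integral>\<^sup>+p\<in>strip_until t. indicator (C i) (\<omega>, p) \<partial>lborel) \<partial>M)"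
      unfolding nn_integral_suminf[OF measurable_nn_integral_strip[OF C], symmetric]
    proof (rule nn_integral_cong)
      fix \<omega> assume \<omega>: "\<omega> \<in> space M"
      have [measurable]: "(\<lambda>p. indicator (C i) (\<omega>, p) :: ennreal) \<in> borel_measurable borel" for i
        using measurable_compose[OF measurable_Pair1'[OF \<omega>] predictable_imp_measurable[OF C]] by simp
      show "(\<integral>\<^sup>+p\<in>strip_until t. indicator (\<Union>i. C i) (\<omega>, p) \<partial>lborel) =
          (\<Sum>i. \<integral>\<^sup>+p\<in>strip_until t. indicator (C i) (\<omega>, p) \<partial>lborel)"
        unfolding suminf_indicator[OF union(1), symmetric] ennreal_suminf_multc[symmetric]
        by (rule nn_integral_suminf) measurable
    qed
    ultimately show ?case
      using union(3) by simp
  qed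
next
  case (mult u c)
  have [measurable]: "(\<lambda>p. u (\<omega>, p)) \<in> borel_measurable borel" if "\<omega> \<in> space M" for \<omega>
    using measurable_compose[OF measurable_Pair1'[OF that] predictable_imp_measurable[OF mult(2)]] .
  have "(\<integral>\<^sup>+\<omega>. (\<integral>\<^sup>+p\<in>strip_until t. c * u (\<omega>, p) \<partial>lborel) \<partial>M) = (\<integral>\<^sup>+\<omega>. c * (\<integral>\<^sup>+p\<in>strip_until t. u (\<omega>, p) \<partial>lborel) \<partial>M)"
    by (intro nn_integral_cong) (simp add: nn_integral_cmult mult.assoc)
  then show ?case
    using mult(4) measurable_nn_integral_atoms[OF mult(2)] measurable_nn_integral_strip[OF mult(2)]
    by (simp add: nn_integral_cmult)
next
  case (add u v)
  have [measurable]: "(\<lambda>p. u (\<omega>, p)) \<in> borel_measurable borel" "(\<lambda>p. v (\<omega>, p)) \<in> borel_measurable borel" if "\<omega> \<in> space M" for \<omega>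
    using measurable_compose[OF measurable_Pair1'[OF that] predictable_imp_measurable[OF add(1)]]
      measurable_compose[OF measurable_Pair1'[OF that] predictable_imp_measurable[OF add(3)]] .
  have "(\<integral>\<^sup>+\<omega>. (\<integral>\<^sup>+p\<in>strip_until t. v (\<omega>, p) + u (\<omega>, p) \<partial>lborel) \<partial>M) =
      (\<integral>\<^sup>+\<omega>. (\<integral>\<^sup>+p\<in>strip_until t. v (\<omega>, p) \<partial>lborel) + (\<integral>\<^sup>+p\<in>strip_until t. u (\<omega>, p) \<partial>lborel) \<partial>M)"
    by (intro nn_integral_cong) (simp add: nn_integral_add distrib_right)
  then show ?case
    using add measurable_nn_integral_atoms measurable_nn_integral_strip
    by (simp add: nn_integral_add)
next
  case (seq U)
  have [measurable]: "(\<lambda>p. U i (\<omega>, p)) \<in> borel_measurable borel" if "\<omega> \<in> space M" for \<omega> i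
    using measurable_compose[OF measurable_Pair1'[OF that] predictable_imp_measurable[OF seq(1)]] .
  have mono: "U i x \<le> U j x" if "i \<le> j" for i j x
    using incseqD[OF \<open>incseq U\<close> that] by (rule le_funD)
  have "(\<integral>\<^sup>+\<omega>. \<integral>\<^sup>+p. (SUP i. U i) (\<omega>, p) \<partial>count_space (X \<omega> \<inter> strip_until t) \<partial>M) =
      (\<integral>\<^sup>+\<omega>. (SUP i. \<integral>\<^sup>+p. U i (\<omega>, p) \<partial>count_space (X \<omega> \<inter> strip_until t)) \<partial>M)"
    unfolding SUP_apply image_image
    by (intro nn_integral_cong nn_integral_monotone_convergence_SUP) (auto simp: incseq_def le_fun_def mono)
  also have "\<dots> = (SUP i. \<integral>\<^sup>+\<omega>. \<integral>\<^sup>+p. U i (\<omega>, p) \<partial>count_space (X \<omega> \<inter> strip_until t) \<partial>M)"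
    by (intro nn_integral_monotone_convergence_SUP measurable_nn_integral_atoms seq(1))
       (auto simp: incseq_def le_fun_def intro!: nn_integral_mono mono)
  also have "\<dots> = (SUP i. \<integral>\<^sup>+\<omega>. (\<integral>\<^sup>+p\<in>strip_until t. U i (\<omega>, p) \<partial>lborel) \<partial>M)"
    using seq.IH by simp
  also have "\<dots> = (\<integral>\<^sup>+\<omega>. (SUP i. \<integral>\<^sup>+p\<in>strip_until t. U i (\<omega>, p) \<partial>lborel) \<partial>M)"
    by (intro nn_integral_monotone_convergence_SUP[symmetric] measurable_nn_integral_strip seq(1))
       (auto simp: incseq_def le_fun_def intro!: nn_integral_mono mult_right_mono mono)
  also have "\<dots> = (\<integral>\<^sup>+\<omega>. (\<integral>\<^sup>+p\<in>strip_until t. (SUP i. U i) (\<omega>, p) \<partial>lborel) \<partial>M)"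
  proof (rule nn_integral_cong)
    fix \<omega> assume [simp]: "\<omega> \<in> space M"
    have "(SUP i. \<integral>\<^sup>+p\<in>strip_until t. U i (\<omega>, p) \<partial>lborel) = (\<integral>\<^sup>+p. (SUP i. U i (\<omega>, p) * indicator (strip_until t) p) \<partial>lborel)"
      by (intro nn_integral_monotone_convergence_SUP[symmetric])
         (auto simp: incseq_def le_fun_def intro!: mult_right_mono mono borel_measurable_times_ennreal)
    also have "\<dots> = (\<integral>\<^sup>+p\<in>strip_until t. (SUP i. U i) (\<omega>, p) \<partial>lborel)"
      by (intro nn_integral_cong) (auto simp: SUP_apply image_image indicator_def)
    finally show "(SUP i. \<integral>\<^sup>+p\<in>strip_until t. U i (\<omega>, p) \<partial>lborel) = (\<integral>\<^sup>+p\<in>strip_until t. (SUP i. U i) (\<omega>, p) \<partial>lborel)" .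
  qed
  finally show ?case .
qed

end

subsection \<open>Telescoping along a path\<close>

text \<open>The strict inequality \<open>fst q < s\<close> gives the left limit, which is what makes
  it predictable. For an increasing set of atoms the maximum is the most recent value, and 0 stands
  for no selection yet.\<close>

definition last_value :: "(real \<times> real) set \<Rightarrow> real \<Rightarrow> real" where
  "last_value D s = Max (insert 0 (snd ` {q \<in> D. fst q < s}))"

lemma last_value_le_iff:
  assumes "finite D"
  shows "last_value D s \<le> y \<longleftrightarrow> 0 \<le> y \<and> (\<forall>q\<in>D. fst q < s \<longrightarrow> snd q \<le> y)"
  unfolding last_value_def using assms by (subst Max_le_iff) auto

lemma less_last_value_iff:
  assumes "finite D"
  shows "y < last_value D s \<longleftrightarrow> y < 0 \<or> (\<exists>q\<in>D. fst q < s \<and> y < snd q)"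
  using last_value_le_iff[OF assms, of s y] by (auto simp: not_le)

lemma last_value_bounds:
  assumes "finite D" "snd ` D \<subseteq> {0..1}"
  shows "last_value D s \<in> {0..1}"
proof -
  have "last_value D s \<le> 1"
    using assms by (subst last_value_le_iff) auto
  moreover have "0 \<le> last_value D s"
    using last_value_le_iff[OF assms(1), of s "last_value D s"] by simp
  ultimately show ?thesis
    by simp
qed

lemma last_value_measurable:
  assumes "finite D"
  shows "last_value D \<in> borel_measurable borel"
proof (rule borel_measurable_mono, rule monoI)
  show "last_value D s \<le> last_value D s'" if "s \<le> s'" for s s'
    using last_value_le_iff[OF assms, of s "last_value D s'"] last_value_le_iff[OF assms, of s' "last_value D s'"] that
    by force
qed

text \<open>Between selections only the remaining time decreases; a selection at \<open>p\<close> makes the remaining area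
  jump from \<open>(t - fst p) * (1 - Y)\<close> to \<open>(t - fst p) * (1 - snd p)\<close>.\<close>
lemma telescoping_has_integral:
  fixes f f' :: "real \<Rightarrow> real"
  assumes deriv: "\<And>z. z \<ge> 0 \<Longrightarrow> (f has_real_derivative f' z) (at z)"
    and D: "finite D" "increasing_atoms D" "D \<subseteq> {0..r} \<times> {0..1}" and r: "0 \<le> r" "r \<le> t"
  shows "((\<lambda>s. (1 - last_value D s) * f' ((t - s) * (1 - last_value D s))) has_integral
          f t - f ((t - r) * (1 - Max (insert 0 (snd ` D)))) +
          (\<Sum>p\<in>D. f ((t - fst p) * (1 - snd p)) - f ((t - fst p) * (1 - last_value D (fst p))))) {0..r}"
  using D r
proof (induction "card D" arbitrary: D r)
  case 0
  have "((\<lambda>s. - (f' (t - s))) has_integral f (t - r) - f (t - 0)) {0..r}"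
  proof (rule fundamental_theorem_of_calculus)
    fix s assume "s \<in> {0..r}"
    then have "t - s \<ge> 0"
      using 0 by simp
    moreover have "((\<lambda>s. t - s) has_real_derivative - 1) (at s)"
      by (auto intro!: derivative_eq_intros)
    ultimately have "((\<lambda>s. f (t - s)) has_real_derivative f' (t - s) * - 1) (at s)"
      by (intro DERIV_chain2[where f = f] deriv)
    then show "((\<lambda>s. f (t - s)) has_vector_derivative - f' (t - s)) (at s within {0..r})"
      by (simp add: has_real_derivative_iff_has_vector_derivative has_vector_derivative_at_within)
  qed (use 0 in auto)
  from has_integral_neg[OF this] show ?case
    using 0 by (simp add: last_value_def)
next
  case (Suc n)
  then have "fst ` D \<noteq> {}" "finite (fst ` D)"
    by auto
  then have "Max (fst ` D) \<in> fst ` D"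
    by (intro Max_in)
  \<comment> \<open>The induction removes the latest atom. Up to and including its time the records
    of \<open>D\<close> and \<open>D'\<close> coincide, because \<open>last_value\<close> looks
    strictly backwards; afterwards the record is constantly \<open>snd p\<close>.\<close>
  then obtain p where p: "p \<in> D" "fst p = Max (fst ` D)"
    by force
  define D' where "D' = D - {p}"
  have D': "finite D'" "increasing_atoms D'" "card D' = n" "D = insert p D'" "p \<notin> D'"
    using Suc p by (auto simp: D'_def increasing_atoms_def)
  have less: "fst q < fst p \<and> snd q < snd p" if "q \<in> D'" for q
  proof -
    have "fst q \<le> fst p"
      using p(2) that Suc.prems by (auto simp: D'_def)
    then show ?thesis
      using \<open>increasing_atoms D\<close> p(1) that unfolding D'_def increasing_atoms_def by force
  qed
  have p_bounds: "0 \<le> fst p" "fst p \<le> r" "0 \<le> snd p" "snd p \<le> 1"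
    using Suc.prems p(1) by auto
  have before: "last_value D s = last_value D' s" if "s \<le> fst p" for s
    unfolding last_value_def D'(4) using that by (intro arg_cong[where f = Max]) auto
  have after: "last_value D s = snd p" if "fst p < s" for s
    unfolding last_value_def D'(4) using that less p_bounds D'(1)
    by (intro Max_eqI) (auto intro: less_imp_le)
  have last_D: "Max (insert 0 (snd ` D)) = snd p"
    unfolding D'(4) using less p_bounds D'(1) by (intro Max_eqI) (auto intro: less_imp_le)
  have last_D': "Max (insert 0 (snd ` D')) = last_value D (fst p)"
  proof -
    have "D' = {q \<in> D. fst q < fst p}"
      unfolding D'(4) using less by auto
    then show ?thesis
      by (simp add: last_value_def)
  qed
  let ?S = "\<Sum>q\<in>D'. f ((t - fst q) * (1 - snd q)) - f ((t - fst q) * (1 - last_value D (fst q)))"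
  have "((\<lambda>s. (1 - last_value D' s) * f' ((t - s) * (1 - last_value D' s))) has_integral
      f t - f ((t - fst p) * (1 - Max (insert 0 (snd ` D')))) +
      (\<Sum>q\<in>D'. f ((t - fst q) * (1 - snd q)) - f ((t - fst q) * (1 - last_value D' (fst q))))) {0..fst p}"
  proof (rule Suc.hyps(1))
    show "D' \<subseteq> {0..fst p} \<times> {0..1}"
    proof
      fix q assume q: "q \<in> D'"
      then have "q \<in> {0..r} \<times> {0..1}"
        using Suc.prems(3) by (auto simp: D'_def)
      then show "q \<in> {0..fst p} \<times> {0..1}"
        using less[OF q] by (cases q) auto
    qed
  qed (use D' p_bounds Suc.prems in auto)
  also have "(\<Sum>q\<in>D'. f ((t - fst q) * (1 - snd q)) - f ((t - fst q) * (1 - last_value D' (fst q)))) = ?S"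
    using less by (intro sum.cong refl) (simp add: before less_imp_le)
  finally have 1: "((\<lambda>s. (1 - last_value D s) * f' ((t - s) * (1 - last_value D s))) has_integral
      f t - f ((t - fst p) * (1 - last_value D (fst p))) + ?S) {0..fst p}"
    unfolding last_D' by (rule has_integral_eq[rotated]) (simp add: before)
  have "((\<lambda>s. - ((1 - snd p) * f' ((t - s) * (1 - snd p)))) has_integral
      f ((t - r) * (1 - snd p)) - f ((t - fst p) * (1 - snd p))) {fst p..r}"
  proof (rule fundamental_theorem_of_calculus)
    fix s assume "s \<in> {fst p..r}"
    then have "(t - s) * (1 - snd p) \<ge> 0"
      using Suc.prems p_bounds by simp
    moreover have "((\<lambda>s. (t - s) * (1 - snd p)) has_real_derivative - (1 - snd p)) (at s)"
      by (auto intro!: derivative_eq_intros)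
    ultimately have "((\<lambda>s. f ((t - s) * (1 - snd p))) has_real_derivative
        f' ((t - s) * (1 - snd p)) * - (1 - snd p)) (at s)"
      by (intro DERIV_chain2[where f = f] deriv)
    also have "f' ((t - s) * (1 - snd p)) * - (1 - snd p) = - ((1 - snd p) * f' ((t - s) * (1 - snd p)))"
      by (simp only: mult_minus_right mult.commute)
    finally show "((\<lambda>s. f ((t - s) * (1 - snd p))) has_vector_derivative
        - ((1 - snd p) * f' ((t - s) * (1 - snd p)))) (at s within {fst p..r})"
      by (simp add: has_real_derivative_iff_has_vector_derivative has_vector_derivative_at_within)
  qed (use p_bounds in auto)
  from has_integral_neg[OF this]
  have "((\<lambda>s. (1 - snd p) * f' ((t - s) * (1 - snd p))) has_integral
      f ((t - fst p) * (1 - snd p)) - f ((t - r) * (1 - snd p))) {fst p..r}"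
    by (simp only: minus_minus minus_diff_eq)
  \<comment> \<open>At the single time \<open>fst p\<close> the record is still the old one, so the
    integrands agree only off a null set.\<close>
  then have 2: "((\<lambda>s. (1 - last_value D s) * f' ((t - s) * (1 - last_value D s))) has_integral
      f ((t - fst p) * (1 - snd p)) - f ((t - r) * (1 - snd p))) {fst p..r}"
    by (rule has_integral_spike[where S = "{fst p}", rotated 2]) (simp_all add: after)
  have "(\<Sum>q\<in>D. f ((t - fst q) * (1 - snd q)) - f ((t - fst q) * (1 - last_value D (fst q)))) =
      ?S + (f ((t - fst p) * (1 - snd p)) - f ((t - fst p) * (1 - last_value D (fst p))))"
    using D' by (simp add: D'(4) sum.insert)
  then have "f t - f ((t - fst p) * (1 - last_value D (fst p))) + ?S +
      (f ((t - fst p) * (1 - snd p)) - f ((t - r) * (1 - snd p))) =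
      f t - f ((t - r) * (1 - Max (insert 0 (snd ` D)))) +
      (\<Sum>q\<in>D. f ((t - fst q) * (1 - snd q)) - f ((t - fst q) * (1 - last_value D (fst q))))"
    unfolding last_D by linarith
  then show ?case
    using has_integral_combine[OF p_bounds(1,2) 1 2] by (simp only:)
qed

text \<open>For the subsolution the integrand may change sign, so the gauge integral is compared
  with the integral of the positive part; if the latter is infinite there is nothing to
  show.\<close>

lemma ennreal_has_integral_le_nn_integral:
  fixes f :: "real \<Rightarrow> real"
  assumes f: "f \<in> borel_measurable borel" and I: "(f has_integral I) S" and S: "S \<in> sets borel"
  shows "ennreal I \<le> (\<integral>\<^sup>+x\<in>S. ennreal (f x) \<partial>lborel)"
proof (cases "(\<integral>\<^sup>+x\<in>S. ennreal (f x) \<partial>lborel)")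
  case (real r)
  let ?q = "\<lambda>x. indicator S x * max 0 (f x)"
  have "(\<integral>\<^sup>+x. ennreal (?q x) \<partial>lborel) = (\<integral>\<^sup>+x\<in>S. ennreal (f x) \<partial>lborel)"
    by (intro nn_integral_cong) (auto simp: indicator_def max_def ennreal_neg)
  with real have "(\<integral>\<^sup>+x. ennreal (?q x) \<partial>lborel) = ennreal r"
    by simp
  then have "(?q has_integral r) UNIV"
    using f S real by (intro nn_integral_has_integral) auto
  moreover have "((\<lambda>x. if x \<in> S then f x else 0) has_integral I) UNIV"
    using I by (simp add: has_integral_restrict_UNIV)
  ultimately have "I \<le> r"
    by (intro has_integral_le[of "\<lambda>x. if x \<in> S then f x else 0" I UNIV ?q r]) (auto simp: indicator_def)
  then show ?thesis
    using real by (simp add: ennreal_leI)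
qed simp

text \<open>Maps the remaining range above \<open>y\<close> to the unit interval. At
  \<open>y = 1\<close> the affine map degenerates, but both sides are 0.\<close>

lemma nn_integral_rescale_interval:
  fixes f :: "real \<Rightarrow> ennreal"
  assumes [measurable]: "f \<in> borel_measurable borel" and y: "y \<le> 1"
  shows "(\<integral>\<^sup>+x\<in>{y<..y + (1 - y) * c}. f x \<partial>lborel) =
           ennreal (1 - y) * (\<integral>\<^sup>+x\<in>{0<..c}. f (y + (1 - y) * x) \<partial>lborel)"
proof (cases "y = 1")
  case False
  then have y': "1 - y > 0"
    using y by simp
  have "(\<integral>\<^sup>+x\<in>{y<..y + (1 - y) * c}. f x \<partial>lborel) =
      ennreal \<bar>1 - y\<bar> * (\<integral>\<^sup>+x. f (y + (1 - y) * x) * indicator {y<..y + (1 - y) * c} (y + (1 - y) * x) \<partial>lborel)"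
    using y' by (intro nn_integral_real_affine) auto
  also have "(\<integral>\<^sup>+x. f (y + (1 - y) * x) * indicator {y<..y + (1 - y) * c} (y + (1 - y) * x) \<partial>lborel) =
      (\<integral>\<^sup>+x\<in>{0<..c}. f (y + (1 - y) * x) \<partial>lborel)"
    using y' by (intro nn_integral_cong) (auto simp: indicator_def zero_less_mult_iff)
  finally show ?thesis
    using y' by simp
qed simp

text \<open>Here \<open>y\<close> is the last selected value and \<open>\<phi>\<close> the width of the acceptance window relative to the
  remaining range \<open>1 - y\<close>. The coercion to \<open>ennreal\<close> takes the positive part.\<close>
definition gain :: "(real \<Rightarrow> real) \<Rightarrow> (real \<Rightarrow> real) \<Rightarrow> real \<Rightarrow> real \<Rightarrow> real \<times> real \<Rightarrow> ennreal" where
  "gain f \<phi> t y p = ennreal (1 + f ((t - fst p) * (1 - snd p)) - f ((t - fst p) * (1 - y))) *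
     indicator {y<..y + (1 - y) * \<phi> ((t - fst p) * (1 - y))} (snd p)"

lemma gain_measurable:
  assumes [measurable]: "f \<in> borel_measurable borel" "\<phi> \<in> borel_measurable borel"
    "y \<in> borel_measurable N" "p \<in> N \<rightarrow>\<^sub>M borel"
  shows "(\<lambda>x. gain f \<phi> t (y x) (p x)) \<in> borel_measurable N"
proof -
  have [measurable]: "(\<lambda>x. fst (p x)) \<in> borel_measurable N" "(\<lambda>x. snd (p x)) \<in> borel_measurable N"
    using measurable_compose[OF assms(4) borel_measurable_continuous_onI[OF continuous_on_fst[OF continuous_on_id]]]
      measurable_compose[OF assms(4) borel_measurable_continuous_onI[OF continuous_on_snd[OF continuous_on_id]]]
    by simp_all
  have "(\<lambda>x. gain f \<phi> t (y x) (p x)) = (\<lambda>x.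
      if y x < snd (p x) \<and> snd (p x) \<le> y x + (1 - y x) * \<phi> ((t - fst (p x)) * (1 - y x))
      then ennreal (1 + f ((t - fst (p x)) * (1 - snd (p x))) - f ((t - fst (p x)) * (1 - y x))) else 0)"
    by (auto simp: gain_def indicator_def)
  also have "\<dots> \<in> borel_measurable N"
    by measurable
  finally show ?thesis .
qed

text \<open>Fubini, followed by rescaling the window above the current record, brings in the
  integral of the dynamic programming inequality at the remaining area. The bound
  \<open>\<phi> \<le> 1\<close> keeps the window below value 1, so the strip does not truncate
  it.\<close>

lemma nn_integral_gain:
  assumes f: "f \<in> borel_measurable borel" and \<phi>: "\<phi> \<in> borel_measurable borel" "\<And>z. 0 \<le> z \<Longrightarrow> \<phi> z \<le> 1"
    and D: "finite D" "snd ` D \<subseteq> {0..1}"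
  shows "(\<integral>\<^sup>+p\<in>strip_until t. gain f \<phi> t (last_value D (fst p)) p \<partial>lborel) =
    (\<integral>\<^sup>+s\<in>{0<..t}. ennreal (1 - last_value D s) * (\<integral>\<^sup>+x\<in>{0<..\<phi> ((t - s) * (1 - last_value D s))}.
        ennreal (1 + f ((t - s) * (1 - last_value D s) * (1 - x)) - f ((t - s) * (1 - last_value D s))) \<partial>lborel) \<partial>lborel)"
proof -
  have "(\<lambda>p :: real \<times> real. last_value D (fst p)) \<in> borel_measurable (borel \<Otimes>\<^sub>M borel)"
    by (rule measurable_compose[OF measurable_fst last_value_measurable[OF D(1)]])
  then have [measurable]: "(\<lambda>p. gain f \<phi> t (last_value D (fst p)) p) \<in> borel_measurable borel"
    unfolding borel_prod by (intro gain_measurable f \<phi>) simp_all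
  have "(\<integral>\<^sup>+p\<in>strip_until t. gain f \<phi> t (last_value D (fst p)) p \<partial>lborel) =
      (\<integral>\<^sup>+s. (\<integral>\<^sup>+x. gain f \<phi> t (last_value D s) (s, x) * indicator (strip_until t) (s, x) \<partial>lborel) \<partial>lborel)"
    unfolding lborel_prod[symmetric]
    by (subst lborel.nn_integral_fst[symmetric]) (auto simp: lborel_prod intro!: borel_measurable_times_ennreal)
  also have "\<dots> = (\<integral>\<^sup>+s\<in>{0<..t}. ennreal (1 - last_value D s) * (\<integral>\<^sup>+x\<in>{0<..\<phi> ((t - s) * (1 - last_value D s))}.
        ennreal (1 + f ((t - s) * (1 - last_value D s) * (1 - x)) - f ((t - s) * (1 - last_value D s))) \<partial>lborel) \<partial>lborel)"
  proof (rule nn_integral_cong)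
    fix s :: real
    define y where "y = last_value D s"
    have y: "0 \<le> y" "y \<le> 1"
      using last_value_bounds[OF D, of s] by (auto simp: y_def)
    define z where "z = (t - s) * (1 - y)"
    show "(\<integral>\<^sup>+x. gain f \<phi> t (last_value D s) (s, x) * indicator (strip_until t) (s, x) \<partial>lborel) =
      ennreal (1 - last_value D s) * (\<integral>\<^sup>+x\<in>{0<..\<phi> ((t - s) * (1 - last_value D s))}.
        ennreal (1 + f ((t - s) * (1 - last_value D s) * (1 - x)) - f ((t - s) * (1 - last_value D s))) \<partial>lborel) * indicator {0<..t} s"
      unfolding y_def[symmetric] z_def[symmetric]
    proof (cases "s \<in> {0<..t}")
      case True
      have "z \<ge> 0"
        using True y by (simp add: z_def)
      then have "(1 - y) * \<phi> z \<le> (1 - y) * 1"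
        using y \<phi>(2) by (intro mult_left_mono) auto
      then have le: "y + (1 - y) * \<phi> z \<le> 1"
        by simp
      have "(\<integral>\<^sup>+x. gain f \<phi> t y (s, x) * indicator (strip_until t) (s, x) \<partial>lborel) =
          (\<integral>\<^sup>+x\<in>{y<..y + (1 - y) * \<phi> z}. ennreal (1 + f ((t - s) * (1 - x)) - f z) \<partial>lborel)"
        using True y le by (intro nn_integral_cong) (auto simp: gain_def z_def strip_until_def indicator_def)
      also have "\<dots> = ennreal (1 - y) * (\<integral>\<^sup>+x\<in>{0<..\<phi> z}. ennreal (1 + f ((t - s) * (1 - (y + (1 - y) * x))) - f z) \<partial>lborel)"
        using f y by (intro nn_integral_rescale_interval) auto
      also have "(\<lambda>x. (t - s) * (1 - (y + (1 - y) * x))) = (\<lambda>x. z * (1 - x))"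
        by (auto simp: z_def algebra_simps)
      finally show "(\<integral>\<^sup>+x. gain f \<phi> t y (s, x) * indicator (strip_until t) (s, x) \<partial>lborel) =
          ennreal (1 - y) * (\<integral>\<^sup>+x\<in>{0<..\<phi> z}. ennreal (1 + f (z * (1 - x)) - f z) \<partial>lborel) * indicator {0<..t} s"
        using True by (simp add: fun_eq_iff)
    qed (auto simp: strip_until_def)
  qed
  finally show ?thesis .
qed

subsection \<open>The upper bound\<close>

lemma increasing_atoms_last_value_less:
  assumes "finite D" "increasing_atoms D" "D \<subseteq> strip_until t" "p \<in> D"
  shows "last_value D (fst p) < snd p"
proof -
  have "0 < snd p"
    using assms by (auto simp: strip_until_def)
  moreover have "snd q < snd p" if "q \<in> D" "fst q < fst p" for q
    using assms that unfolding increasing_atoms_def by fastforce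
  ultimately show ?thesis
    unfolding last_value_def using assms(1) by (subst Max_less_iff) auto
qed

text \<open>At time \<open>t\<close> the remaining area is 0 whatever has been selected, so the
  terminal term is \<open>f 0\<close>.\<close>

lemma telescoping_strip:
  fixes f f' :: "real \<Rightarrow> real"
  assumes deriv: "\<And>z. z \<ge> 0 \<Longrightarrow> (f has_real_derivative f' z) (at z)"
    and D: "finite D" "increasing_atoms D" "D \<subseteq> strip_until t" and t: "0 \<le> t"
  shows "((\<lambda>s. (1 - last_value D s) * f' ((t - s) * (1 - last_value D s))) has_integral
          f t - f 0 + (\<Sum>p\<in>D. f ((t - fst p) * (1 - snd p)) - f ((t - fst p) * (1 - last_value D (fst p))))) {0..t}"
proof -
  have "D \<subseteq> {0..t} \<times> {0..1}"
    using D(3) by (force simp: strip_until_def)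
  from telescoping_has_integral[OF deriv D(1,2) this t order_refl] show ?thesis
    by simp
qed

lemma sum_gain_eq:
  assumes "finite D" "increasing_atoms D" "D \<subseteq> strip_until t"
    and window: "\<And>p. p \<in> D \<Longrightarrow> snd p \<le> last_value D (fst p) +
      (1 - last_value D (fst p)) * \<phi> ((t - fst p) * (1 - last_value D (fst p)))"
  shows "(\<Sum>p\<in>D. gain f \<phi> t (last_value D (fst p)) p) =
    (\<Sum>p\<in>D. ennreal (1 + f ((t - fst p) * (1 - snd p)) - f ((t - fst p) * (1 - last_value D (fst p)))))"
  using increasing_atoms_last_value_less[OF assms(1-3)] window by (intro sum.cong) (auto simp: gain_def)

text \<open>By the supersolution property the area is at most the telescoped integral, which equals
  \<open>g t - g 0\<close> plus the jumps of \<open>g\<close> at selections. Adding 1 per selection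
  turns each jump into an unrounded gain. The second claim holds because \<open>g\<close> increases,
  so all jumps are nonpositive; it provides the finiteness used for cancelling.\<close>

lemma pathwise_upper_bound:
  fixes g g' :: "real \<Rightarrow> real"
  assumes deriv: "\<And>z. z \<ge> 0 \<Longrightarrow> (g has_real_derivative g' z) (at z)"
    and meas: "g \<in> borel_measurable borel"
    and nonneg: "\<And>z. z \<ge> 0 \<Longrightarrow> 0 \<le> g' z"
    and super: "\<And>z. z \<ge> 0 \<Longrightarrow> (\<integral>\<^sup>+x\<in>{0..1}. ennreal (1 + g (z * (1 - x)) - g z) \<partial>lborel) \<le> ennreal (g' z)"
    and D: "finite D" "increasing_atoms D" "D \<subseteq> strip_until t" and t: "0 \<le> t"
  shows "of_nat (card D) + (\<integral>\<^sup>+p\<in>strip_until t. gain g (\<lambda>_. 1) t (last_value D (fst p)) p \<partial>lborel)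
           \<le> ennreal (g t - g 0) + (\<Sum>p\<in>D. gain g (\<lambda>_. 1) t (last_value D (fst p)) p)" (is ?path)
    and "(\<integral>\<^sup>+p\<in>strip_until t. gain g (\<lambda>_. 1) t (last_value D (fst p)) p \<partial>lborel) \<le> ennreal (g t - g 0)" (is ?area)
proof -
  have snd_D: "snd ` D \<subseteq> {0..1}" and fst_D: "\<And>p. p \<in> D \<Longrightarrow> fst p \<le> t"
    using D(3) by (force simp: strip_until_def)+
  note Y = last_value_bounds[OF D(1) snd_D]
  have mono: "g a \<le> g b" if "0 \<le> a" "a \<le> b" for a b
    using that deriv nonneg by (intro DERIV_nonneg_imp_nondecreasing[OF that(2)]) (meson order.trans)
  let ?F = "\<lambda>p. g ((t - fst p) * (1 - snd p)) - g ((t - fst p) * (1 - last_value D (fst p)))"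
  let ?I = "g t - g 0 + (\<Sum>p\<in>D. ?F p)"
  have "(\<integral>\<^sup>+p\<in>strip_until t. gain g (\<lambda>_. 1) t (last_value D (fst p)) p \<partial>lborel) =
      (\<integral>\<^sup>+s\<in>{0<..t}. ennreal (1 - last_value D s) * (\<integral>\<^sup>+x\<in>{0<..1}.
        ennreal (1 + g ((t - s) * (1 - last_value D s) * (1 - x)) - g ((t - s) * (1 - last_value D s))) \<partial>lborel) \<partial>lborel)"
    using D(1) snd_D meas by (intro nn_integral_gain) auto
  also have "\<dots> \<le> (\<integral>\<^sup>+s\<in>{0..t}. ennreal ((1 - last_value D s) * g' ((t - s) * (1 - last_value D s))) \<partial>lborel)"
  proof (rule nn_integral_mono)
    fix s :: real
    define z where "z = (t - s) * (1 - last_value D s)"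
    have "ennreal (1 - last_value D s) * (\<integral>\<^sup>+x\<in>{0<..1}. ennreal (1 + g (z * (1 - x)) - g z) \<partial>lborel) \<le>
        ennreal ((1 - last_value D s) * g' z)" if "s \<in> {0<..t}"
    proof -
      have z: "z \<ge> 0"
        using that Y[of s] by (simp add: z_def)
      have "(\<integral>\<^sup>+x\<in>{0<..1}. ennreal (1 + g (z * (1 - x)) - g z) \<partial>lborel) \<le>
          (\<integral>\<^sup>+x\<in>{0..1}. ennreal (1 + g (z * (1 - x)) - g z) \<partial>lborel)"
        by (intro nn_integral_mono) (auto simp: indicator_def)
      also have "\<dots> \<le> ennreal (g' z)"
        by (rule super[OF z])
      finally show ?thesis
        using Y[of s] by (simp add: ennreal_mult' mult_left_mono)
    qed
    then show "ennreal (1 - last_value D s) * (\<integral>\<^sup>+x\<in>{0<..1}.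
        ennreal (1 + g ((t - s) * (1 - last_value D s) * (1 - x)) - g ((t - s) * (1 - last_value D s))) \<partial>lborel) *
        indicator {0<..t} s \<le> ennreal ((1 - last_value D s) * g' ((t - s) * (1 - last_value D s))) * indicator {0..t} s"
      unfolding z_def[symmetric] by (auto simp: indicator_def)
  qed
  also have "\<dots> = ennreal ?I"
  proof (rule nn_integral_has_integral_lebesgue'[OF _ telescoping_strip[OF deriv D t]])
    fix s assume "s \<in> {0..t}"
    then show "0 \<le> (1 - last_value D s) * g' ((t - s) * (1 - last_value D s))"
      using Y[of s] by (intro mult_nonneg_nonneg nonneg) auto
  qed
  finally have area: "(\<integral>\<^sup>+p\<in>strip_until t. gain g (\<lambda>_. 1) t (last_value D (fst p)) p \<partial>lborel) \<le> ennreal ?I" .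
  have "?F p \<le> 0" if "p \<in> D" for p
  proof -
    have "g ((t - fst p) * (1 - snd p)) \<le> g ((t - fst p) * (1 - last_value D (fst p)))"
      using increasing_atoms_last_value_less[OF D that] fst_D[OF that] snd_D that
      by (intro mono mult_left_mono mult_nonneg_nonneg) auto
    then show ?thesis
      by simp
  qed
  then have "(\<Sum>p\<in>D. ?F p) \<le> 0"
    by (intro sum_nonpos)
  then have "ennreal ?I \<le> ennreal (g t - g 0)"
    by (intro ennreal_leI) simp
  with area show ?area
    by (rule order.trans)
  have "0 \<le> ?I"
  proof (rule has_integral_nonneg[OF telescoping_strip[OF deriv D t]])
    fix s assume "s \<in> {0..t}"
    then show "0 \<le> (1 - last_value D s) * g' ((t - s) * (1 - last_value D s))"
      using Y[of s] by (intro mult_nonneg_nonneg nonneg) auto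
  qed
  have "of_nat (card D) + (\<integral>\<^sup>+p\<in>strip_until t. gain g (\<lambda>_. 1) t (last_value D (fst p)) p \<partial>lborel) \<le>
      ennreal (real (card D)) + ennreal ?I"
    using area by (simp add: ennreal_of_nat_eq_real_of_nat add_left_mono)
  also have "\<dots> = ennreal (real (card D) + ?I)"
    using \<open>0 \<le> ?I\<close> by (simp add: ennreal_plus)
  also have "real (card D) + ?I = (g t - g 0) + (\<Sum>p\<in>D. 1 + ?F p)"
    by (simp add: sum.distrib)
  \<comment> \<open>Taking positive parts can only enlarge the right-hand side. This covers policies
    that accept atoms of negative unrounded gain.\<close>
  also have "ennreal \<dots> \<le> ennreal ((g t - g 0) + (\<Sum>p\<in>D. max 0 (1 + ?F p)))"
    by (intro ennreal_leI add_left_mono sum_mono) auto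
  also have "\<dots> = ennreal (g t - g 0) + (\<Sum>p\<in>D. ennreal (max 0 (1 + ?F p)))"
    using mono[of 0 t] t by (simp only: sum_ennreal max.cobounded1) (auto intro!: ennreal_plus sum_nonneg)
  also have "(\<Sum>p\<in>D. ennreal (max 0 (1 + ?F p))) = (\<Sum>p\<in>D. gain g (\<lambda>_. 1) t (last_value D (fst p)) p)"
  proof -
    have "(\<Sum>p\<in>D. gain g (\<lambda>_. 1) t (last_value D (fst p)) p) =
        (\<Sum>p\<in>D. ennreal (1 + g ((t - fst p) * (1 - snd p)) - g ((t - fst p) * (1 - last_value D (fst p)))))"
      by (rule sum_gain_eq[OF D]) (use snd_D in auto)
    also have "\<dots> = (\<Sum>p\<in>D. ennreal (max 0 (1 + ?F p)))"
      by (intro sum.cong) (auto simp: max_def ennreal_neg add_diff_eq)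
    finally show ?thesis
      by simp
  qed
  finally show ?path .
qed

lemma strictly_increasing_until_infinity:
  fixes \<tau> :: "nat \<Rightarrow> ennreal"
  assumes "\<And>i. \<tau> i < \<tau> (Suc i) \<or> \<tau> (Suc i) = \<infinity>" "i < j" "\<tau> j < \<infinity>"
  shows "\<tau> i < \<tau> j"
  using assms(2,3)
proof (induction j)
  case (Suc j)
  have "\<tau> j < \<tau> (Suc j)"
    using assms(1)[of j] Suc.prems by auto
  then show ?case
    using Suc by (cases "i = j") (auto intro: less_trans)
qed simp

section \<open>Expectations under an arbitrary policy\<close>

context unit_poisson_process
begin

text \<open>The two edges missing from \<open>strip_until t\<close> have area 0, so their atom count
  is Poisson of mean 0 and vanishes almost surely.\<close>

lemma AE_atoms_in_strip_until:
  assumes "0 \<le> t"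
  shows "AE \<omega> in M. \<forall>p\<in>X \<omega>. fst p \<le> t \<longrightarrow> p \<in> strip_until t"
proof -
  let ?B = "({0} \<times> {0..1}) \<union> ({0..t} \<times> {0}) :: (real \<times> real) set"
  have B: "?B \<in> sets borel" "bounded ?B" "?B \<subseteq> strip"
  proof -
    show "?B \<in> sets borel"
      by (intro sets.Un borel_Times) auto
    show "bounded ?B"
      by (intro bounded_Un[THEN iffD2] conjI bounded_Times) auto
    show "?B \<subseteq> strip"
      by (auto simp: strip_def)
  qed
  have "{0} \<times> {0..1} \<in> null_sets (lborel :: (real \<times> real) measure)" "{0..t} \<times> {0} \<in> null_sets (lborel :: (real \<times> real) measure)"
    unfolding lborel_prod[symmetric] by (auto intro!: null_setsI simp: lborel.emeasure_pair_measure_Times)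
  then have "?B \<in> null_sets lborel"
    by (rule null_sets.Un)
  then have "measure lborel ?B = 0"
    by (simp add: null_setsD1 measure_def)
  then have "prob {\<omega> \<in> space M. num_atoms X ?B \<omega> = 0} = 1"
    using num_atoms_poisson[OF B, of 0] by simp
  moreover have "{\<omega> \<in> space M. num_atoms X ?B \<omega> = 0} \<in> events"
    using num_atoms_measurable[OF B(1,2)] by measurable
  ultimately have "AE \<omega> in M. num_atoms X ?B \<omega> = 0"
    by (simp add: prob_Collect_eq_1)
  with AE_space show ?thesis
  proof eventually_elim
    case (elim \<omega>)
    have "finite (X \<omega> \<inter> ?B)"
      by (rule locally_finite[OF elim(1) B(2)])
    then have "X \<omega> \<inter> ?B = {}"
      using elim(2) by (simp only: card_0_eq)
    show ?case
    proof (intro ballI impI)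
      fix p assume p: "p \<in> X \<omega>" "fst p \<le> t"
      obtain s x where [simp]: "p = (s, x)"
        by (cases p)
      have "p \<notin> ?B" "p \<in> strip"
        using p \<open>X \<omega> \<inter> ?B = {}\<close> atoms_in_strip[OF elim(1)] by blast+
      then show "p \<in> strip_until t"
        using p(2) by (auto simp: strip_def strip_until_def)
    qed
  qed
qed

text \<open>A record above \<open>y\<close> before time \<open>s\<close> was already set by some
  rational time before \<open>s\<close>. The question is thus reduced to events decided at fixed
  times, which is all that \<open>adapted\<close> asks of a selection.\<close>

lemma last_value_predictable:
  assumes fin: "\<And>\<omega>. \<omega> \<in> space M \<Longrightarrow> finite (D \<omega>)"
    and adapted: "\<And>r y. {\<omega> \<in> space M. \<exists>p\<in>D \<omega>. fst p \<le> r \<and> y < snd p} \<in> sets (natural_filtration M X (ennreal r))"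
  shows "(\<lambda>x. last_value (D (fst x)) (fst (snd x))) \<in> borel_measurable predictable"
proof (rule borel_measurableI_greater)
  fix y :: real
  let ?A = "\<lambda>q. {\<omega> \<in> space M. \<exists>p\<in>D \<omega>. fst p \<le> of_rat q \<and> y < snd p}"
  show "{x \<in> space predictable. y < last_value (D (fst x)) (fst (snd x))} \<in> sets predictable"
  proof (cases "y < 0")
    case True
    then have "{x \<in> space predictable. y < last_value (D (fst x)) (fst (snd x))} = space predictable"
      using less_last_value_iff[OF fin] by auto
    then show ?thesis
      by (simp only: sets.top)
  next
    case False
    have dense: "(\<exists>p\<in>D'. fst p < s \<and> y < snd p) \<longleftrightarrow> (\<exists>q. of_rat q < s \<and> (\<exists>p\<in>D'. fst p \<le> of_rat q \<and> y < snd p))"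
      for D' :: "(real \<times> real) set" and s
    proof
      assume "\<exists>p\<in>D'. fst p < s \<and> y < snd p"
      then obtain p where p: "p \<in> D'" "fst p < s" "y < snd p"
        by auto
      obtain q where "fst p < of_rat q" "of_rat q < s"
        using of_rat_dense[OF p(2)] by auto
      with p show "\<exists>q. of_rat q < s \<and> (\<exists>p\<in>D'. fst p \<le> of_rat q \<and> y < snd p)"
        by (intro exI[of _ q]) (auto intro!: bexI[of _ p])
    qed force
    have "{x \<in> space predictable. y < last_value (D (fst x)) (fst (snd x))} =
        {x \<in> space predictable. \<exists>q. of_rat q < fst (snd x) \<and> fst x \<in> ?A q}"
    proof (intro Collect_cong conj_cong refl)
      fix x assume "x \<in> space predictable"
      then have x: "fst x \<in> space M"
        by auto
      have "y < last_value (D (fst x)) (fst (snd x)) \<longleftrightarrow> (\<exists>p\<in>D (fst x). fst p < fst (snd x) \<and> y < snd p)"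
        using False less_last_value_iff[OF fin[OF x]] by simp
      also have "\<dots> \<longleftrightarrow> (\<exists>q. of_rat q < fst (snd x) \<and> fst x \<in> ?A q)"
        unfolding dense[of "D (fst x)"] using x by simp
      finally show "y < last_value (D (fst x)) (fst (snd x)) \<longleftrightarrow> (\<exists>q. of_rat q < fst (snd x) \<and> fst x \<in> ?A q)" .
    qed
    also have "\<dots> \<in> sets predictable"
      by (intro past_predictable adapted)
    finally show ?thesis .
  qed
qed

text \<open>A stopping time is not itself measurable at time \<open>r\<close>, but its truncation at
  \<open>r\<close> is. This suffices because only selections up to \<open>r\<close> are
  inspected.\<close>

lemma policy_selection_adapted:
  fixes \<tau> :: "nat \<Rightarrow> 'a \<Rightarrow> ennreal"
  assumes \<tau>: "\<And>i. stopping_time (natural_filtration M X) (\<tau> i)"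
  shows "{\<omega> \<in> space M. \<exists>p\<in>{p \<in> X \<omega> \<inter> strip_until t. \<exists>i. \<tau> i \<omega> = ennreal (fst p)}. fst p \<le> r \<and> y < snd p}
    \<in> sets (natural_filtration M X (ennreal r))"
proof -
  let ?F = "natural_filtration M X (ennreal r)"
  have [measurable]: "(\<lambda>\<omega>. min (\<tau> i \<omega>) (ennreal r)) \<in> borel_measurable ?F" for i
  proof (rule borel_measurableI_le)
    fix c
    show "{\<omega> \<in> space ?F. min (\<tau> i \<omega>) (ennreal r) \<le> c} \<in> sets ?F"
    proof (cases "ennreal r \<le> c")
      case True
      then have "{\<omega> \<in> space ?F. min (\<tau> i \<omega>) (ennreal r) \<le> c} = space ?F"
        by (auto simp: min_le_iff_disj)
      then show ?thesis
        by (simp only: sets.top)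
    next
      case False
      have "{\<omega> \<in> space (natural_filtration M X c). \<tau> i \<omega> \<le> c} \<in> sets (natural_filtration M X c)"
        using stopping_timeD[OF \<tau>[of i], of c] by (simp only: pred_def)
      also have "\<dots> \<subseteq> sets ?F"
        using False by (intro sets_natural_filtration_mono) auto
      also have "{\<omega> \<in> space (natural_filtration M X c). \<tau> i \<omega> \<le> c} = {\<omega> \<in> space ?F. min (\<tau> i \<omega>) (ennreal r) \<le> c}"
        using False by (auto simp: min_le_iff_disj)
      finally show ?thesis .
    qed
  qed
  have [measurable]: "Measurable.pred (?F \<Otimes>\<^sub>M (borel \<Otimes>\<^sub>M borel :: (real \<times> real) measure)) (\<lambda>x. \<tau> i (fst x) \<le> ennreal r)" for i
    by (rule measurable_compose[OF measurable_fst stopping_timeD[OF \<tau>]])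
  \<comment> \<open>The condition \<open>\<tau> i (fst x) \<le> ennreal r\<close> separates a
    selection at time \<open>r\<close> from a later one truncated to \<open>r\<close>.\<close>
  define C where "C = {x \<in> space (?F \<Otimes>\<^sub>M (borel \<Otimes>\<^sub>M borel)). fst (snd x) \<le> t \<and> y < snd (snd x) \<and>
    (\<exists>i. min (\<tau> i (fst x)) (ennreal r) = ennreal (fst (snd x)) \<and> \<tau> i (fst x) \<le> ennreal r)}"
  have "C \<in> sets (?F \<Otimes>\<^sub>M (borel \<Otimes>\<^sub>M borel))"
    unfolding C_def by measurable
  then have "C \<in> sets (?F \<Otimes>\<^sub>M borel)"
    by (simp only: borel_prod)
  then have "{\<omega> \<in> space M. \<exists>p\<in>X \<omega> \<inter> strip_until r. (\<omega>, p) \<in> C} \<in> sets ?F"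
    by (rule exists_atom_adapted)
  also have "{\<omega> \<in> space M. \<exists>p\<in>X \<omega> \<inter> strip_until r. (\<omega>, p) \<in> C} =
      {\<omega> \<in> space M. \<exists>p\<in>{p \<in> X \<omega> \<inter> strip_until t. \<exists>i. \<tau> i \<omega> = ennreal (fst p)}. fst p \<le> r \<and> y < snd p}"
  proof (intro Collect_cong conj_cong refl)
    fix \<omega> assume \<omega>: "\<omega> \<in> space M"
    have "p \<in> strip_until r \<and> (\<omega>, p) \<in> C \<longleftrightarrow> p \<in> strip_until t \<and> (\<exists>i. \<tau> i \<omega> = ennreal (fst p)) \<and> fst p \<le> r \<and> y < snd p" for p
    proof -
      have "min (\<tau> i \<omega>) (ennreal r) = ennreal (fst p) \<and> \<tau> i \<omega> \<le> ennreal r \<longleftrightarrow> \<tau> i \<omega> = ennreal (fst p)"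
        if "fst p \<le> r" for i
        using that by (auto simp: min_def ennreal_leI)
      then show ?thesis
        using \<omega> by (cases p) (auto simp: C_def strip_until_def space_pair_measure)
    qed
    then show "(\<exists>p\<in>X \<omega> \<inter> strip_until r. (\<omega>, p) \<in> C) \<longleftrightarrow>
        (\<exists>p\<in>{p \<in> X \<omega> \<inter> strip_until t. \<exists>i. \<tau> i \<omega> = ennreal (fst p)}. fst p \<le> r \<and> y < snd p)"
      by blast
  qed
  finally show ?thesis .
qed

text \<open>Taking expectations of the pathwise bound, the gains at all atoms and the area have
  equal means by the compensator formula. The area mean is finite and cancels.\<close>

theorem policy_upper_bound:
  fixes g g' :: "real \<Rightarrow> real"
  assumes deriv: "\<And>z. z \<ge> 0 \<Longrightarrow> (g has_real_derivative g' z) (at z)"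
    and meas: "g \<in> borel_measurable borel"
    and nonneg: "\<And>z. z \<ge> 0 \<Longrightarrow> 0 \<le> g' z"
    and super: "\<And>z. z \<ge> 0 \<Longrightarrow> (\<integral>\<^sup>+x\<in>{0..1}. ennreal (1 + g (z * (1 - x)) - g z) \<partial>lborel) \<le> ennreal (g' z)"
    and policy: "online_policy M X t \<tau>" and t: "0 \<le> t"
  shows "expected_length M \<tau> \<le> ennreal (g t - g 0)"
proof -
  have \<tau>: "stopping_time (natural_filtration M X) (\<tau> i)" for i
    using policy by (simp add: online_policy_def)
  define D where "D = (\<lambda>\<omega>. {p \<in> X \<omega> \<inter> strip_until t. \<exists>i. \<tau> i \<omega> = ennreal (fst p)})"
  have fin: "finite (X \<omega> \<inter> strip_until t)" if "\<omega> \<in> space M" for \<omega>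
    using that by (rule locally_finite[OF _ bounded_strip_until])
  have D: "finite (D \<omega>)" "D \<omega> \<subseteq> X \<omega> \<inter> strip_until t" if "\<omega> \<in> space M" for \<omega>
  proof -
    show "D \<omega> \<subseteq> X \<omega> \<inter> strip_until t"
      by (auto simp: D_def)
    then show "finite (D \<omega>)"
      using fin[OF that] by (rule finite_subset)
  qed
  define K where "K = (\<lambda>x. gain g (\<lambda>_. 1) t (last_value (D (fst x)) (fst (snd x))) (snd x))"
  have "(\<lambda>x. last_value (D (fst x)) (fst (snd x))) \<in> borel_measurable predictable"
  proof (rule last_value_predictable)
    show "{\<omega> \<in> space M. \<exists>p\<in>D \<omega>. fst p \<le> r \<and> y < snd p} \<in> sets (natural_filtration M X (ennreal r))" for r y
      unfolding D_def by (rule policy_selection_adapted[OF \<tau>])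
  qed (rule D(1))
  then have K: "K \<in> borel_measurable predictable"
    unfolding K_def by (intro gain_measurable meas) auto
  define len where "len = (\<lambda>\<omega>. \<Sum>i. indicator {\<omega>. \<tau> i \<omega> < \<infinity>} \<omega> :: ennreal)"
  have [measurable]: "\<tau> i \<in> borel_measurable M" for i
    by (rule measurable_stopping_time[OF \<tau>]) (auto simp: sets_natural_filtration_subset)
  have "len = (\<lambda>\<omega>. \<Sum>i. if \<tau> i \<omega> < \<infinity> then 1 else 0)"
    by (auto simp: len_def indicator_def fun_eq_iff intro!: suminf_cong)
  then have len [measurable]: "len \<in> borel_measurable M"
    by simp
  let ?atoms = "\<lambda>\<omega>. \<integral>\<^sup>+p. K (\<omega>, p) \<partial>count_space (X \<omega> \<inter> strip_until t)"
  let ?area = "\<lambda>\<omega>. \<integral>\<^sup>+p\<in>strip_until t. K (\<omega>, p) \<partial>lborel"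
  have "AE \<omega> in M. (\<forall>i. \<tau> i \<omega> < \<tau> (Suc i) \<omega> \<or> \<tau> (Suc i) \<omega> = \<infinity>) \<and>
        (\<forall>i. \<tau> i \<omega> = \<infinity> \<or> (\<exists>p\<in>X \<omega>. fst p \<le> t \<and> \<tau> i \<omega> = ennreal (fst p))) \<and>
        increasing_atoms (selected_atoms X \<tau> \<omega>)"
    using policy by (simp add: online_policy_def)
  with AE_atoms_in_strip_until[OF t] AE_space
  have path: "AE \<omega> in M. len \<omega> + ?area \<omega> \<le> ennreal (g t - g 0) + ?atoms \<omega> \<and> ?area \<omega> \<le> ennreal (g t - g 0)"
  proof eventually_elim
    case (elim \<omega>)
    then have incr: "\<tau> i \<omega> < \<tau> (Suc i) \<omega> \<or> \<tau> (Suc i) \<omega> = \<infinity>" for i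
      by blast
    have "D \<omega> \<subseteq> selected_atoms X \<tau> \<omega>"
      by (auto simp: D_def selected_atoms_def)
    then have incr_D: "increasing_atoms (D \<omega>)"
      using elim unfolding increasing_atoms_def by blast
    define I where "I = {i. \<tau> i \<omega> < \<infinity>}"
    have "\<exists>p\<in>D \<omega>. \<tau> i \<omega> = ennreal (fst p)" if i: "i \<in> I" for i
    proof -
      have "\<tau> i \<omega> \<noteq> \<infinity>"
        using i by (auto simp: I_def)
      then obtain p where "p \<in> X \<omega>" "fst p \<le> t" "\<tau> i \<omega> = ennreal (fst p)"
        using elim by blast
      then show ?thesis
        using elim unfolding D_def by blast
    qed
    then obtain p where p: "\<And>i. i \<in> I \<Longrightarrow> p i \<in> D \<omega> \<and> \<tau> i \<omega> = ennreal (fst (p i))"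
      by metis
    \<comment> \<open>Finite selection times are strictly increasing, hence distinct, so the number
      of selections is at most the number of atoms in \<open>D \<omega>\<close>.\<close>
    have "inj_on p I"
    proof (rule inj_onI, rule ccontr)
      fix i j assume ij: "i \<in> I" "j \<in> I" "p i = p j" "i \<noteq> j"
      then have "\<tau> i \<omega> = \<tau> j \<omega>"
        using p by metis
      moreover have "\<tau> i \<omega> < \<tau> j \<omega> \<or> \<tau> j \<omega> < \<tau> i \<omega>"
        using ij strictly_increasing_until_infinity[of "\<lambda>i. \<tau> i \<omega>", OF incr] unfolding I_def by (metis linorder_neqE_nat mem_Collect_eq)
      ultimately show False
        by simp
    qed
    moreover have "p ` I \<subseteq> D \<omega>"
      using p by auto
    ultimately have I: "finite I" "card I \<le> card (D \<omega>)"
      using D(1)[of \<omega>] elim by (auto intro: inj_on_finite card_inj_on_le)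
    have "len \<omega> = (\<Sum>i\<in>I. indicator {\<omega>. \<tau> i \<omega> < \<infinity>} \<omega>)"
      unfolding len_def by (rule suminf_finite[OF I(1)]) (auto simp: I_def)
    also have "\<dots> = of_nat (card I)"
      by (simp add: I_def indicator_def)
    also have "\<dots> \<le> of_nat (card (D \<omega>))"
      using I(2) by simp
    finally have len_le: "len \<omega> \<le> of_nat (card (D \<omega>))" .
    have area: "?area \<omega> = (\<integral>\<^sup>+p\<in>strip_until t. gain g (\<lambda>_. 1) t (last_value (D \<omega>) (fst p)) p \<partial>lborel)"
      by (simp add: K_def)
    have "(\<Sum>p\<in>D \<omega>. gain g (\<lambda>_. 1) t (last_value (D \<omega>) (fst p)) p) \<le> ?atoms \<omega>"
    proof -
      have fin': "finite (X \<omega> \<inter> strip_until t)" and sub: "D \<omega> \<subseteq> X \<omega> \<inter> strip_until t"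
        using fin D(2) elim by blast+
      show ?thesis
        unfolding nn_integral_count_space_finite[OF fin'] K_def fst_conv snd_conv
        by (rule sum_mono2[OF fin' sub]) simp
    qed
    moreover have "finite (D \<omega>)" "D \<omega> \<subseteq> strip_until t"
      using D elim by auto
    note bound = pathwise_upper_bound[OF deriv meas nonneg super this(1) incr_D this(2) t]
    ultimately show ?case
      using bound len_le unfolding area by (meson add_left_mono add_right_mono order.trans)
  qed
  have area_le: "(\<integral>\<^sup>+\<omega>. ?area \<omega> \<partial>M) \<le> (\<integral>\<^sup>+\<omega>. ennreal (g t - g 0) \<partial>M)"
    using path by (intro nn_integral_mono_AE) auto
  then have area_finite: "(\<integral>\<^sup>+\<omega>. ?area \<omega> \<partial>M) \<noteq> \<infinity>"
    by (auto simp: emeasure_space_1 top_unique)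
  have "(\<integral>\<^sup>+\<omega>. ?area \<omega> \<partial>M) + expected_length M \<tau> = (\<integral>\<^sup>+\<omega>. len \<omega> + ?area \<omega> \<partial>M)"
    unfolding expected_length_def len_def[symmetric]
    using measurable_nn_integral_strip[OF K] by (simp add: nn_integral_add add.commute)
  also have "\<dots> \<le> (\<integral>\<^sup>+\<omega>. ennreal (g t - g 0) + ?atoms \<omega> \<partial>M)"
    using path by (intro nn_integral_mono_AE) auto
  also have "\<dots> = ennreal (g t - g 0) + (\<integral>\<^sup>+\<omega>. ?atoms \<omega> \<partial>M)"
    using measurable_nn_integral_atoms[OF K] by (simp add: nn_integral_add emeasure_space_1)
  also have "(\<integral>\<^sup>+\<omega>. ?atoms \<omega> \<partial>M) = (\<integral>\<^sup>+\<omega>. ?area \<omega> \<partial>M)"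
    by (rule compensator_formula[OF K])
  finally show ?thesis
    using area_finite by (simp add: add.commute[of "ennreal _"] ennreal_add_left_cancel_le)
qed

end

subsection \<open>The lower bound\<close>

definition accept :: "(real \<Rightarrow> real) \<Rightarrow> real \<Rightarrow> real \<Rightarrow> real \<times> real \<Rightarrow> bool" where
  "accept \<phi> t y p \<longleftrightarrow> y < snd p \<and> snd p \<le> y + (1 - y) * \<phi> ((t - fst p) * (1 - y))"

text \<open>Whether \<open>p\<close> is selected depends only on the selections before \<open>p\<close>, so the \<open>n\<close>-th iterate
  decides correctly on all atoms with fewer than \<open>n\<close> predecessors.\<close>
primrec greedy :: "(real \<Rightarrow> real) \<Rightarrow> real \<Rightarrow> (real \<times> real) set \<Rightarrow> nat \<Rightarrow> (real \<times> real) set" where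
  "greedy \<phi> t Z 0 = {}"
| "greedy \<phi> t Z (Suc n) = {p \<in> Z. accept \<phi> t (last_value (greedy \<phi> t Z n) (fst p)) p}"

lemma greedy_subset: "greedy \<phi> t Z n \<subseteq> Z"
  by (cases n) auto

text \<open>Strong induction on the number of points before \<open>s\<close>: the decision about
  \<open>q\<close> consults only points strictly before \<open>fst q\<close>, and \<open>q\<close>
  itself is no longer among them, so the count drops even when arrival times coincide.\<close>

lemma greedy_stable:
  assumes Z: "finite Z" and "card {q \<in> Z. fst q < s} \<le> m" "card {q \<in> Z. fst q < s} \<le> n"
  shows "{q \<in> greedy \<phi> t Z m. fst q < s} = {q \<in> greedy \<phi> t Z n. fst q < s}"
  using assms(2,3)
proof (induction "card {q \<in> Z. fst q < s}" arbitrary: s m n rule: less_induct)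
  case less
  show ?case
  proof (cases "{q \<in> Z. fst q < s} = {}")
    case True
    then show ?thesis
      using greedy_subset[of \<phi> t Z] by blast
  next
    case False
    then have "card {q \<in> Z. fst q < s} \<noteq> 0"
      using Z by simp
    then obtain m' n' where mn: "m = Suc m'" "n = Suc n'"
      using less.prems by (metis le_zero_eq not0_implies_Suc)
    have "q \<in> greedy \<phi> t Z m \<longleftrightarrow> q \<in> greedy \<phi> t Z n" if q: "fst q < s" for q
    proof (cases "q \<in> Z")
      case True
      have "{r \<in> Z. fst r < fst q} \<subset> {r \<in> Z. fst r < s}"
        using q True by auto
      then have card: "card {r \<in> Z. fst r < fst q} < card {r \<in> Z. fst r < s}"
        using Z by (intro psubset_card_mono) auto
      then have "{r \<in> greedy \<phi> t Z m'. fst r < fst q} = {r \<in> greedy \<phi> t Z n'. fst r < fst q}"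
        using less.prems mn by (intro less.hyps) auto
      then have "last_value (greedy \<phi> t Z m') (fst q) = last_value (greedy \<phi> t Z n') (fst q)"
        by (simp add: last_value_def)
      then show ?thesis
        by (simp add: mn)
    next
      case False
      then show ?thesis
        using greedy_subset[of \<phi> t Z] by blast
    qed
    then show ?thesis
      by blast
  qed
qed

text \<open>Stability is applied at a time beyond all points. One further iteration then changes
  nothing, so the limit is a fixed point of the acceptance rule.\<close>

lemma greedy_limit:
  assumes Z: "finite Z" and n: "card Z \<le> n"
  shows "greedy \<phi> t Z n = greedy \<phi> t Z (card Z)"
proof -
  obtain s where s: "\<And>q. q \<in> Z \<Longrightarrow> fst q < s"
  proof -
    have "fst q \<le> Max (insert 0 (fst ` Z))" if "q \<in> Z" for q
      using Z that by (intro Max_ge) auto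
    then have "fst q < Max (insert 0 (fst ` Z)) + 1" if "q \<in> Z" for q
      using that by fastforce
    then show ?thesis
      using that by blast
  qed
  have "{q \<in> Z. fst q < s} = Z"
    using s by auto
  then have "{q \<in> greedy \<phi> t Z n. fst q < s} = {q \<in> greedy \<phi> t Z (card Z). fst q < s}"
    using n by (intro greedy_stable[OF Z]) auto
  moreover have "{q \<in> greedy \<phi> t Z k. fst q < s} = greedy \<phi> t Z k" for k
    using s greedy_subset[of \<phi> t Z k] by auto
  ultimately show ?thesis
    by simp
qed

text \<open>Neither loss of the upper bound occurs for this selection: a rejected point has zero
  gain, and by \<open>pos\<close> the unrounded gain of an accepted point is nonnegative, so its
  positive part is the gain itself. The subsolution property then gives the opposite
  inequality.\<close>

lemma pathwise_lower_bound:
  fixes h h' \<phi> :: "real \<Rightarrow> real"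
  assumes deriv: "\<And>z. z \<ge> 0 \<Longrightarrow> (h has_real_derivative h' z) (at z)"
    and meas: "h \<in> borel_measurable borel" "h' \<in> borel_measurable borel" "\<phi> \<in> borel_measurable borel"
    and \<phi>: "\<And>z. z \<ge> 0 \<Longrightarrow> \<phi> z \<le> 1"
    and pos: "\<And>z x. z \<ge> 0 \<Longrightarrow> x \<in> {0<..\<phi> z} \<Longrightarrow> 0 \<le> 1 + h (z * (1 - x)) - h z"
    and sub: "\<And>z. z \<ge> 0 \<Longrightarrow> ennreal (h' z) \<le> (\<integral>\<^sup>+x\<in>{0<..\<phi> z}. ennreal (1 + h (z * (1 - x)) - h z) \<partial>lborel)"
    and Z: "finite Z" "Z \<subseteq> strip_until t"
    and D: "D = {p \<in> Z. accept \<phi> t (last_value D (fst p)) p}" "increasing_atoms D" and t: "0 \<le> t" "h 0 \<le> h t"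
  shows "ennreal (h t - h 0) + (\<Sum>p\<in>Z. gain h \<phi> t (last_value D (fst p)) p) \<le>
      of_nat (card D) + (\<integral>\<^sup>+p\<in>strip_until t. gain h \<phi> t (last_value D (fst p)) p \<partial>lborel)"
proof -
  have D': "finite D" "D \<subseteq> strip_until t" "D \<subseteq> Z"
    using Z D(1) by (auto intro: finite_subset[of D Z])
  have snd_D: "snd ` D \<subseteq> {0..1}"
    using D'(2) by (force simp: strip_until_def)
  note Y = last_value_bounds[OF D'(1) snd_D]
  have accepted: "accept \<phi> t (last_value D (fst p)) p" if "p \<in> D" for p
    using that D(1) by blast
  let ?F = "\<lambda>p. h ((t - fst p) * (1 - snd p)) - h ((t - fst p) * (1 - last_value D (fst p)))"
  let ?I = "h t - h 0 + (\<Sum>p\<in>D. ?F p)"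
  have F: "0 \<le> 1 + ?F p" if "p \<in> D" for p
  proof -
    define y where "y = last_value D (fst p)"
    define z where "z = (t - fst p) * (1 - y)"
    \<comment> \<open>The position of the accepted value relative to the range left above
      \<open>y\<close>, the coordinate in which \<open>pos\<close> is stated.\<close>
    define x where "x = (snd p - y) / (1 - y)"
    have p: "y < snd p" "snd p \<le> y + (1 - y) * \<phi> z" "snd p \<le> 1" "fst p \<le> t"
      using accepted[OF that] D'(2) that by (auto simp: accept_def y_def z_def strip_until_def)
    have z: "z \<ge> 0"
      using p by (simp add: z_def)
    moreover have "x \<in> {0<..\<phi> z}"
      using p by (simp add: x_def pos_divide_le_eq mult.commute)
    ultimately have "0 \<le> 1 + h (z * (1 - x)) - h z"
      by (rule pos)
    also have "z * (1 - x) = (t - fst p) * (1 - snd p)"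
    proof -
      have "(1 - y) * x = snd p - y"
        using p by (simp add: x_def)
      then have "(1 - y) * (1 - x) = 1 - snd p"
        by (simp only: right_diff_distrib) simp
      then show ?thesis
        by (simp add: z_def mult.assoc)
    qed
    finally show ?thesis
      by (simp add: y_def z_def)
  qed
  have "(\<Sum>p\<in>Z. gain h \<phi> t (last_value D (fst p)) p) = (\<Sum>p\<in>D. gain h \<phi> t (last_value D (fst p)) p)"
  proof (rule sum.mono_neutral_right)
    show "\<forall>p\<in>Z - D. gain h \<phi> t (last_value D (fst p)) p = 0"
    proof
      fix p assume "p \<in> Z - D"
      then have "\<not> accept \<phi> t (last_value D (fst p)) p"
        using D(1) by blast
      then show "gain h \<phi> t (last_value D (fst p)) p = 0"
        by (auto simp: gain_def accept_def indicator_def)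
    qed
  qed (use Z D' in auto)
  also have "\<dots> = (\<Sum>p\<in>D. ennreal (1 + h ((t - fst p) * (1 - snd p)) - h ((t - fst p) * (1 - last_value D (fst p)))))"
    using accepted by (intro sum_gain_eq D' D(2)) (simp add: accept_def)
  also have "\<dots> = ennreal (\<Sum>p\<in>D. 1 + ?F p)"
    using F by (subst sum_ennreal[symmetric]) (auto simp: add_diff_eq)
  finally have "ennreal (h t - h 0) + (\<Sum>p\<in>Z. gain h \<phi> t (last_value D (fst p)) p) =
      ennreal (h t - h 0) + ennreal (\<Sum>p\<in>D. 1 + ?F p)"
    by simp
  also have "\<dots> = ennreal (h t - h 0 + (\<Sum>p\<in>D. 1 + ?F p))"
    using t F by (intro ennreal_plus[symmetric] sum_nonneg) auto
  also have "h t - h 0 + (\<Sum>p\<in>D. 1 + ?F p) = real (card D) + ?I"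
    by (simp add: sum.distrib)
  \<comment> \<open>\<open>?I\<close> may be negative because \<open>h'\<close> may be, whereas
    \<open>ennreal\<close> is additive only on nonnegative reals.\<close>
  also have "ennreal \<dots> \<le> ennreal (real (card D) + max 0 ?I)"
    by (intro ennreal_leI) simp
  also have "\<dots> = of_nat (card D) + ennreal ?I"
    by (simp add: ennreal_plus ennreal_of_nat_eq_real_of_nat)
  also have "ennreal ?I \<le> (\<integral>\<^sup>+p\<in>strip_until t. gain h \<phi> t (last_value D (fst p)) p \<partial>lborel)"
  proof -
    have [measurable]: "last_value D \<in> borel_measurable borel"
      by (rule last_value_measurable[OF D'(1)])
    have "ennreal ?I \<le> (\<integral>\<^sup>+s\<in>{0..t}. ennreal ((1 - last_value D s) * h' ((t - s) * (1 - last_value D s))) \<partial>lborel)"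
    proof (rule ennreal_has_integral_le_nn_integral)
      show "(\<lambda>s. (1 - last_value D s) * h' ((t - s) * (1 - last_value D s))) \<in> borel_measurable borel"
        using meas(2) by measurable
    qed (auto intro!: telescoping_strip deriv D' D(2) t)
    also have "\<dots> \<le> (\<integral>\<^sup>+s\<in>{0<..t}. ennreal (1 - last_value D s) * (\<integral>\<^sup>+x\<in>{0<..\<phi> ((t - s) * (1 - last_value D s))}.
        ennreal (1 + h ((t - s) * (1 - last_value D s) * (1 - x)) - h ((t - s) * (1 - last_value D s))) \<partial>lborel) \<partial>lborel)"
    proof (rule nn_integral_mono_AE, rule AE_mp[OF AE_lborel_singleton[of 0]], rule AE_I2, rule impI)
      fix s :: real
      assume "s \<noteq> 0"
      define z where "z = (t - s) * (1 - last_value D s)"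
      have "ennreal ((1 - last_value D s) * h' z) \<le>
          ennreal (1 - last_value D s) * (\<integral>\<^sup>+x\<in>{0<..\<phi> z}. ennreal (1 + h (z * (1 - x)) - h z) \<partial>lborel)" if "s \<in> {0..t}"
      proof -
        have "z \<ge> 0"
          using that Y[of s] by (simp add: z_def)
        then show ?thesis
          using Y[of s] by (simp add: ennreal_mult' mult_left_mono sub)
      qed
      then show "ennreal ((1 - last_value D s) * h' ((t - s) * (1 - last_value D s))) * indicator {0..t} s \<le>
          ennreal (1 - last_value D s) * (\<integral>\<^sup>+x\<in>{0<..\<phi> ((t - s) * (1 - last_value D s))}.
          ennreal (1 + h ((t - s) * (1 - last_value D s) * (1 - x)) - h ((t - s) * (1 - last_value D s))) \<partial>lborel) * indicator {0<..t} s"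
        unfolding z_def[symmetric] using \<open>s \<noteq> 0\<close> by (auto simp: indicator_def)
    qed
    also have "\<dots> = (\<integral>\<^sup>+p\<in>strip_until t. gain h \<phi> t (last_value D (fst p)) p \<partial>lborel)"
      using meas \<phi> D' snd_D by (intro nn_integral_gain[symmetric]) auto
    finally show ?thesis .
  qed
  finally show ?thesis
    by (simp add: add_left_mono)
qed

text \<open>Arrivals are counted from \<open>0\<close>; the infimum of the empty set is \<open>\<infinity>\<close>.\<close>
definition nth_time :: "(real \<times> real) set \<Rightarrow> nat \<Rightarrow> ennreal" where
  "nth_time D i = (INF p\<in>{p \<in> D. i < card {q \<in> D. fst q \<le> fst p}}. ennreal (fst p))"

lemma nth_time_attained:
  assumes "finite D" "nth_time D i < \<infinity>"
  obtains p where "p \<in> D" "i < card {q \<in> D. fst q \<le> fst p}" "nth_time D i = ennreal (fst p)"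
proof -
  let ?S = "{p \<in> D. i < card {q \<in> D. fst q \<le> fst p}}"
  have ne: "?S \<noteq> {}"
  proof
    assume "?S = {}"
    then have "nth_time D i = \<infinity>"
      by (simp only: nth_time_def image_empty Inf_empty infinity_ennreal_def)
    with assms(2) show False
      by simp
  qed
  have "nth_time D i = Min ((\<lambda>p. ennreal (fst p)) ` ?S)"
    unfolding nth_time_def using assms(1) ne by (subst Min_Inf) auto
  also have "\<dots> \<in> (\<lambda>p. ennreal (fst p)) ` ?S"
    using assms(1) ne by (intro Min_in) auto
  finally show ?thesis
    using that by auto
qed

text \<open>Translates the stopping-time property into a statement about counts, whose adaptedness
  is known. Indexing from 0 makes the inequality strict.\<close>

lemma nth_time_le_iff:
  assumes D: "finite D" "\<And>p. p \<in> D \<Longrightarrow> 0 \<le> fst p" and r: "0 \<le> r"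
  shows "nth_time D i \<le> ennreal r \<longleftrightarrow> i < card {q \<in> D. fst q \<le> r}"
proof
  assume le: "nth_time D i \<le> ennreal r"
  then have "nth_time D i < \<infinity>"
    by (simp add: le_less_trans)
  then obtain p where p: "p \<in> D" "i < card {q \<in> D. fst q \<le> fst p}" "nth_time D i = ennreal (fst p)"
    using nth_time_attained[OF D(1)] by blast
  then have "fst p \<le> r"
    using le r by simp
  then have "card {q \<in> D. fst q \<le> fst p} \<le> card {q \<in> D. fst q \<le> r}"
    using D(1) by (intro card_mono) auto
  then show "i < card {q \<in> D. fst q \<le> r}"
    using p(2) by simp
next
  assume i: "i < card {q \<in> D. fst q \<le> r}"
  let ?E = "{q \<in> D. fst q \<le> r}"
  have "?E \<noteq> {}" "finite ?E"
    using i card_gt_0_iff[of ?E] by linarith+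
  then have "Max (fst ` ?E) \<in> fst ` ?E"
    by (intro Max_in) auto
  then obtain p where p: "p \<in> ?E" "fst p = Max (fst ` ?E)"
    by force
  have "{q \<in> D. fst q \<le> fst p} = ?E"
  proof (intro equalityI subsetI)
    fix q assume q: "q \<in> ?E"
    then have "fst q \<le> Max (fst ` ?E)"
      using \<open>finite ?E\<close> by (intro Max_ge finite_imageI imageI)
    then show "q \<in> {q \<in> D. fst q \<le> fst p}"
      using q p(2) by simp
  qed (use p(1) in auto)
  then have "nth_time D i \<le> ennreal (fst p)"
    unfolding nth_time_def using p i by (intro INF_lower) auto
  also have "\<dots> \<le> ennreal r"
    using p(1) by (intro ennreal_leI) simp
  finally show "nth_time D i \<le> ennreal r" .
qed

lemma nth_time_finite_iff:
  assumes D: "finite D" "\<And>p. p \<in> D \<Longrightarrow> 0 \<le> fst p"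
  shows "nth_time D i < \<infinity> \<longleftrightarrow> i < card D"
proof
  assume "nth_time D i < \<infinity>"
  then obtain p where p: "p \<in> D" "i < card {q \<in> D. fst q \<le> fst p}"
    using nth_time_attained[OF D(1)] by metis
  note p(2)
  also have "card {q \<in> D. fst q \<le> fst p} \<le> card D"
    using D(1) by (intro card_mono) auto
  finally show "i < card D" .
next
  assume i: "i < card D"
  define r where "r = Max (insert 0 (fst ` D))"
  have "fst q \<le> r" if "q \<in> D" for q
    unfolding r_def using D(1) that by (intro Max_ge) auto
  moreover have "0 \<le> r"
    unfolding r_def using D(1) by (intro Max_ge) auto
  ultimately have r: "0 \<le> r" "{q \<in> D. fst q \<le> r} = D"
    by auto
  have "nth_time D i \<le> ennreal r"
    using nth_time_le_iff[OF D r(1)] r(2) i by simp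
  then show "nth_time D i < \<infinity>"
    by (simp add: le_less_trans)
qed

text \<open>Two points with one arrival time would make consecutive times equal; injectivity of
  \<open>fst\<close> excludes this, so at least \<open>i + 1\<close> points arrive strictly before
  the next selection.\<close>

lemma nth_time_strictly_increasing:
  assumes D: "finite D" "\<And>p. p \<in> D \<Longrightarrow> 0 \<le> fst p" and inj: "inj_on fst D"
  shows "nth_time D i < nth_time D (Suc i) \<or> nth_time D (Suc i) = \<infinity>"
proof (cases "nth_time D (Suc i) < \<infinity>")
  case True
  then obtain p where p: "p \<in> D" "Suc i < card {q \<in> D. fst q \<le> fst p}" "nth_time D (Suc i) = ennreal (fst p)"
    using nth_time_attained[OF D(1)] by blast
  let ?E = "{q \<in> D. fst q < fst p}"
  have "{q \<in> D. fst q \<le> fst p} = insert p ?E"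
  proof (intro equalityI subsetI)
    fix q assume q: "q \<in> {q \<in> D. fst q \<le> fst p}"
    show "q \<in> insert p ?E"
    proof (cases "fst q = fst p")
      case True
      then have "q = p"
        using inj_onD[OF inj] q p(1) by blast
      then show ?thesis
        by blast
    qed (use q in auto)
  qed (use p in auto)
  then have i: "i < card ?E"
    using p(2) D(1) by simp
  then have "?E \<noteq> {}" "finite ?E"
    using card_gt_0_iff[of ?E] by linarith+
  then have "Max (fst ` ?E) \<in> fst ` ?E"
    by (intro Max_in) auto
  then obtain p' where p': "p' \<in> ?E" "fst p' = Max (fst ` ?E)"
    by force
  have "?E \<subseteq> {q \<in> D. fst q \<le> fst p'}"
  proof
    fix q assume q: "q \<in> ?E"
    then have "fst q \<le> Max (fst ` ?E)"
      using \<open>finite ?E\<close> by (intro Max_ge finite_imageI imageI)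
    then show "q \<in> {q \<in> D. fst q \<le> fst p'}"
      using q p'(2) by simp
  qed
  then have "card ?E \<le> card {q \<in> D. fst q \<le> fst p'}"
    using D(1) by (intro card_mono) auto
  then have "nth_time D i \<le> ennreal (fst p')"
    using i p'(1) D(2) by (subst nth_time_le_iff[OF D]) auto
  also have "\<dots> < ennreal (fst p)"
    using p' D(2)[of p'] by (simp add: ennreal_less_iff)
  finally show ?thesis
    using p(3) by simp
qed (simp add: not_less top_unique)

section \<open>Simultaneous atoms, adaptedness and expectation of the threshold policy\<close>

context unit_poisson_process
begin

text \<open>With \<open>l\<close> the area, the probability is 1 - (1 + l) exp(-l), and exp(-l) is
  at least 1 - l.\<close>

lemma prob_two_atoms_le:
  assumes B: "B \<in> sets borel" "bounded B" "B \<subseteq> strip"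
  shows "prob {\<omega> \<in> space M. 2 \<le> num_atoms X B \<omega>} \<le> (measure lborel B)\<^sup>2"
proof -
  define l where "l = measure lborel B"
  have l: "0 \<le> l"
    by (simp add: l_def)
  have [measurable]: "num_atoms X B \<in> M \<rightarrow>\<^sub>M count_space UNIV"
    by (rule num_atoms_measurable[OF B(1,2)])
  have "{\<omega> \<in> space M. 2 \<le> num_atoms X B \<omega>} =
      space M - ({\<omega> \<in> space M. num_atoms X B \<omega> = 0} \<union> {\<omega> \<in> space M. num_atoms X B \<omega> = 1})"
    by auto
  also have "prob \<dots> = 1 - prob ({\<omega> \<in> space M. num_atoms X B \<omega> = 0} \<union> {\<omega> \<in> space M. num_atoms X B \<omega> = 1})"
    by (rule prob_compl) measurable
  also have "prob ({\<omega> \<in> space M. num_atoms X B \<omega> = 0} \<union> {\<omega> \<in> space M. num_atoms X B \<omega> = 1}) =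
      prob {\<omega> \<in> space M. num_atoms X B \<omega> = 0} + prob {\<omega> \<in> space M. num_atoms X B \<omega> = 1}"
    by (rule finite_measure_Union) auto
  also have "\<dots> = (1 + l) * exp (- l)"
    using num_atoms_poisson[OF B, of 0] num_atoms_poisson[OF B, of 1] by (simp add: l_def distrib_right)
  also have "(1 + l) * (1 - l) \<le> (1 + l) * exp (- l)"
    using l exp_ge_add_one_self[of "- l"] by (intro mult_left_mono) auto
  then have "1 - (1 + l) * exp (- l) \<le> l\<^sup>2"
    by (simp add: power2_eq_square algebra_simps)
  finally show ?thesis
    by (simp add: l_def)
qed

text \<open>Cut the strip into \<open>n\<close> vertical slices of width t/n. Simultaneous atoms
  share a slice for every \<open>n\<close>, which has probability at most n (t/n)^2 = t^2/n.\<close>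

lemma AE_distinct_times:
  assumes t: "0 < t"
  shows "AE \<omega> in M. inj_on fst (X \<omega> \<inter> strip_until t)"
proof -
  define J where "J = (\<lambda>n k :: nat. {t * real k / real n<..t * real (Suc k) / real n} \<times> {0..1} :: (real \<times> real) set)"
  define E where "E = (\<lambda>n. \<Union>k<n. {\<omega> \<in> space M. 2 \<le> num_atoms X (J n k) \<omega>})"
  have J: "J n k \<in> sets borel" "bounded (J n k)" "J n k \<subseteq> strip" for n k
  proof -
    show "J n k \<in> sets borel"
      unfolding J_def by (intro borel_Times) auto
    show "bounded (J n k)"
      unfolding J_def by (intro bounded_Times) (auto intro: bounded_subset[OF bounded_closed_interval])
    have "0 \<le> t * real k / real n"
      using t by simp
    then show "J n k \<subseteq> strip"
      unfolding J_def strip_def by auto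
  qed
  have E_sets [measurable]: "E n \<in> events" for n
    unfolding E_def using num_atoms_measurable[OF J(1,2)] by measurable
  have "prob (E n) \<le> t\<^sup>2 / real n" if n: "n > 0" for n
  proof -
    have "prob (E n) \<le> (\<Sum>k<n. prob {\<omega> \<in> space M. 2 \<le> num_atoms X (J n k) \<omega>})"
      unfolding E_def using num_atoms_measurable[OF J(1,2)] by (intro finite_measure_subadditive_finite) auto
    also have "\<dots> \<le> (\<Sum>k<n. (t / real n)\<^sup>2)"
    proof (rule sum_mono)
      fix k
      have len: "t * real (Suc k) / real n - t * real k / real n = t / real n"
        by (simp add: diff_divide_distrib[symmetric] right_diff_distrib[symmetric])
      have "emeasure lborel (J n k) = emeasure lborel {t * real k / real n<..t * real (Suc k) / real n} * emeasure lborel {0..1::real}"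
        unfolding J_def by (subst lborel_prod[symmetric], subst lborel.emeasure_pair_measure_Times) auto
      also have "\<dots> = ennreal (t / real n)"
        unfolding len[symmetric] using t n by (subst emeasure_lborel_Ioc) (auto intro!: divide_right_mono)
      finally have "measure lborel (J n k) = t / real n"
        using t by (simp add: measure_def)
      then show "prob {\<omega> \<in> space M. 2 \<le> num_atoms X (J n k) \<omega>} \<le> (t / real n)\<^sup>2"
        using prob_two_atoms_le[OF J, of n k] by simp
    qed
    also have "\<dots> = t\<^sup>2 / real n"
      using n by (simp add: power2_eq_square)
    finally show ?thesis .
  qed
  moreover have "prob (\<Inter>n. E (Suc n)) \<le> prob (E (Suc n))" for n
    by (intro finite_measure_mono) auto
  ultimately have "prob (\<Inter>n. E (Suc n)) \<le> t\<^sup>2 / real (Suc n)" for n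
    by (meson order.trans zero_less_Suc)
  moreover have "(\<lambda>n. t\<^sup>2 / real (Suc n)) \<longlonglongrightarrow> 0"
    by (rule LIMSEQ_Suc[OF lim_const_over_n])
  ultimately have "prob (\<Inter>n. E (Suc n)) \<le> 0"
    by (intro LIMSEQ_le_const) auto
  then have "prob (\<Inter>n. E (Suc n)) = 0"
    by (simp add: measure_le_0_iff)
  then have null: "(\<Inter>n. E (Suc n)) \<in> null_sets M"
    by (intro null_setsI) (auto simp: emeasure_eq_measure)
  show ?thesis
  proof (rule AE_I'[OF null], rule subsetI, rule INT_I)
    fix \<omega> n assume "\<omega> \<in> {\<omega> \<in> space M. \<not> inj_on fst (X \<omega> \<inter> strip_until t)}"
    then obtain p q where \<omega>: "\<omega> \<in> space M" and p: "p \<in> X \<omega> \<inter> strip_until t" and q: "q \<in> X \<omega> \<inter> strip_until t"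
      and pq: "fst p = fst q" "p \<noteq> q"
      by (auto simp: inj_on_def)
    have s: "0 < fst p" "fst p \<le> t"
      using p by (auto simp: strip_until_def)
    \<comment> \<open>The slices are left-open and right-closed, hence the ceiling minus
      one.\<close>
    define k where "k = nat (\<lceil>fst p * real (Suc n) / t\<rceil> - 1)"
    have pos: "0 < fst p * real (Suc n) / t"
      using s t by simp
    then have k: "real k = of_int \<lceil>fst p * real (Suc n) / t\<rceil> - 1"
      unfolding k_def by (simp add: of_nat_nat)
    have 1: "real k < fst p * real (Suc n) / t" "fst p * real (Suc n) / t \<le> real (Suc k)"
      using k by linarith+
    have "fst p * real (Suc n) / t \<le> real (Suc n)"
      using s t by (simp add: divide_le_eq mult.commute mult_left_mono)
    then have "k < Suc n"
      using 1 by linarith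
    have "fst p \<in> {t * real k / real (Suc n)<..t * real (Suc k) / real (Suc n)}"
      using 1 t by (auto simp del: of_nat_Suc simp: field_simps)
    then have "{p, q} \<subseteq> X \<omega> \<inter> J (Suc n) k"
      using p q pq(1) unfolding J_def strip_until_def by auto
    then have "card {p, q} \<le> num_atoms X (J (Suc n) k) \<omega>"
      by (intro card_mono locally_finite[OF \<omega> J(2)])
    then have "2 \<le> num_atoms X (J (Suc n) k) \<omega>"
      using pq(2) by simp
    then show "\<omega> \<in> E (Suc n)"
      unfolding E_def using \<omega> \<open>k < Suc n\<close> by blast
  qed
qed

lemma accept_predictable:
  assumes [measurable]: "\<phi> \<in> borel_measurable borel" "y \<in> borel_measurable predictable"
  shows "Measurable.pred predictable (\<lambda>x. accept \<phi> t (y x) (snd x))"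
proof -
  have [measurable]: "(\<lambda>x. fst (snd x)) \<in> borel_measurable predictable" "(\<lambda>x. snd (snd x)) \<in> borel_measurable predictable"
    using measurable_predictable_snd unfolding borel_prod[symmetric] by measurable
  show ?thesis
    unfolding accept_def by measurable
qed

text \<open>The counterpart of \<open>policy_selection_adapted\<close> for a selection given by a
  predictable rule instead of stopping times.\<close>

lemma exists_selected_adapted:
  assumes C: "Measurable.pred predictable (\<lambda>x. P (fst x) (snd x))"
  shows "{\<omega> \<in> space M. \<exists>p\<in>{p \<in> X \<omega> \<inter> strip_until t. P \<omega> p}. fst p \<le> r \<and> y < snd p}
    \<in> sets (natural_filtration M X (ennreal r))"
proof -
  have [measurable]: "(\<lambda>x. fst (snd x)) \<in> borel_measurable predictable" "(\<lambda>x. snd (snd x)) \<in> borel_measurable predictable"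
    using measurable_predictable_snd unfolding borel_prod[symmetric] by measurable
  note C [measurable]
  define S where "S = {x \<in> space predictable. fst (snd x) \<le> t \<and> y < snd (snd x) \<and> P (fst x) (snd x)}"
  have "S \<in> sets predictable"
    unfolding S_def by measurable
  then have "{\<omega> \<in> space M. \<exists>p\<in>X \<omega> \<inter> strip_until r. (\<omega>, p) \<in> S} \<in> sets (natural_filtration M X (ennreal r))"
    by (rule exists_predictable_atom_adapted)
  also have "{\<omega> \<in> space M. \<exists>p\<in>X \<omega> \<inter> strip_until r. (\<omega>, p) \<in> S} =
      {\<omega> \<in> space M. \<exists>p\<in>{p \<in> X \<omega> \<inter> strip_until t. P \<omega> p}. fst p \<le> r \<and> y < snd p}"
  proof (intro Collect_cong conj_cong refl)
    fix \<omega> assume \<omega>: "\<omega> \<in> space M"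
    have "p \<in> strip_until r \<and> (\<omega>, p) \<in> S \<longleftrightarrow> p \<in> strip_until t \<and> P \<omega> p \<and> fst p \<le> r \<and> y < snd p" for p
      using \<omega> by (cases p) (auto simp: S_def strip_until_def)
    then show "(\<exists>p\<in>X \<omega> \<inter> strip_until r. (\<omega>, p) \<in> S) \<longleftrightarrow>
        (\<exists>p\<in>{p \<in> X \<omega> \<inter> strip_until t. P \<omega> p}. fst p \<le> r \<and> y < snd p)"
      by blast
  qed
  finally show ?thesis .
qed

text \<open>Each iteration closes a loop: a predictable record gives a predictable acceptance rule,
  this gives an adapted selection, and its record is again predictable.\<close>

lemma greedy_last_value_predictable:
  assumes \<phi>: "\<phi> \<in> borel_measurable borel"
  shows "(\<lambda>x. last_value (greedy \<phi> t (X (fst x) \<inter> strip_until t) n) (fst (snd x))) \<in> borel_measurable predictable"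
proof (induction n)
  case 0
  then show ?case
    by (simp add: last_value_def)
next
  case (Suc n)
  show ?case
  proof (rule last_value_predictable)
    show "finite (greedy \<phi> t (X \<omega> \<inter> strip_until t) (Suc n))" if "\<omega> \<in> space M" for \<omega>
      using greedy_subset locally_finite[OF that bounded_strip_until] by (rule finite_subset)
    show "{\<omega> \<in> space M. \<exists>p\<in>greedy \<phi> t (X \<omega> \<inter> strip_until t) (Suc n). fst p \<le> r \<and> y < snd p}
        \<in> sets (natural_filtration M X (ennreal r))" for r y
      unfolding greedy.simps
      using accept_predictable[OF \<phi> Suc] by (rule exists_selected_adapted)
  qed
qed

text \<open>The witness takes the arrival times of the greedy fixed point as its stopping times.
  Expectations are then compared as in the upper bound; \<open>almost_mono\<close> bounds each gain
  by \<open>1 + c\<close> and so keeps the cancelled area finite.\<close>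

theorem policy_lower_bound:
  fixes h h' \<phi> :: "real \<Rightarrow> real"
  assumes deriv: "\<And>z. z \<ge> 0 \<Longrightarrow> (h has_real_derivative h' z) (at z)"
    and meas: "h \<in> borel_measurable borel" "h' \<in> borel_measurable borel" "\<phi> \<in> borel_measurable borel"
    and \<phi>: "\<And>z. z \<ge> 0 \<Longrightarrow> \<phi> z \<le> 1"
    and pos: "\<And>z x. z \<ge> 0 \<Longrightarrow> x \<in> {0<..\<phi> z} \<Longrightarrow> 0 \<le> 1 + h (z * (1 - x)) - h z"
    and sub: "\<And>z. z \<ge> 0 \<Longrightarrow> ennreal (h' z) \<le> (\<integral>\<^sup>+x\<in>{0<..\<phi> z}. ennreal (1 + h (z * (1 - x)) - h z) \<partial>lborel)"
    and almost_mono: "\<And>a b. 0 \<le> a \<Longrightarrow> a \<le> b \<Longrightarrow> h a \<le> h b + c"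
    and t: "0 < t"
  obtains \<tau> where "online_policy M X t \<tau>" "ennreal (h t - h 0) \<le> expected_length M \<tau>"
proof -
  define Z where "Z = (\<lambda>\<omega>. X \<omega> \<inter> strip_until t)"
  define D where "D = (\<lambda>\<omega>. greedy \<phi> t (Z \<omega>) (card (Z \<omega>)))"
  \<comment> \<open>\<open>D\<close> iterates \<open>card (Z \<omega>)\<close> times, a number that
    depends on the future. Acceptance by all late iterates describes the same set through countably
    many predictable conditions.\<close>
  define P where "P = (\<lambda>\<omega> p. \<exists>N. \<forall>n\<ge>N. accept \<phi> t (last_value (greedy \<phi> t (Z \<omega>) n) (fst p)) p)"
  have Z: "finite (Z \<omega>)" if "\<omega> \<in> space M" for \<omega>
    unfolding Z_def using that by (rule locally_finite[OF _ bounded_strip_until])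
  have D_fix: "D \<omega> = {p \<in> Z \<omega>. accept \<phi> t (last_value (D \<omega>) (fst p)) p}" if "\<omega> \<in> space M" for \<omega>
    unfolding D_def using greedy_limit[OF Z[OF that], of "Suc (card (Z \<omega>))" \<phi> t] by simp
  have D_P: "D \<omega> = {p \<in> Z \<omega>. P \<omega> p}" if \<omega>: "\<omega> \<in> space M" for \<omega>
  proof -
    have "accept \<phi> t (last_value (greedy \<phi> t (Z \<omega>) n) (fst p)) p \<longleftrightarrow> accept \<phi> t (last_value (D \<omega>) (fst p)) p"
      if "card (Z \<omega>) \<le> n" for n p
      unfolding D_def greedy_limit[OF Z[OF \<omega>] that] ..
    then have "P \<omega> p \<longleftrightarrow> accept \<phi> t (last_value (D \<omega>) (fst p)) p" for p
      unfolding P_def by (metis nle_le)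
    then show ?thesis
      using D_fix[OF \<omega>] by simp
  qed
  have D_sub: "D \<omega> \<subseteq> Z \<omega>" for \<omega>
    unfolding D_def by (rule greedy_subset)
  have D_fin: "finite (D \<omega>)" if "\<omega> \<in> space M" for \<omega>
    using D_sub Z[OF that] by (rule finite_subset)
  have D_pos: "0 \<le> fst p" if "p \<in> D \<omega>" for p \<omega>
    using that D_sub[of \<omega>] by (auto simp: Z_def strip_until_def)
  have P_pred [measurable]: "Measurable.pred predictable (\<lambda>x. P (fst x) (snd x))"
  proof -
    have [measurable]: "Measurable.pred predictable
        (\<lambda>x. accept \<phi> t (last_value (greedy \<phi> t (Z (fst x)) n) (fst (snd x))) (snd x))" for n
      unfolding Z_def by (intro accept_predictable meas greedy_last_value_predictable)
    show ?thesis
      unfolding P_def by measurable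
  qed
  define \<tau> where "\<tau> = (\<lambda>i \<omega>. nth_time (D \<omega>) i)"

  have stopping: "stopping_time (natural_filtration M X) (\<tau> i)" for i
  proof (rule stopping_timeI)
    fix c :: ennreal
    show "Measurable.pred (natural_filtration M X c) (\<lambda>\<omega>. \<tau> i \<omega> \<le> c)"
    proof (cases c)
      case (real r)
      have [measurable]: "(\<lambda>x. fst (snd x)) \<in> borel_measurable predictable"
        using measurable_predictable_snd unfolding borel_prod[symmetric] by measurable
      define S where "S = {x \<in> space predictable. fst (snd x) \<le> t \<and> P (fst x) (snd x)}"
      have "S \<in> sets predictable"
        unfolding S_def by measurable
      note [measurable] = card_predictable_atoms_adapted[OF this, of r]
      have "Measurable.pred (natural_filtration M X c) (\<lambda>\<omega>. i < card {p \<in> X \<omega> \<inter> strip_until r. (\<omega>, p) \<in> S})"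
        unfolding real(2) by measurable
      moreover have "\<tau> i \<omega> \<le> c \<longleftrightarrow> i < card {p \<in> X \<omega> \<inter> strip_until r. (\<omega>, p) \<in> S}" if \<omega>: "\<omega> \<in> space M" for \<omega>
      proof -
        have "{p \<in> X \<omega> \<inter> strip_until r. (\<omega>, p) \<in> S} = {q \<in> D \<omega>. fst q \<le> r}"
          unfolding D_P[OF \<omega>] Z_def using \<omega> by (auto simp: S_def strip_until_def)
        then show ?thesis
          unfolding \<tau>_def real(2) using nth_time_le_iff[OF D_fin[OF \<omega>] D_pos real(1)] by simp
      qed
      ultimately show ?thesis
        by (subst measurable_cong) auto
    qed simp
  qed

  have incr: "increasing_atoms (D \<omega>)" if \<omega>: "\<omega> \<in> space M" and inj: "inj_on fst (Z \<omega>)" for \<omega>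
  proof -
    have less: "snd p < snd q" if "p \<in> D \<omega>" "q \<in> D \<omega>" "fst p < fst q" for p q
    proof -
      have "snd p \<le> last_value (D \<omega>) (fst q)"
        using last_value_le_iff[OF D_fin[OF \<omega>], of "fst q" "last_value (D \<omega>) (fst q)"] that by auto
      also have "\<dots> < snd q"
        using that(2) D_fix[OF \<omega>] unfolding accept_def by blast
      finally show ?thesis .
    qed
    have "fst p \<noteq> fst q" if "p \<in> D \<omega>" "q \<in> D \<omega>" "p \<noteq> q" for p q
      using that inj_onD[OF inj, of p q] D_sub[of \<omega>] by blast
    then show ?thesis
      unfolding increasing_atoms_def using less by (metis linorder_neqE)
  qed

  have good: "AE \<omega> in M. \<omega> \<in> space M \<and> inj_on fst (Z \<omega>) \<and> (\<forall>p\<in>X \<omega>. fst p \<le> t \<longrightarrow> p \<in> strip_until t)"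
    using AE_space AE_distinct_times[OF t] AE_atoms_in_strip_until[OF less_imp_le[OF t]] unfolding Z_def by eventually_elim auto
  have policy: "online_policy M X t \<tau>"
    unfolding online_policy_def
  proof (intro conjI allI stopping)
    show "AE \<omega> in M. (\<forall>i. \<tau> i \<omega> < \<tau> (Suc i) \<omega> \<or> \<tau> (Suc i) \<omega> = \<infinity>) \<and>
        (\<forall>i. \<tau> i \<omega> = \<infinity> \<or> (\<exists>p\<in>X \<omega>. fst p \<le> t \<and> \<tau> i \<omega> = ennreal (fst p))) \<and>
        increasing_atoms (selected_atoms X \<tau> \<omega>)"
      using good
    proof eventually_elim
      case (elim \<omega>)
      then have \<omega>: "\<omega> \<in> space M" and inj: "inj_on fst (Z \<omega>)"
        by auto
      have attained: "\<exists>p\<in>D \<omega>. \<tau> i \<omega> = ennreal (fst p)" if "\<tau> i \<omega> \<noteq> \<infinity>" for i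
        using that nth_time_attained[OF D_fin[OF \<omega>], of i] unfolding \<tau>_def by (metis infinity_ennreal_def less_top)
      \<comment> \<open>\<open>selected_atoms\<close> recognises atoms by their time alone, so an
        atom simultaneous with a selected one would enter as well; distinct arrival times exclude
        it.\<close>
      have "selected_atoms X \<tau> \<omega> \<subseteq> D \<omega>"
      proof
        fix p assume "p \<in> selected_atoms X \<tau> \<omega>"
        then obtain i where p: "p \<in> X \<omega>" "\<tau> i \<omega> = ennreal (fst p)"
          by (auto simp: selected_atoms_def)
        then obtain q where q: "q \<in> D \<omega>" "ennreal (fst p) = ennreal (fst q)"
          using attained[of i] by auto
        have "0 \<le> fst p"
          using atoms_in_strip[OF \<omega>] p(1) by (auto simp: strip_def)
        then have "fst p = fst q"
          using q D_pos by simp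
        moreover have "q \<in> Z \<omega>"
          using q D_sub by blast
        moreover from this have "fst q \<le> t"
          by (auto simp: Z_def strip_until_def)
        ultimately have "p \<in> Z \<omega>" "q \<in> Z \<omega>" "fst p = fst q"
          using elim p(1) unfolding Z_def by auto
        then have "p = q"
          using inj_onD[OF inj] by blast
        then show "p \<in> D \<omega>"
          using q by simp
      qed
      then have "increasing_atoms (selected_atoms X \<tau> \<omega>)"
        using incr[OF \<omega> inj] unfolding increasing_atoms_def by blast
      moreover have "\<tau> i \<omega> < \<tau> (Suc i) \<omega> \<or> \<tau> (Suc i) \<omega> = \<infinity>" for i
        unfolding \<tau>_def using inj_on_subset[OF inj D_sub] D_pos by (intro nth_time_strictly_increasing D_fin[OF \<omega>])
      moreover have "\<tau> i \<omega> = \<infinity> \<or> (\<exists>p\<in>X \<omega>. fst p \<le> t \<and> \<tau> i \<omega> = ennreal (fst p))" for i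
      proof -
        have "p \<in> X \<omega> \<and> fst p \<le> t" if "p \<in> D \<omega>" for p
          using that D_sub[of \<omega>] by (auto simp: Z_def strip_until_def)
        then show ?thesis
          using attained[of i] by blast
      qed
      ultimately show ?case
        by blast
    qed
  qed

  have len: "expected_length M \<tau> = (\<integral>\<^sup>+\<omega>. of_nat (card (D \<omega>)) \<partial>M)"
    unfolding expected_length_def
  proof (rule nn_integral_cong)
    fix \<omega> assume \<omega>: "\<omega> \<in> space M"
    have fin_iff: "\<tau> i \<omega> < \<infinity> \<longleftrightarrow> i < card (D \<omega>)" for i
      unfolding \<tau>_def using D_pos by (intro nth_time_finite_iff D_fin[OF \<omega>])
    have "(\<Sum>i. indicator {\<omega>. \<tau> i \<omega> < \<infinity>} \<omega> :: ennreal) = (\<Sum>i\<in>{..<card (D \<omega>)}. indicator {\<omega>. \<tau> i \<omega> < \<infinity>} \<omega>)"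
      using fin_iff by (intro suminf_finite) (auto simp: indicator_def)
    also have "\<dots> = (\<Sum>i\<in>{..<card (D \<omega>)}. 1)"
      using fin_iff by (intro sum.cong) (auto simp: indicator_def)
    finally show "(\<Sum>i. indicator {\<omega>. \<tau> i \<omega> < \<infinity>} \<omega> :: ennreal) = of_nat (card (D \<omega>))"
      by simp
  qed

  define K where "K = (\<lambda>x. gain h \<phi> t (last_value (D (fst x)) (fst (snd x))) (snd x))"
  have "(\<lambda>x. last_value (D (fst x)) (fst (snd x))) \<in> borel_measurable predictable"
  proof (rule last_value_predictable[OF D_fin])
    fix r y
    have "{\<omega> \<in> space M. \<exists>p\<in>D \<omega>. fst p \<le> r \<and> y < snd p} =
        {\<omega> \<in> space M. \<exists>p\<in>{p \<in> X \<omega> \<inter> strip_until t. P \<omega> p}. fst p \<le> r \<and> y < snd p}"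
      by (intro Collect_cong conj_cong refl) (simp only: D_P Z_def)
    also have "\<dots> \<in> sets (natural_filtration M X (ennreal r))"
      by (rule exists_selected_adapted[OF P_pred])
    finally show "{\<omega> \<in> space M. \<exists>p\<in>D \<omega>. fst p \<le> r \<and> y < snd p} \<in> sets (natural_filtration M X (ennreal r))" .
  qed
  then have K: "K \<in> borel_measurable predictable"
    unfolding K_def by (intro gain_measurable meas) auto
  let ?atoms = "\<lambda>\<omega>. \<integral>\<^sup>+p. K (\<omega>, p) \<partial>count_space (X \<omega> \<inter> strip_until t)"
  let ?area = "\<lambda>\<omega>. \<integral>\<^sup>+p\<in>strip_until t. K (\<omega>, p) \<partial>lborel"
  show ?thesis
  proof (cases "h 0 \<le> h t")
    case False
    then show ?thesis
      using that[OF policy] by (simp add: ennreal_neg)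
  next
    case True
    have path: "AE \<omega> in M. ennreal (h t - h 0) + ?atoms \<omega> \<le> of_nat (card (D \<omega>)) + ?area \<omega>"
      using good
    proof eventually_elim
      case (elim \<omega>)
      then have \<omega>: "\<omega> \<in> space M" and inj: "inj_on fst (Z \<omega>)"
        by auto
      have "Z \<omega> \<subseteq> strip_until t"
        by (auto simp: Z_def)
      from pathwise_lower_bound[OF deriv meas \<phi> pos sub Z[OF \<omega>] this D_fix[OF \<omega>] incr[OF \<omega> inj] less_imp_le[OF t] True]
      show ?case
        using nn_integral_count_space_finite[OF Z[OF \<omega>]] by (simp add: K_def Z_def)
    qed
    \<comment> \<open>Within the window the value exceeds the record, so the remaining area shrinks
      and \<open>h\<close> can rise by at most \<open>c\<close>.\<close>
    have area_le: "?area \<omega> \<le> ennreal (1 + c) * emeasure lborel (strip_until t)" if \<omega>: "\<omega> \<in> space M" for \<omega>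
    proof -
      have "?area \<omega> \<le> (\<integral>\<^sup>+p. ennreal (1 + c) * indicator (strip_until t) p \<partial>lborel)"
      proof (rule nn_integral_mono)
        fix p :: "real \<times> real"
        have "K (\<omega>, p) \<le> ennreal (1 + c)" if p: "p \<in> strip_until t"
        proof (cases "last_value (D \<omega>) (fst p) < snd p")
          case True
          then have "h ((t - fst p) * (1 - snd p)) \<le> h ((t - fst p) * (1 - last_value (D \<omega>) (fst p))) + c"
            using p by (intro almost_mono mult_left_mono) (auto simp: strip_until_def)
          then show ?thesis
            by (auto simp: K_def gain_def indicator_def intro!: ennreal_leI)
        qed (auto simp: K_def gain_def indicator_def)
        then show "K (\<omega>, p) * indicator (strip_until t) p \<le> ennreal (1 + c) * indicator (strip_until t) p"
          by (auto simp: indicator_def)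
      qed
      then show ?thesis
        by (simp add: nn_integral_cmult)
    qed
    have "(\<integral>\<^sup>+\<omega>. ?area \<omega> \<partial>M) \<le> (\<integral>\<^sup>+\<omega>. ennreal (1 + c) * emeasure lborel (strip_until t) \<partial>M)"
      by (intro nn_integral_mono area_le)
    also have "\<dots> = ennreal (1 + c) * emeasure lborel (strip_until t)"
      by (simp add: emeasure_space_1)
    also have "\<dots> < \<infinity>"
      using emeasure_bounded_finite[OF bounded_strip_until, of t] by (simp add: ennreal_mult_less_top)
    finally have area_finite: "(\<integral>\<^sup>+\<omega>. ?area \<omega> \<partial>M) \<noteq> \<infinity>"
      by simp
    have card_meas: "(\<lambda>\<omega>. of_nat (card (D \<omega>)) :: ennreal) \<in> borel_measurable M"
    proof -
      have S: "{x \<in> space predictable. P (fst x) (snd x)} \<in> sets predictable"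
        by measurable
      have "(\<lambda>\<omega>. card {p \<in> X \<omega> \<inter> strip_until t. (\<omega>, p) \<in> {x \<in> space predictable. P (fst x) (snd x)}})
          \<in> M \<rightarrow>\<^sub>M count_space UNIV"
        by (rule measurable_from_subalg[OF _ card_predictable_atoms_adapted[OF S, of t]])
           (use sets_natural_filtration_subset in \<open>auto simp: subalgebra_def\<close>)
      moreover have "D \<omega> = {p \<in> X \<omega> \<inter> strip_until t. (\<omega>, p) \<in> {x \<in> space predictable. P (fst x) (snd x)}}" if "\<omega> \<in> space M" for \<omega>
        using D_P[OF that] that by (auto simp: Z_def)
      ultimately have [measurable]: "(\<lambda>\<omega>. card (D \<omega>)) \<in> M \<rightarrow>\<^sub>M count_space UNIV"
        by (subst measurable_cong) auto
      show ?thesis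
        by measurable
    qed
    have "(\<integral>\<^sup>+\<omega>. ?area \<omega> \<partial>M) + ennreal (h t - h 0) = (\<integral>\<^sup>+\<omega>. ?atoms \<omega> \<partial>M) + ennreal (h t - h 0)"
      by (simp only: compensator_formula[OF K])
    also have "\<dots> = (\<integral>\<^sup>+\<omega>. ennreal (h t - h 0) + ?atoms \<omega> \<partial>M)"
      using measurable_nn_integral_atoms[OF K] by (simp add: nn_integral_add emeasure_space_1 add.commute)
    also have "\<dots> \<le> (\<integral>\<^sup>+\<omega>. of_nat (card (D \<omega>)) + ?area \<omega> \<partial>M)"
      using path by (intro nn_integral_mono_AE) auto
    also have "\<dots> = (\<integral>\<^sup>+\<omega>. ?area \<omega> \<partial>M) + expected_length M \<tau>"
      using measurable_nn_integral_strip[OF K] card_meas by (simp add: len nn_integral_add add.commute)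
    finally have "ennreal (h t - h 0) \<le> expected_length M \<tau>"
      using area_finite by (simp add: ennreal_add_left_cancel_le)
    then show ?thesis
      by (rule that[OF policy])
  qed
qed

end

subsection \<open>The asymptotics of the value\<close>

lemma approx_value_asymptotics:
  "(\<lambda>t. approx_value t - (sqrt (2 * t) - 1 / 12 * ln t)) \<in> O[at_top](\<lambda>_. 1)"
  unfolding approx_value_def by real_asymp

context unit_poisson_process
begin

text \<open>The increasing correction helps on both sides of the supersolution inequality: it adds
  its derivative on the right and lowers the increments inside the integral on the left.\<close>

lemma online_policies_upper_bound:
  obtains c where "\<And>t. 0 \<le> t \<Longrightarrow>
    (SUP \<tau> \<in> {\<tau>. online_policy M X t \<tau>}. expected_length M \<tau>) \<le> ennreal (approx_value t + c)"
proof -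
  obtain C where C: "C \<ge> 0" "\<And>z. z \<ge> 0 \<Longrightarrow>
    (\<integral>\<^sup>+x\<in>{0..1}. ennreal (1 + approx_value (z * (1 - x)) - approx_value z) \<partial>lborel)
      \<le> ennreal (approx_value_deriv z + correction_deriv C z)"
    using approx_value_supersolution by blast
  define g where "g = (\<lambda>z. approx_value z + correction C z)"
  define g' where "g' = (\<lambda>z. approx_value_deriv z + correction_deriv C z)"
  have bound: "expected_length M \<tau> \<le> ennreal (g t - g 0)" if t: "0 \<le> t" and \<tau>: "online_policy M X t \<tau>" for t \<tau>
  proof (rule policy_upper_bound[OF _ _ _ _ \<tau> t])
    fix z :: real assume z: "z \<ge> 0"
    show "(g has_real_derivative g' z) (at z)"
      unfolding g_def g'_def by (intro DERIV_add approx_value_has_derivative correction_has_derivative z)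
    show "0 \<le> g' z"
      unfolding g'_def using approx_value_deriv_bounds(1)[OF z] C(1) z by (auto simp: correction_deriv_def)
    have "(\<integral>\<^sup>+x\<in>{0..1}. ennreal (1 + g (z * (1 - x)) - g z) \<partial>lborel) \<le>
        (\<integral>\<^sup>+x\<in>{0..1}. ennreal (1 + approx_value (z * (1 - x)) - approx_value z) \<partial>lborel)"
    proof (rule nn_integral_mono)
      fix x :: real
      have "correction C (z * (1 - x)) \<le> correction C z" if "x \<in> {0..1}"
        using that z C(1) by (intro correction_mono) (auto simp: mult_left_le)
      then show "ennreal (1 + g (z * (1 - x)) - g z) * indicator {0..1} x \<le>
          ennreal (1 + approx_value (z * (1 - x)) - approx_value z) * indicator {0..1} x"
        unfolding g_def by (auto simp: indicator_def intro!: ennreal_leI)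
    qed
    also have "\<dots> \<le> ennreal (g' z)"
      unfolding g'_def by (rule C(2)[OF z])
    finally show "(\<integral>\<^sup>+x\<in>{0..1}. ennreal (1 + g (z * (1 - x)) - g z) \<partial>lborel) \<le> ennreal (g' z)" .
  next
    show "g \<in> borel_measurable borel"
      unfolding g_def approx_value_def correction_def by measurable
  qed
  have "(SUP \<tau> \<in> {\<tau>. online_policy M X t \<tau>}. expected_length M \<tau>) \<le> ennreal (approx_value t + (2 * C - g 0))"
    if t: "0 \<le> t" for t
  proof (rule SUP_least)
    fix \<tau> assume "\<tau> \<in> {\<tau>. online_policy M X t \<tau>}"
    then have "expected_length M \<tau> \<le> ennreal (g t - g 0)"
      using bound[OF t] by simp
    also have "\<dots> \<le> ennreal (approx_value t + (2 * C - g 0))"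
      using correction_bounds(2)[OF t C(1)] by (intro ennreal_leI) (simp add: g_def)
    finally show "expected_length M \<tau> \<le> ennreal (approx_value t + (2 * C - g 0))" .
  qed
  then show ?thesis
    by (rule that)
qed

text \<open>Subtracting the correction lowers the derivative and raises the increments, as a
  subsolution requires. Monotonicity may be lost, but only by \<open>2 * C\<close>, the range of the
  correction; this is the constant passed as \<open>c\<close>.\<close>

lemma online_policies_lower_bound:
  obtains c where "\<And>t. 0 < t \<Longrightarrow>
    ennreal (approx_value t - c) \<le> (SUP \<tau> \<in> {\<tau>. online_policy M X t \<tau>}. expected_length M \<tau>)"
proof -
  obtain C t0 where C: "C \<ge> 0"
    and pos: "\<And>z x. z \<ge> 0 \<Longrightarrow> x \<in> {0<..acceptance_width t0 z} \<Longrightarrow>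
      0 \<le> 1 + approx_value (z * (1 - x)) - approx_value z"
    and sub: "\<And>z. z \<ge> 0 \<Longrightarrow> ennreal (approx_value_deriv z - correction_deriv C z) \<le>
      (\<integral>\<^sup>+x\<in>{0<..acceptance_width t0 z}.
        ennreal (1 + approx_value (z * (1 - x)) - approx_value z) \<partial>lborel)"
    using approx_value_subsolution by blast
  define h where "h = (\<lambda>z. approx_value z - correction C z)"
  define h' where "h' = (\<lambda>z. approx_value_deriv z - correction_deriv C z)"
  have gain_le: "1 + approx_value (z * (1 - x)) - approx_value z \<le> 1 + h (z * (1 - x)) - h z"
    if "z \<ge> 0" "x \<in> {0<..acceptance_width t0 z}" for z x
  proof -
    have "x \<le> 1"
      using that acceptance_width_le_1[OF that(1), of t0] by simp
    then have "correction C (z * (1 - x)) \<le> correction C z"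
      using that C by (intro correction_mono) (auto simp: mult_left_le)
    then show ?thesis
      by (simp add: h_def)
  qed
  have "ennreal (approx_value t - (2 * C + h 0)) \<le> (SUP \<tau> \<in> {\<tau>. online_policy M X t \<tau>}. expected_length M \<tau>)"
    if t: "0 < t" for t
  proof -
    obtain \<tau> where \<tau>: "online_policy M X t \<tau>" "ennreal (h t - h 0) \<le> expected_length M \<tau>"
    proof (rule policy_lower_bound)
      fix z :: real assume z: "z \<ge> 0"
      show "(h has_real_derivative h' z) (at z)"
        unfolding h_def h'_def by (intro DERIV_diff approx_value_has_derivative correction_has_derivative z)
      show "acceptance_width t0 z \<le> 1"
        by (rule acceptance_width_le_1[OF z])
      have "ennreal (h' z) \<le> (\<integral>\<^sup>+x\<in>{0<..acceptance_width t0 z}.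
          ennreal (1 + approx_value (z * (1 - x)) - approx_value z) \<partial>lborel)"
        unfolding h'_def by (rule sub[OF z])
      also have "\<dots> \<le> (\<integral>\<^sup>+x\<in>{0<..acceptance_width t0 z}. ennreal (1 + h (z * (1 - x)) - h z) \<partial>lborel)"
        using gain_le[OF z] by (intro nn_integral_mono) (auto simp: indicator_def intro!: ennreal_leI)
      finally show "ennreal (h' z) \<le> (\<integral>\<^sup>+x\<in>{0<..acceptance_width t0 z}. ennreal (1 + h (z * (1 - x)) - h z) \<partial>lborel)" .
    next
      fix z x :: real assume "z \<ge> 0" "x \<in> {0<..acceptance_width t0 z}"
      then show "0 \<le> 1 + h (z * (1 - x)) - h z"
        using pos gain_le by (meson order.trans)
    next
      fix a b :: real assume ab: "0 \<le> a" "a \<le> b"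
      then show "h a \<le> h b + 2 * C"
        using approx_value_mono[OF ab] correction_bounds[of a C] correction_bounds[of b C] C by (simp add: h_def)
    next
      show "h \<in> borel_measurable borel" "h' \<in> borel_measurable borel" "acceptance_width t0 \<in> borel_measurable borel"
        unfolding h_def h'_def approx_value_def correction_def approx_value_deriv_def correction_deriv_def
        by measurable
    qed (use t in auto)
    have "ennreal (approx_value t - (2 * C + h 0)) \<le> ennreal (h t - h 0)"
      using correction_bounds(2)[of t C] t C by (intro ennreal_leI) (simp add: h_def)
    also have "\<dots> \<le> expected_length M \<tau>"
      by (rule \<tau>(2))
    also have "\<dots> \<le> (SUP \<tau> \<in> {\<tau>. online_policy M X t \<tau>}. expected_length M \<tau>)"
      using \<tau>(1) by (intro SUP_upper) simp
    finally show ?thesis .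
  qed
  then show ?thesis
    by (rule that)
qed

text \<open>\<open>enn2real\<close> sends infinity to 0, so the upper bound on the supremum also
  enters the lower estimate, where it guarantees finiteness.\<close>

lemma online_value_approx:
  obtains c where "\<And>t. 0 < t \<Longrightarrow> \<bar>online_value M X t - approx_value t\<bar> \<le> c"
proof -
  obtain a where a: "\<And>t. 0 \<le> t \<Longrightarrow>
      (SUP \<tau> \<in> {\<tau>. online_policy M X t \<tau>}. expected_length M \<tau>) \<le> ennreal (approx_value t + a)"
    using online_policies_upper_bound by blast
  obtain b where b: "\<And>t. 0 < t \<Longrightarrow>
      ennreal (approx_value t - b) \<le> (SUP \<tau> \<in> {\<tau>. online_policy M X t \<tau>}. expected_length M \<tau>)"
    using online_policies_lower_bound by blast
  have "\<bar>online_value M X t - approx_value t\<bar> \<le> \<bar>a\<bar> + \<bar>b\<bar>" if t: "0 < t" for t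
  proof -
    let ?S = "SUP \<tau> \<in> {\<tau>. online_policy M X t \<tau>}. expected_length M \<tau>"
    have S: "?S \<le> ennreal (approx_value t + \<bar>a\<bar>)"
      using a[of t] t by (meson abs_ge_self add_left_mono ennreal_leI less_imp_le order.trans)
    have "approx_value 0 \<le> approx_value t"
      using t by (intro approx_value_mono) auto
    moreover have "0 \<le> approx_value 0"
      by (simp add: approx_value_def)
    ultimately have nonneg: "0 \<le> approx_value t"
      by simp
    have "online_value M X t \<le> approx_value t + \<bar>a\<bar>"
      unfolding online_value_def using S nonneg by (intro enn2real_leI) auto
    moreover have "enn2real (ennreal (approx_value t - b)) \<le> enn2real ?S"
      using b[OF t] S by (intro enn2real_mono) (auto simp: le_less_trans)
    \<comment> \<open>If the left-hand side is negative, its \<open>ennreal\<close> image is 0 and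
      the bound follows from nonnegativity of the value.\<close>
    then have "approx_value t - b \<le> online_value M X t"
      by (cases "0 \<le> approx_value t - b") (auto simp: online_value_def intro: order.trans[OF _ enn2real_nonneg])
    ultimately show ?thesis
      by linarith
  qed
  then show ?thesis
    by (rule that)
qed

end

theorem theorem2p3:
  fixes M :: "'a measure" and X :: "'a \<Rightarrow> (real \<times> real) set"
  assumes "unit_poisson_process M X"
  shows "(\<lambda>t. online_value M X t - (sqrt (2 * t) - 1 / 12 * ln t)) \<in> O[at_top](\<lambda>_. 1)"
proof -
  interpret unit_poisson_process M X
    by (rule assms)
  obtain c where c: "\<And>t. 0 < t \<Longrightarrow> \<bar>online_value M X t - approx_value t\<bar> \<le> c"
    using online_value_approx by blast
  have "(\<lambda>t. online_value M X t - approx_value t) \<in> O[at_top](\<lambda>_. 1)"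
  proof (rule bigoI)
    show "eventually (\<lambda>t. norm (online_value M X t - approx_value t) \<le> c * norm (1 :: real)) at_top"
      using eventually_gt_at_top[of 0] by eventually_elim (simp add: c)
  qed
  from sum_in_bigo(1)[OF this approx_value_asymptotics]
  have "(\<lambda>t. online_value M X t - approx_value t + (approx_value t - (sqrt (2 * t) - 1 / 12 * ln t))) \<in> O[at_top](\<lambda>_. 1)" .
  also have "(\<lambda>t. online_value M X t - approx_value t + (approx_value t - (sqrt (2 * t) - 1 / 12 * ln t))) =
      (\<lambda>t. online_value M X t - (sqrt (2 * t) - 1 / 12 * ln t))"
    by (simp add: fun_eq_iff)
  finally show ?thesis .
qed

end
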